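(* Let $\mathbf I=\mathrm{diag}(I_1,I_2,I_3)$ with $0<I_i<\tfrac12$, $I_1+I_2+I_3=1$ satisfy the Lagrange stability conditions $I_1>I_3>I_2$, and consider the family, parametrized by $R>0$, of orthogonal relative equilibria $((\mathrm{Id},\mathbf R),\xi)$ of the second order system given by $$\mathbf R=(0,R,0),\qquad \xi=(\xi_1,0,0),\qquad \xi_1>0,\qquad \xi_1^2=\frac{2R^2+3-9I_2}{2R^5}.$$ Let $R_{\mathrm{crit}}$ be the unique positive solution of $2R^4+(9I_2-6I_1-3)R^2-15I_1+45I_1I_2=0$. Then this family loses stability at $R=R_{\mathrm{crit}}$ (it is $G^{\mathrm{asym}}_\mu$-stable for $R>R_{\mathrm{crit}}$ and linearly unstable for $R<R_{\mathrm{crit}}$), but no bifurcation occurs at that point: there is a neighborhood in $\mathbb R^3\times\mathbb R^3$ of the pair $(\mathbf R,\xi)$ with $R=R_{\mathrm{crit}}$ such that every pair $(\mathbf R',\xi')$ in it for which $((\mathrm{Id},\mathbf R'),\xi')$ is a relative equilibrium belongs to this same family of orthogonal relative equilibria.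
   Context: Second order satellite model. Units are chosen so that the satellite has mass $1$ and its inertia tensor has trace $1$. The configuration space is $Q=SO(3)\times(\mathbb R^3\setminus\{0\})$ with points $(B,\mathbf R)$ in body coordinates. Tangent vectors are written $(\Omega,\dot{\mathbf R})\in\mathbb R^3\times\mathbb R^3$ with $\dot B=B\widehat\Omega$, where $\widehat\Omega u=\Omega\times u$. The kinetic energy is $K=\frac12(\Omega\cdot\mathbf I\Omega+|\dot{\mathbf R}+\Omega\times\mathbf R|^2)$, the potential is $$V_2(\mathbf R)=-\frac1R-\frac1{2R^3}+\frac{3}{2R^5}\,\mathbf R\cdot\mathbf I\mathbf R,\qquad R=|\mathbf R|,$$ and the system on $T^*Q$ has Hamiltonian $H_2=K+V_2$. Symmetry. Let $\Gamma=\{\mathrm{diag}(\pm1,\pm1,\pm1)\}$ and $G^{\mathrm{asym}}=SO(3)\times\Gamma$, acting on $Q$ by $(M,A)\cdot(B,\mathbf R)=(MBA^T\det A,\,A\mathbf R)$ and on $T^*Q$ by cotangent lift; $H_2$ is invariant. The momentum map $\mathbf J:T^*Q\to\mathbb R^3$ is the total (spatial) angular momentum; the coadjoint action is $(M,A)\cdot\mu=M\mu$. A relative equilibrium with angular velocity $\xi\in\mathfrak{so}(3)\cong\mathbb R^3$ is a point $p\in T^*Q$ whose evolution is $t\mapsto\exp(t\widehat\xi)\cdot p$; a pair $((\mathrm{Id},\mathbf R),\xi)$ denotes the phase space point over $(\mathrm{Id},\mathbf R)$ that is the Legendre transform of $(\Omega,\dot{\mathbf R})=(\xi,0)$. Such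 a pair is a relative equilibrium if and only if $$\xi\times\big((\mathbf I-\mathbf R\mathbf R^T)\xi\big)=0,\qquad \nabla_{\mathbf R}V_2(\mathbf R)+\xi(\mathbf R\cdot\xi)-\mathbf R|\xi|^2=0 .$$ It is orthogonal if $\mathbf R\cdot\xi=0$. Its momentum is $\mu=(\mathbf I-\widehat{\mathbf R}\widehat{\mathbf R})\xi$, with stabilizer $G^{\mathrm{asym}}_\mu$. Stability. For a symmetry group $G$, a relative equilibrium $p$ with momentum $\mu$ is $G_\mu$-stable if for every $G_\mu$-invariant neighborhood $U$ of $G_\mu\cdot p$ there is a neighborhood $O$ of $p$ such that the Hamiltonian evolution of $O$ stays in $U$ for all time. It is linearly unstable if the linearization at $p$ of the Hamiltonian vector field of $H_2-\langle\mathbf J,\xi\rangle$, induced on the symplectic slice $\ker d\mathbf J(p)/(\mathfrak g_\mu\cdot p)$, has an eigenvalue with positive real part. *)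

theory Defs
  imports "HOL-Analysis.Analysis"
begin

text \<open>
  The cotangent bundle of \<open>Q = SO(3) \<times> (\<real>\<^sup>3 - {0})\<close> is left trivialised, i.e. written in body
  coordinates: \<open>(B, R, \<pi>, p)\<close> is the covector over \<open>(B, R)\<close> whose value on the tangent vector
  \<open>(\<Omega>, v)\<close>, meaning \<open>B' = B \<Omega>^\<close> and \<open>R' = v\<close>, is \<open>\<pi> \<bullet> \<Omega> + p \<bullet> v\<close>.
  It is treated as a submanifold of the vector space underlying the type \<open>phase\<close>.  Functions and
  forms are given by formulas that make sense near it in that vector space; all derivatives below
  are evaluated on tangent vectors of the submanifold only, where the choice of extension is
  irrelevant.
\<close>

type_synonym phase = "(real^3^3) \<times> (real^3) \<times> (real^3) \<times> (real^3)"

definition diag :: "real^3 \<Rightarrow> real^3^3" where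
  "diag a = (\<chi> i j. if i = j then a $ i else 0)"

definition hat :: "real^3 \<Rightarrow> real^3^3" where
  "hat w = matrix (\<lambda>u. cross3 w u)"

text \<open>Inverse of \<open>hat\<close> on skew-symmetric matrices.\<close>

definition vee :: "real^3^3 \<Rightarrow> real^3" where
  "vee A = vector [A $ 3 $ 2, A $ 1 $ 3, A $ 2 $ 1]"

definition mat_exp :: "real^3^3 \<Rightarrow> real^3^3" where
  "mat_exp A = (\<Sum>n. (1 / fact n) *\<^sub>R ((\<lambda>M. A ** M) ^^ n) (mat 1))"

definition phase_space :: "phase set" where
  "phase_space = {(B, R, \<pi>, p). rotation_matrix B \<and> R \<noteq> 0}"

definition tangent_space :: "phase \<Rightarrow> phase set" where
  "tangent_space = (\<lambda>(B, R, \<pi>, p). {(B ** hat w, r, a, b) | w r a b. True})"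


subsection \<open>Energy\<close>

definition kinetic :: "real^3^3 \<Rightarrow> real^3 \<Rightarrow> (real^3) \<times> (real^3) \<Rightarrow> real" where
  "kinetic I R = (\<lambda>(\<Omega>, v). (\<Omega> \<bullet> (I *v \<Omega>) + (norm (v + cross3 \<Omega> R))\<^sup>2) / 2)"

definition V2 :: "real^3^3 \<Rightarrow> real^3 \<Rightarrow> real" where
  "V2 I R = - 1 / norm R - 1 / (2 * norm R ^ 3) + 3 / (2 * norm R ^ 5) * (R \<bullet> (I *v R))"

definition legendre :: "real^3^3 \<Rightarrow> real^3 \<Rightarrow> (real^3) \<times> (real^3) \<Rightarrow> (real^3) \<times> (real^3)" where
  "legendre I R = (\<lambda>(\<Omega>, v). (I *v \<Omega> + cross3 R (v + cross3 \<Omega> R), v + cross3 \<Omega> R))"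

text \<open>The Legendre transform is the fibre derivative of the kinetic energy.\<close>

lemma kinetic_has_derivative:
  assumes "transpose I = I"
  shows "(kinetic I R has_derivative (\<lambda>d. legendre I R (\<Omega>, v) \<bullet> d)) (at (\<Omega>, v))"
proof -
  have lin: "bounded_linear (\<lambda>x. cross3 x R)"
    by (rule linear_conv_bounded_linear[THEN iffD1])
      (simp add: linear_iff cross_add_left cross_mult_left)
  have linI: "bounded_linear (\<lambda>x. I *v x)"
    by (rule matrix_vector_mul_bounded_linear)
  have sym: "x \<bullet> (I *v y) = y \<bullet> (I *v x)" for x y
    using assms by (metis dot_lmul_matrix inner_commute vector_transpose_matrix)
  have cyc: "cross3 R a \<bullet> b = a \<bullet> cross3 b R" for a b
    by (simp add: cross3_simps)
  have eq: "kinetic I R = (\<lambda>y. (fst y \<bullet> (I *v fst y) +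
      (snd y + cross3 (fst y) R) \<bullet> (snd y + cross3 (fst y) R)) / 2)"
    by (auto simp: kinetic_def power2_norm_eq_inner fun_eq_iff)
  show ?thesis
    unfolding eq
  proof (rule has_derivative_eq_rhs)
    show "((\<lambda>y. (fst y \<bullet> (I *v fst y) +
        (snd y + cross3 (fst y) R) \<bullet> (snd y + cross3 (fst y) R)) / 2) has_derivative
      (\<lambda>d. (\<Omega> \<bullet> (I *v fst d) + fst d \<bullet> (I *v \<Omega>) +
        ((v + cross3 \<Omega> R) \<bullet> (snd d + cross3 (fst d) R) +
         (snd d + cross3 (fst d) R) \<bullet> (v + cross3 \<Omega> R))) / 2)) (at (\<Omega>, v))"
      by (auto intro!: derivative_eq_intros bounded_linear.has_derivative[OF lin]
          bounded_linear.has_derivative[OF linI])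
    show "(\<lambda>d. (\<Omega> \<bullet> (I *v fst d) + fst d \<bullet> (I *v \<Omega>) +
        ((v + cross3 \<Omega> R) \<bullet> (snd d + cross3 (fst d) R) +
         (snd d + cross3 (fst d) R) \<bullet> (v + cross3 \<Omega> R))) / 2)
      = (\<lambda>d. legendre I R (\<Omega>, v) \<bullet> d)"
    proof
      fix d :: "(real^3) \<times> (real^3)"
      show "(\<Omega> \<bullet> (I *v fst d) + fst d \<bullet> (I *v \<Omega>) +
          ((v + cross3 \<Omega> R) \<bullet> (snd d + cross3 (fst d) R) +
           (snd d + cross3 (fst d) R) \<bullet> (v + cross3 \<Omega> R))) / 2
        = legendre I R (\<Omega>, v) \<bullet> d"
        using sym[of \<Omega> "fst d"] cyc[of "v + cross3 \<Omega> R" "fst d"]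
        by (cases d) (simp add: legendre_def inner_add_left inner_add_right inner_commute)
    qed
  qed
qed

definition H2 :: "real^3^3 \<Rightarrow> phase \<Rightarrow> real" where
  "H2 I = (\<lambda>(B, R, \<pi>, p). kinetic I R (inv (legendre I R) (\<pi>, p)) + V2 I R)"


subsection \<open>Hamiltonian dynamics\<close>

text \<open>The canonical one-form \<open>\<theta>\<close> and the canonical symplectic form \<open>\<omega> = - d\<theta>\<close>.\<close>

definition theta :: "phase \<Rightarrow> phase \<Rightarrow> real" where
  "theta = (\<lambda>(B, R, \<pi>, p) (B', R', \<pi>', p'). \<pi> \<bullet> vee (transpose B ** B') + p \<bullet> R')"

definition omega :: "phase \<Rightarrow> phase \<Rightarrow> phase \<Rightarrow> real" where
  "omega z X Y = frechet_derivative (\<lambda>z'. theta z' X) (at z) Y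
               - frechet_derivative (\<lambda>z'. theta z' Y) (at z) X"

definition ham_vf :: "(phase \<Rightarrow> real) \<Rightarrow> phase \<Rightarrow> phase" where
  "ham_vf F z = (THE X. X \<in> tangent_space z \<and>
     (\<forall>Y\<in>tangent_space z. omega z X Y = frechet_derivative F (at z) Y))"

definition integral_curve :: "(phase \<Rightarrow> phase) \<Rightarrow> (real \<Rightarrow> phase) \<Rightarrow> bool" where
  "integral_curve X \<gamma> \<longleftrightarrow>
     (\<forall>t. \<gamma> t \<in> phase_space \<and> (\<gamma> has_vector_derivative X (\<gamma> t)) (at t))"


subsection \<open>Symmetry\<close>

definition Gasym :: "((real^3^3) \<times> (real^3^3)) set" where
  "Gasym = {(M, A). rotation_matrix M \<and> (\<exists>s. (\<forall>i. s $ i = 1 \<or> s $ i = -1) \<and> A = diag s)}"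

text \<open>
  Cotangent lift of \<open>(M, A) \<cdot> (B, R) = (M B A\<^sup>T det A, A R)\<close>; this map of configurations sends
  the body velocity \<open>(\<Omega>, v)\<close> to \<open>(det A \<cdot> A \<Omega>, A v)\<close>.  For fixed \<open>(M, A)\<close> the formula is
  linear in the phase point, so it is also its own tangent map.
\<close>

definition act :: "(real^3^3) \<times> (real^3^3) \<Rightarrow> phase \<Rightarrow> phase" where
  "act = (\<lambda>(M, A) (B, R, \<pi>, p).
     (det A *\<^sub>R (M ** B ** transpose A), A *v R, det A *\<^sub>R (A *v \<pi>), A *v p))"

lemma theta_act:
  assumes "g \<in> Gasym" "z \<in> phase_space" "V \<in> tangent_space z"
  shows "theta (act g z) (act g V) = theta z V"
proof -
  obtain M s where g: "g = (M, diag s)" and M: "orthogonal_matrix M"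
    and s: "\<And>i. s $ i = 1 \<or> s $ i = -1"
    using assms(1) by (auto simp: Gasym_def rotation_matrix_def)
  obtain B R \<pi> p where z: "z = (B, R, \<pi>, p)" and B: "orthogonal_matrix B"
    using assms(2) by (auto simp: phase_space_def rotation_matrix_def)
  obtain w r a b where V: "V = (B ** hat w, r, a, b)"
    using assms(3) by (auto simp: z tangent_space_def)
  let ?A = "diag s"
  have dd: "det ?A * det ?A = 1"
    using s[of 1] s[of 2] s[of 3] by (auto simp: det_3 diag_def)
  have "transpose (det ?A *\<^sub>R (M ** B ** transpose ?A)) **
      (det ?A *\<^sub>R (M ** (B ** hat w) ** transpose ?A))
      = (det ?A * det ?A) *\<^sub>R (?A ** (transpose B ** ((transpose M ** M) ** B)) ** hat w ** transpose ?A)"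
    by (simp add: matrix_transpose_mul transpose_scalar scalar_matrix_assoc
        matrix_scalar_ac matrix_mul_assoc flip: scaleR_scaleR)
  also have "\<dots> = ?A ** hat w ** transpose ?A"
    using M B dd by (simp add: orthogonal_matrix_def)
  finally have eq: "transpose (det ?A *\<^sub>R (M ** B ** transpose ?A)) **
      (det ?A *\<^sub>R (M ** (B ** hat w) ** transpose ?A)) = ?A ** hat w ** transpose ?A" .
  have BB: "transpose B ** (B ** hat w) = hat w"
    using B by (simp add: matrix_mul_assoc orthogonal_matrix_def)
  have 1: "det ?A * ((?A *v \<pi>) \<bullet> vee (?A ** hat w ** transpose ?A)) = \<pi> \<bullet> vee (hat w)"
    using s[of 1] s[of 2] s[of 3]
    by (elim disjE) (simp_all add: det_3 diag_def vee_def hat_def matrix_def cross3_def inner_vec_def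
        sum_3 matrix_matrix_mult_def matrix_vector_mult_def transpose_def axis_def vector_def)
  have 2: "(?A *v p) \<bullet> (?A *v r) = p \<bullet> r"
    using s[of 1] s[of 2] s[of 3]
    by (elim disjE) (simp_all add: diag_def inner_vec_def sum_3 matrix_vector_mult_def)
  show ?thesis
    by (simp add: g z V theta_def act_def eq BB 1 2)
qed

text \<open>Total spatial angular momentum.\<close>

definition J :: "phase \<Rightarrow> real^3" where
  "J = (\<lambda>(B, R, \<pi>, p). B *v \<pi>)"

lemma J_inner:
  assumes "rotation_matrix B"
  shows "J (B, R, \<pi>, p) \<bullet> \<eta> = theta (B, R, \<pi>, p) (hat \<eta> ** B, 0, 0, 0)"
proof -
  have rT: "rotation_matrix (transpose B)"
    using assms by (simp add: rotation_matrix_def det_transpose)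
  have BB: "transpose B *v (B *v u) = u" for u
    using assms by (simp add: rotation_matrix_def orthogonal_matrix_def matrix_vector_mul_assoc)
  have hat: "hat w *v u = cross3 w u" for w u
    by (simp add: hat_def matrix_def cross3_def axis_def vec_eq_iff forall_3
        matrix_vector_mult_def sum_3)
  have "(transpose B ** (hat \<eta> ** B)) *v u = hat (transpose B *v \<eta>) *v u" for u
  proof -
    have "(transpose B ** (hat \<eta> ** B)) *v u = transpose B *v (cross3 \<eta> (B *v u))"
      by (simp add: hat flip: matrix_vector_mul_assoc)
    also have "\<dots> = cross3 (transpose B *v \<eta>) (transpose B *v (B *v u))"
      by (rule cross_rotation_matrix[OF rT, symmetric])
    finally show ?thesis by (simp only: hat BB)
  qed
  then have "transpose B ** (hat \<eta> ** B) = hat (transpose B *v \<eta>)"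
    by (simp add: matrix_eq)
  moreover have "vee (hat w) = w" for w
    by (simp add: vee_def hat_def matrix_def cross3_def axis_def vec_eq_iff forall_3)
  ultimately show ?thesis
    by (simp add: J_def theta_def dot_lmul_matrix flip: vector_transpose_matrix)
qed

definition isotropy :: "real^3 \<Rightarrow> ((real^3^3) \<times> (real^3^3)) set" where
  "isotropy \<mu> = {(M, A) \<in> Gasym. M *v \<mu> = \<mu>}"

definition one_param :: "real^3 \<Rightarrow> real \<Rightarrow> (real^3^3) \<times> (real^3^3)" where
  "one_param \<xi> t = (mat_exp (t *\<^sub>R hat \<xi>), mat 1)"

definition isotropy_algebra :: "real^3 \<Rightarrow> (real^3) set" where
  "isotropy_algebra \<mu> = {\<eta>. \<forall>t. one_param \<eta> t \<in> isotropy \<mu>}"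

definition infinitesimal :: "real^3 \<Rightarrow> phase \<Rightarrow> phase" where
  "infinitesimal \<eta> z = vector_derivative (\<lambda>t. act (one_param \<eta> t) z) (at 0)"


subsection \<open>Relative equilibria and their stability\<close>

definition relative_equilibrium :: "real^3^3 \<Rightarrow> phase \<Rightarrow> real^3 \<Rightarrow> bool" where
  "relative_equilibrium I z \<xi> \<longleftrightarrow>
     z \<in> phase_space \<and> integral_curve (ham_vf (H2 I)) (\<lambda>t. act (one_param \<xi> t) z)"

text \<open>The phase point denoted by the pair \<open>((Id, R), \<xi>)\<close>.\<close>

definition pair_point :: "real^3^3 \<Rightarrow> real^3 \<Rightarrow> real^3 \<Rightarrow> phase" where
  "pair_point I R \<xi> = (mat 1, R, legendre I R (\<xi>, 0))"

definition nbhd_of :: "phase set \<Rightarrow> phase set \<Rightarrow> bool" where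
  "nbhd_of S U \<longleftrightarrow> U \<subseteq> phase_space \<and>
     (\<exists>V. openin (top_of_set phase_space) V \<and> S \<subseteq> V \<and> V \<subseteq> U)"

text \<open>
  "The evolution stays in \<open>U\<close> for all time" includes that the evolution exists for all
  (positive and negative) time.
\<close>

definition G_mu_stable :: "real^3^3 \<Rightarrow> phase \<Rightarrow> bool" where
  "G_mu_stable I z \<longleftrightarrow>
     (let K = isotropy (J z); X = ham_vf (H2 I) in
      \<forall>U. nbhd_of ((\<lambda>g. act g z) ` K) U \<and> (\<forall>g\<in>K. act g ` U \<subseteq> U) \<longrightarrow>
        (\<exists>N. nbhd_of {z} N \<and>
          (\<forall>y\<in>N. (\<exists>\<gamma>. integral_curve X \<gamma> \<and> \<gamma> 0 = y) \<and>
                 (\<forall>\<gamma>. integral_curve X \<gamma> \<and> \<gamma> 0 = y \<longrightarrow> (\<forall>t. \<gamma> t \<in> U)))))"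

text \<open>
  \<open>c\<close> is an eigenvalue of (the complexification of) the map induced by \<open>L\<close> on \<open>W / N\<close>, with
  eigenvector the class of \<open>a + \<i> b\<close>.
\<close>

definition quotient_eigenvalue ::
  "(phase \<Rightarrow> phase) \<Rightarrow> phase set \<Rightarrow> phase set \<Rightarrow> complex \<Rightarrow> bool" where
  "quotient_eigenvalue L W N c \<longleftrightarrow>
     (\<exists>a\<in>W. \<exists>b\<in>W. (a \<notin> N \<or> b \<notin> N) \<and>
        L a - (Re c *\<^sub>R a - Im c *\<^sub>R b) \<in> N \<and>
        L b - (Im c *\<^sub>R a + Re c *\<^sub>R b) \<in> N)"

definition ker_dJ :: "phase \<Rightarrow> phase set" where
  "ker_dJ z = {V \<in> tangent_space z. frechet_derivative J (at z) V = 0}"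

definition linearly_unstable :: "real^3^3 \<Rightarrow> phase \<Rightarrow> real^3 \<Rightarrow> bool" where
  "linearly_unstable I z \<xi> \<longleftrightarrow>
     (\<exists>L. (ham_vf (\<lambda>y. H2 I y - J y \<bullet> \<xi>) has_derivative L) (at z within phase_space) \<and>
       (\<exists>c. Re c > 0 \<and> quotient_eigenvalue L (ker_dJ z)
          ((\<lambda>\<eta>. infinitesimal \<eta> z) ` isotropy_algebra (J z)) c))"

end

theory Submission
  imports Defs
begin

text \<open>
  In body coordinates the flow reduces to an autonomous system for \<open>x = (R, \<pi>, p)\<close>, with the
  rotation \<open>B\<close> driven by the body angular velocity; \<open>H\<close> and the spatial momentum \<open>B \<pi>\<close> are
  conserved.

  Stability: put \<open>D = I + |R|\<^sup>2\<close> and \<open>\<omega> = D\<inverse> \<pi>\<close>.  Completing squares gives the exact formula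
  \<open>2 (H - V) = (\<Omega> - \<omega>) \<bullet> I (\<Omega> - \<omega>) + |p - \<omega> \<times> R|\<^sup>2 + (\<omega> \<bullet> R)\<^sup>2 + \<pi> \<bullet> D\<inverse> \<pi>\<close>.
  By the Lagrange conditions both \<open>\<pi> \<bullet> D\<inverse> \<pi>\<close> and \<open>V\<close> exceed the values they have when \<open>\<pi>\<close> points
  along the first and \<open>R\<close> along the second axis, so \<open>H\<close> is bounded below by an amended potential in
  \<open>|R|\<close> alone.  Its second derivative at the equilibrium has the sign of the polynomial defining
  \<open>R\<^sub>c\<^sub>r\<^sub>i\<^sub>t\<close>.  When it is positive, the equilibrium is isolated in its joint energy and momentum
  sublevel set, which traps the reduced motion; conservation of \<open>B \<pi>\<close> controls \<open>B\<close> up to rotations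
  about the momentum.

  Instability: planar perturbations, orthogonal to the axis of rotation, are invariant under the
  linearised flow, and the squares of their eigenvalues solve a quadratic equation with negative
  constant term below \<open>R\<^sub>c\<^sub>r\<^sub>i\<^sub>t\<close>.

  No bifurcation: if \<open>t = R \<bullet> \<xi> \<noteq> 0\<close>, the equilibrium equations express each of the three terms of
  \<open>t\<^sup>2 = t (R\<^sub>1 \<xi>\<^sub>1 + R\<^sub>2 \<xi>\<^sub>2 + R\<^sub>3 \<xi>\<^sub>3)\<close> as a nonpositive quantity near the family; hence
  \<open>t = 0\<close>, which forces membership in the family.
\<close>

section \<open>Global solutions of ordinary differential equations\<close>

lemma antiderivative_on_reals:
  fixes f :: "real \<Rightarrow> 'a::euclidean_space"
  assumes f: "continuous_on UNIV f"
  shows "\<exists>P. P 0 = 0 \<and> (\<forall>t. (P has_vector_derivative f t) (at t))"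
proof -
  define Q where "Q t = (if t \<ge> 0 then integral {0..t} f else - integral {t..0} f)" for t
  have int: "f integrable_on {a..b}" for a b
    by (intro integrable_continuous_interval continuous_on_subset[OF f]) auto
  have Q: "Q t = integral {c..t} f - integral {c..0} f" if "c \<le> 0" "c \<le> t" for c t
  proof (cases "t \<ge> 0")
    case True
    have "integral {c..0} f + integral {0..t} f = integral {c..t} f"
      using True that by (intro Henstock_Kurzweil_Integration.integral_combine int) auto
    then show ?thesis using True by (simp add: Q_def algebra_simps)
  next
    case False
    have "integral {c..t} f + integral {t..0} f = integral {c..0} f"
      using False that by (intro Henstock_Kurzweil_Integration.integral_combine int) auto
    then show ?thesis using False by (simp add: Q_def algebra_simps)
  qed
  have "(Q has_vector_derivative f t) (at t)" for t
  proof -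
    \<comment> \<open>The base point \<open>c\<close> lies to the left of both 0 and
      \<open>t\<close>, so both cases of \<open>Q\<close> reduce to integrals starting at
      \<open>c\<close>, and \<open>t\<close> is interior to \<open>{c..d}\<close>.\<close>
    define c where "c = - \<bar>t\<bar> - 1"
    define d where "d = \<bar>t\<bar> + 1"
    have cd: "c \<le> 0" "c < t" "t < d" by (auto simp: c_def d_def)
    have "((\<lambda>u. integral {c..u} f) has_vector_derivative f t) (at t within {c..d})"
      using cd by (intro integral_has_vector_derivative continuous_on_subset[OF f]) auto
    then have "((\<lambda>u. integral {c..u} f) has_vector_derivative f t) (at t)"
      using cd by (simp add: at_within_Icc_at)
    then have "((\<lambda>u. integral {c..u} f - integral {c..0} f) has_vector_derivative f t) (at t)"
      by (auto intro!: derivative_eq_intros)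
    then show ?thesis
    proof (rule has_vector_derivative_transform_within_open[where S="{c<..}"])
    qed (use cd Q in auto)
  qed
  moreover have "Q 0 = 0" by (simp add: Q_def)
  ultimately show ?thesis by blast
qed

text \<open>Mean value inequality against the comparison function
  \<open>D / k * exp (k * t)\<close>. Integration gains the factor 1/k, which is what later makes
  the Picard operator contract.\<close>

lemma antiderivative_exp_bound_pos:
  fixes P :: "real \<Rightarrow> 'a::real_normed_vector"
  assumes P: "P 0 = 0" "\<And>t. (P has_vector_derivative f t) (at t)"
    and f: "\<And>t. t \<ge> 0 \<Longrightarrow> norm (f t) \<le> D * exp (k * t)" and "k > 0" "D \<ge> 0" "t \<ge> 0"
  shows "norm (P t) \<le> D / k * exp (k * t)"
proof (cases "t = 0")
  case True
  then show ?thesis using assms by simp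
next
  case False
  then have t: "t > 0" using assms by simp
  let ?g = "\<lambda>s. D / k * exp (k * s)"
  have "norm (P t - P 0) \<le> ?g t - ?g 0"
  proof (rule differentiable_bound_general[where f'=f and \<phi>'="\<lambda>s. D * exp (k * s)"])
    show "continuous_on {0..t} P"
      using P(2) by (intro continuous_at_imp_continuous_on) (auto intro: has_vector_derivative_continuous)
    show "continuous_on {0..t} ?g" by (intro continuous_intros)
    show "(?g has_vector_derivative D * exp (k * x)) (at x)" for x
      using \<open>k > 0\<close> by (auto intro!: derivative_eq_intros simp flip: has_real_derivative_iff_has_vector_derivative)
  qed (use t P f in auto)
  also have "\<dots> \<le> ?g t" using assms by simp
  finally show ?thesis using P by simp
qed

lemma antiderivative_exp_bound:
  fixes P :: "real \<Rightarrow> 'a::real_normed_vector"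
  assumes P: "P 0 = 0" "\<And>t. (P has_vector_derivative f t) (at t)"
    and f: "\<And>t. norm (f t) \<le> D * exp (k * \<bar>t\<bar>)" and k: "k > 0" "D \<ge> 0"
  shows "norm (P t) \<le> D / k * exp (k * \<bar>t\<bar>)"
proof (cases "t \<ge> 0")
  case True
  show ?thesis
    using antiderivative_exp_bound_pos[of P f D k t] assms True f[of "_::real"]
    by (metis abs_of_nonneg)
next
  case False
  have "norm ((\<lambda>s. P (- s)) (- t)) \<le> D / k * exp (k * - t)"
  proof (rule antiderivative_exp_bound_pos[where f="\<lambda>s. - f (- s)"])
    show "((\<lambda>s. P (- s)) has_vector_derivative - f (- x)) (at x)" for x
    proof -
      have "((P \<circ> uminus) has_vector_derivative (- 1) *\<^sub>R f (- x)) (at x)"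
        by (rule vector_diff_chain_at) (auto intro!: derivative_eq_intros P(2))
      then show ?thesis by (simp add: o_def)
    qed
    show "norm (- f (- s)) \<le> D * exp (k * s)" if "s \<ge> 0" for s
      using f[of "- s"] that by simp
  qed (use False P k in auto)
  then show ?thesis using False by simp
qed

text \<open>
  The Picard operator is a contraction on all of \<open>\<real>\<close> at once for the norm with weight
  \<open>exp (- k |t|)\<close>, \<open>k > L\<close>; the bound \<open>M\<close> keeps solutions in the weighted space.
\<close>

lemma lipschitz_ode_global_solution:
  fixes F :: "'a::euclidean_space \<Rightarrow> 'a"
  assumes L: "L-lipschitz_on UNIV F" and M: "\<And>x. norm (F x) \<le> M"
  shows "\<exists>\<gamma>. \<gamma> 0 = y \<and> (\<forall>t. (\<gamma> has_vector_derivative F (\<gamma> t)) (at t))"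
proof -
  \<comment> \<open>This makes L/k at most 1/2, the contraction constant; the summand 1 keeps
    \<open>k\<close> positive when \<open>L = 0\<close>.\<close>
  define k where "k = 2 * L + 1"
  have L0: "L \<ge> 0" using L by (rule lipschitz_on_nonneg)
  then have k: "k > 0" by (simp add: k_def)
  have M0: "M \<ge> 0" using M[of 0] norm_ge_zero by (rule order_trans[rotated])
  \<comment> \<open>The unknown of the fixed point problem is the bounded function \<open>g\<close>;
    the curve it encodes is \<open>c g\<close>, whose distance from \<open>y\<close> may grow like
    \<open>exp (k * \<bar>t\<bar>)\<close>.\<close>
  define c where "c g t = y + exp (k * \<bar>t\<bar>) *\<^sub>R apply_bcontfun g t" for g :: "real \<Rightarrow>\<^sub>C 'a" and t
  have contF: "continuous_on UNIV F" using L by (rule lipschitz_on_continuous_on)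
  have contc: "continuous_on UNIV (c g)" for g
    unfolding c_def by (intro continuous_intros continuous_on_apply_bcontfun)
  have "\<exists>P. P 0 = 0 \<and> (\<forall>t. (P has_vector_derivative F (c g t)) (at t))" for g
    by (rule antiderivative_on_reals) (use continuous_on_compose2[OF contF contc] in auto)
  then obtain P where P0: "\<And>g. P g 0 = 0"
    and P: "\<And>g t. (P g has_vector_derivative F (c g t)) (at t)" by metis
  have contP: "continuous_on UNIV (P g)" for g
    using P by (intro continuous_at_imp_continuous_on) (auto intro: has_vector_derivative_continuous)
  \<comment> \<open>\<open>Bcontfun\<close> has its intended value only on bounded continuous
    functions; \<open>bc\<close> supplies this, with a bound coming from \<open>M\<close>.\<close>
  define \<Phi> where "\<Phi> g = Bcontfun (\<lambda>t. exp (- (k * \<bar>t\<bar>)) *\<^sub>R P g t)" for g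
  have bc: "(\<lambda>t. exp (- (k * \<bar>t\<bar>)) *\<^sub>R P g t) \<in> bcontfun" for g
  proof (rule bcontfun_normI)
    show "continuous_on UNIV (\<lambda>t. exp (- (k * \<bar>t\<bar>)) *\<^sub>R P g t)"
      by (intro continuous_intros contP)
    fix t
    have "norm (P g t) \<le> M / k * exp (k * \<bar>t\<bar>)"
    proof (rule antiderivative_exp_bound[where f="\<lambda>t. F (c g t)"])
      show "norm (F (c g t)) \<le> M * exp (k * \<bar>t\<bar>)" for t
        using M[of "c g t"] M0 k mult_left_mono[of 1 "exp (k * \<bar>t\<bar>)" M] by simp
    qed (use P0 P k M0 in auto)
    then show "norm (exp (- (k * \<bar>t\<bar>)) *\<^sub>R P g t) \<le> M / k"
      by (simp add: exp_minus field_simps)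
  qed
  have \<Phi>: "apply_bcontfun (\<Phi> g) t = exp (- (k * \<bar>t\<bar>)) *\<^sub>R P g t" for g t
    by (simp add: \<Phi>_def Bcontfun_inverse[OF bc])
  have contr: "dist (\<Phi> g) (\<Phi> h) \<le> 1 / 2 * dist g h" for g h
  proof (rule dist_bound)
    fix t
    let ?D = "L * dist g h"
    have "norm (P g t - P h t) \<le> ?D / k * exp (k * \<bar>t\<bar>)"
    proof (rule antiderivative_exp_bound[where f="\<lambda>t. F (c g t) - F (c h t)" and P="\<lambda>t. P g t - P h t"])
      show "norm (F (c g t) - F (c h t)) \<le> ?D * exp (k * \<bar>t\<bar>)" for t
      proof -
        have "norm (F (c g t) - F (c h t)) \<le> L * dist (c g t) (c h t)"
          using lipschitz_onD[OF L, of "c g t" "c h t"] by (simp add: dist_norm)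
        also have "dist (c g t) (c h t) = exp (k * \<bar>t\<bar>) * dist (apply_bcontfun g t) (apply_bcontfun h t)"
          by (simp add: c_def dist_norm flip: scaleR_diff_right)
        also have "\<dots> \<le> exp (k * \<bar>t\<bar>) * dist g h"
          by (intro mult_left_mono dist_bounded) auto
        finally have "norm (F (c g t) - F (c h t)) \<le> L * (exp (k * \<bar>t\<bar>) * dist g h)"
          using L0 by (simp add: mult_left_mono)
        then show ?thesis by (simp add: algebra_simps)
      qed
    qed (use P0 P k L0 in \<open>auto intro: has_vector_derivative_diff\<close>)
    from mult_left_mono[OF this, of "exp (- (k * \<bar>t\<bar>))"]
    have "exp (- (k * \<bar>t\<bar>)) * norm (P g t - P h t)
        \<le> ?D / k * (exp (- (k * \<bar>t\<bar>)) * exp (k * \<bar>t\<bar>))"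
      by (simp add: mult_ac)
    then have "exp (- (k * \<bar>t\<bar>)) * norm (P g t - P h t) \<le> ?D / k"
      by (simp flip: exp_add)
    moreover have "dist (apply_bcontfun (\<Phi> g) t) (apply_bcontfun (\<Phi> h) t)
        = exp (- (k * \<bar>t\<bar>)) * norm (P g t - P h t)"
      by (simp add: \<Phi> dist_norm flip: scaleR_diff_right)
    ultimately have "dist (apply_bcontfun (\<Phi> g) t) (apply_bcontfun (\<Phi> h) t) \<le> ?D / k"
      by simp
    also have "\<dots> \<le> 1 / 2 * dist g h"
    proof -
      have "L / k \<le> 1 / 2" using L0 by (simp add: k_def field_simps)
      from mult_right_mono[OF this, of "dist g h"] show ?thesis by simp
    qed
    finally show "dist (apply_bcontfun (\<Phi> g) t) (apply_bcontfun (\<Phi> h) t) \<le> 1 / 2 * dist g h" .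
  qed
  then obtain g where g: "\<Phi> g = g"
    using banach_fix_type[of "1/2" \<Phi>] by auto
  have Pg: "P g t = exp (k * \<bar>t\<bar>) *\<^sub>R apply_bcontfun g t" for t
  proof -
    have "exp (k * \<bar>t\<bar>) *\<^sub>R apply_bcontfun (\<Phi> g) t = P g t"
      unfolding \<Phi> by (simp flip: exp_add)
    then show ?thesis by (simp add: g)
  qed
  have cg: "c g t = y + P g t" for t
    by (simp add: Pg c_def)
  have "(c g has_vector_derivative F (c g t)) (at t)" for t
    unfolding cg[abs_def] using P[of g t, unfolded cg]
    by (auto intro!: derivative_eq_intros)
  then show ?thesis
    by (intro exI[of _ "c g"]) (simp add: cg P0)
qed

section \<open>Trapping of solutions by conserved quantities\<close>

text \<open>First exit argument. The curve solves the equation only as long as it is in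
  \<open>C\<close>; there \<open>P\<close> is constant along it, and \<open>trap\<close> says that
  this level set of \<open>P\<close> meets \<open>C\<close> in interior points only, so there is no
  first time at which the curve is outside the interior.\<close>

lemma trapped_forward:
  fixes \<gamma> :: "real \<Rightarrow> 'a::real_normed_vector" and P :: "'a \<Rightarrow> 'b::real_normed_vector"
  assumes C: "closed C" and y: "\<gamma> 0 = y" "y \<in> C"
    and cont: "continuous_on UNIV \<gamma>"
    and \<gamma>: "\<And>t. \<gamma> t \<in> C \<Longrightarrow> (\<gamma> has_vector_derivative X (\<gamma> t)) (at t)"
    and P: "\<And>z. z \<in> C \<Longrightarrow> (P has_derivative P' z) (at z)" "\<And>z. z \<in> C \<Longrightarrow> P' z (X z) = 0"
    and trap: "\<And>z. z \<in> C \<Longrightarrow> P z = P y \<Longrightarrow> z \<in> interior C"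
    and T: "T \<ge> 0"
  shows "\<gamma> T \<in> C" and "P (\<gamma> T) = P y"
proof -
  have const: "P (\<gamma> t) = P y" if "t \<ge> 0" and in_C: "\<And>s. 0 \<le> s \<Longrightarrow> s \<le> t \<Longrightarrow> \<gamma> s \<in> C" for t
  proof -
    have "((P \<circ> \<gamma>) has_derivative (\<lambda>h. 0)) (at s within {0..t})" if "s \<in> {0..t}" for s
    proof -
      have "\<gamma> s \<in> C" using in_C that by auto
      from diff_chain_at[OF \<gamma>[OF this, unfolded has_vector_derivative_def] P(1)[OF this]]
      have "((P \<circ> \<gamma>) has_derivative (\<lambda>h. P' (\<gamma> s) (h *\<^sub>R X (\<gamma> s)))) (at s)"
        by (simp add: o_def)
      moreover have "P' (\<gamma> s) (h *\<^sub>R X (\<gamma> s)) = 0" for h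
        using linear_scale[OF has_derivative_linear[OF P(1)]] P(2) \<open>\<gamma> s \<in> C\<close> by simp
      ultimately show ?thesis by (auto intro: has_derivative_at_withinI)
    qed
    then obtain c where "\<And>s. s \<in> {0..t} \<Longrightarrow> (P \<circ> \<gamma>) s = c"
      using has_derivative_zero_constant[of "{0..t}" "P \<circ> \<gamma>"] by blast
    from this[of t] this[of 0] show ?thesis using that(1) y by simp
  qed
  have inside: "\<gamma> t \<in> interior C" if "t \<ge> 0" for t
  proof (rule ccontr)
    assume out: "\<gamma> t \<notin> interior C"
    \<comment> \<open>The times outside the interior form a compact set, so there is a first one,
      \<open>t1\<close>. Before it the curve is in \<open>C\<close>, and by closedness also at
      \<open>t1\<close>, where constancy of \<open>P\<close> contradicts
      \<open>trap\<close>.\<close>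
    define D where "D = {0..t} \<inter> \<gamma> -` (- interior C)"
    have "closed (\<gamma> -` (- interior C))"
      by (rule continuous_closed_vimage) (use cont in \<open>auto simp: continuous_on_eq_continuous_at\<close>)
    then have "compact D"
      unfolding D_def by (intro compact_Int_closed) auto
    moreover have "t \<in> D" using out that by (auto simp: D_def)
    ultimately obtain t1 where t1: "t1 \<in> D" "\<And>s. s \<in> D \<Longrightarrow> t1 \<le> s"
      using compact_attains_inf[of D] by auto
    have t10: "0 \<le> t1" "t1 \<le> t" using t1 by (auto simp: D_def)
    have below: "\<gamma> s \<in> C" if "0 \<le> s" "s < t1" for s
      using t1(2)[of s] that t10 interior_subset by (force simp: D_def)
    have "\<gamma> t1 \<in> C"
    proof (cases "t1 = 0")
      case False
      then have "t1 \<in> closure {0..<t1}" using t10 by (simp add: closure_atLeastLessThan)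
      moreover have "\<gamma> ` closure {0..<t1} \<subseteq> C"
        by (rule image_closure_subset) (use C below continuous_on_subset[OF cont] in auto)
      ultimately show ?thesis by blast
    qed (use y in simp)
    then have "P (\<gamma> t1) = P y"
      using t10 below by (intro const) (auto simp: le_less)
    then show False using trap \<open>\<gamma> t1 \<in> C\<close> t1(1) by (auto simp: D_def)
  qed
  then show "\<gamma> T \<in> C" using T interior_subset by blast
  show "P (\<gamma> T) = P y"
    using const[of T] T inside interior_subset by blast
qed

text \<open>Negative times follow by reversing time: the reversed curve solves the equation for
  \<open>- X\<close>, which has the same conserved quantities.\<close>

lemma trapped_curve:
  fixes \<gamma> :: "real \<Rightarrow> 'a::real_normed_vector" and P :: "'a \<Rightarrow> 'b::real_normed_vector"
  assumes C: "closed C" and y: "\<gamma> 0 = y" "y \<in> C"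
    and cont: "continuous_on UNIV \<gamma>"
    and \<gamma>: "\<And>t. \<gamma> t \<in> C \<Longrightarrow> (\<gamma> has_vector_derivative X (\<gamma> t)) (at t)"
    and P: "\<And>z. z \<in> C \<Longrightarrow> (P has_derivative P' z) (at z)" "\<And>z. z \<in> C \<Longrightarrow> P' z (X z) = 0"
    and trap: "\<And>z. z \<in> C \<Longrightarrow> P z = P y \<Longrightarrow> z \<in> interior C"
  shows "\<gamma> t \<in> C \<and> P (\<gamma> t) = P y"
proof (cases "t \<ge> 0")
  case True
  from trapped_forward[OF C y cont \<gamma> P trap True] show ?thesis by blast
next
  case False
  let ?\<delta> = "\<lambda>t. \<gamma> (- t)"
  have \<delta>: "(?\<delta> has_vector_derivative - X (?\<delta> s)) (at s)" if "?\<delta> s \<in> C" for s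
  proof -
    have "((\<gamma> \<circ> uminus) has_vector_derivative (- 1) *\<^sub>R X (\<gamma> (- s))) (at s)"
      by (rule vector_diff_chain_at) (auto intro!: derivative_eq_intros \<gamma> that)
    then show ?thesis by (simp add: o_def)
  qed
  have c\<delta>: "continuous_on UNIV ?\<delta>"
    by (rule continuous_on_compose2[OF cont]) (auto intro!: continuous_intros)
  have P'm: "P' z (- X z) = 0" if "z \<in> C" for z
    using linear_neg[OF has_derivative_linear[OF P(1)]] P(2) that by simp
  have \<delta>0: "?\<delta> 0 = y" using y(1) by simp
  have "- t \<ge> 0" using False by simp
  note tf = trapped_forward[where C=C and X="\<lambda>z. - X z" and P'=P' and y=y and P=P and T="- t"
      and \<gamma>="?\<delta>", OF C \<delta>0 y(2) c\<delta> _ P(1) P'm trap this]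
  have "?\<delta> (- t) \<in> C" "P (?\<delta> (- t)) = P y"
    by (rule tf; use \<delta> in blast)+
  then show ?thesis by simp
qed

text \<open>The vector field is controlled on \<open>C\<close> only. A global solution is obtained
  for an extension of it, and trapping shows that this solution never notices the extension.\<close>

lemma trapped_global_solution:
  fixes X :: "'a::euclidean_space \<Rightarrow> 'a" and P :: "'a \<Rightarrow> 'b::real_normed_vector"
  assumes C: "compact C" "convex C" and X: "L-lipschitz_on C X" and y: "y \<in> C"
    and P: "\<And>z. z \<in> C \<Longrightarrow> (P has_derivative P' z) (at z)" "\<And>z. z \<in> C \<Longrightarrow> P' z (X z) = 0"
    and trap: "\<And>z. z \<in> C \<Longrightarrow> P z = P y \<Longrightarrow> z \<in> interior C"
  shows "\<exists>\<gamma>. \<gamma> 0 = y \<and> (\<forall>t. \<gamma> t \<in> C \<and> P (\<gamma> t) = P y \<and> (\<gamma> has_vector_derivative X (\<gamma> t)) (at t))"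
proof -
  have cl: "closed C" "C \<noteq> {}" using C y by (auto intro: compact_imp_closed)
  \<comment> \<open>The projection to a convex set is 1-Lipschitz, so \<open>F\<close> is a globally Lipschitz extension of \<open>X\<close>.\<close>
  define F where "F z = X (closest_point C z)" for z
  have cp: "closest_point C z \<in> C" for z using closest_point_in_set cl by blast
  have "L-lipschitz_on UNIV F"
  proof (rule lipschitz_onI)
    fix u v
    have "dist (F u) (F v) \<le> L * dist (closest_point C u) (closest_point C v)"
      unfolding F_def by (rule lipschitz_onD[OF X cp cp])
    also have "\<dots> \<le> L * dist u v"
      by (intro mult_left_mono closest_point_lipschitz C cl lipschitz_on_nonneg[OF X])
    finally show "dist (F u) (F v) \<le> L * dist u v" .
  qed (rule lipschitz_on_nonneg[OF X])
  moreover have "compact (X ` C)"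
    by (rule compact_continuous_image[OF lipschitz_on_continuous_on[OF X] C(1)])
  then obtain M where "\<And>z. z \<in> C \<Longrightarrow> norm (X z) \<le> M"
    by (meson bounded_iff compact_imp_bounded imageI)
  then have "norm (F z) \<le> M" for z using cp by (auto simp: F_def)
  ultimately obtain \<gamma> where \<gamma>: "\<gamma> 0 = y" "\<And>t. (\<gamma> has_vector_derivative F (\<gamma> t)) (at t)"
    using lipschitz_ode_global_solution[of L F M y] by blast
  have cont: "continuous_on UNIV \<gamma>"
    using \<gamma> by (intro continuous_at_imp_continuous_on) (auto intro: has_vector_derivative_continuous)
  have FX: "F z = X z" if "z \<in> C" for z
    using that by (simp add: F_def closest_point_self)
  have "(\<gamma> has_vector_derivative X (\<gamma> s)) (at s)" if "\<gamma> s \<in> C" for s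
    using \<gamma>(2)[of s] FX that by simp
  from trapped_curve[OF cl(1) \<gamma>(1) y cont this P trap]
  have "\<gamma> t \<in> C \<and> P (\<gamma> t) = P y" for t by blast
  then show ?thesis using \<gamma> FX by (intro exI[of _ \<gamma>]) metis
qed

section \<open>Rotations and the exponential of a skew-symmetric matrix\<close>

lemma bounded_bilinear_cross3: "bounded_bilinear cross3"
  using bilinear_cross by (simp add: bilinear_conv_bounded_bilinear)

lemma bounded_bilinear_matrix_mult:
  "bounded_bilinear ((**) :: real^'n^'m \<Rightarrow> real^'k^'n \<Rightarrow> real^'k^'m)"
  unfolding bilinear_conv_bounded_bilinear[symmetric] bilinear_def
  by (auto simp: linear_iff matrix_matrix_mult_def vec_eq_iff sum.distrib sum_distrib_left algebra_simps)

lemma bounded_bilinear_matrix_vector_mult: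
  "bounded_bilinear ((*v) :: real^'n^'m \<Rightarrow> real^'n \<Rightarrow> real^'m)"
  unfolding bilinear_conv_bounded_bilinear[symmetric] bilinear_def
  by (auto simp: linear_iff matrix_vector_mult_def vec_eq_iff sum.distrib sum_distrib_left algebra_simps)

lemma bounded_linear_transpose: "bounded_linear (transpose :: real^'n^'m \<Rightarrow> real^'m^'n)"
  unfolding linear_conv_bounded_linear[symmetric]
  by (auto simp: linear_iff transpose_def vec_eq_iff)

lemma hat_mult_vec: "hat w *v u = cross3 w u"
  by (simp add: hat_def matrix_def cross3_def axis_def vec_eq_iff forall_3
      matrix_vector_mult_def sum_3)

lemma vee_hat [simp]: "vee (hat w) = w"
  by (simp add: vee_def hat_def matrix_def cross3_def axis_def vec_eq_iff forall_3)

lemma bounded_linear_hat: "bounded_linear hat"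
  unfolding linear_conv_bounded_linear[symmetric]
  by (auto simp: linear_iff hat_def matrix_def cross_add_left cross_mult_left vec_eq_iff)

lemma bounded_linear_vee: "bounded_linear vee"
  unfolding linear_conv_bounded_linear[symmetric]
  by (auto simp: linear_iff vee_def vec_eq_iff forall_3)

lemmas hat_simps = bounded_linear.linear[OF bounded_linear_hat, THEN linear_diff]
  bounded_linear.linear[OF bounded_linear_hat, THEN linear_scale]
  bounded_linear.linear[OF bounded_linear_hat, THEN linear_0]

lemma transpose_hat: "transpose (hat w) = - hat w"
  by (simp add: transpose_def hat_def matrix_def cross3_def axis_def vec_eq_iff forall_3)

lemma hat_commutator: "hat v ** hat w - hat w ** hat v = hat (cross3 v w)"
  by (simp add: hat_def matrix_def cross3_def axis_def vec_eq_iff forall_3 matrix_matrix_mult_def sum_3)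

lemma hat_cubed: "hat w ** (hat w ** hat w) = - (w \<bullet> w) *\<^sub>R hat w"
  by (simp add: hat_def matrix_def cross3_def axis_def vec_eq_iff forall_3 matrix_matrix_mult_def
      sum_3 inner_vec_def algebra_simps)

lemmas matrix_add_left = bounded_bilinear.add_left[OF bounded_bilinear_matrix_mult]
  and matrix_minus_left = bounded_bilinear.minus_left[OF bounded_bilinear_matrix_mult]
  and matrix_minus_right = bounded_bilinear.minus_right[OF bounded_bilinear_matrix_mult]

lemmas has_derivative_cross3 [derivative_intros] = bounded_bilinear.FDERIV[OF bounded_bilinear_cross3]
lemmas has_derivative_matrix_mult [derivative_intros] =
  bounded_bilinear.FDERIV[OF bounded_bilinear_matrix_mult]
lemmas has_derivative_matrix_vector_mult [derivative_intros] =
  bounded_bilinear.FDERIV[OF bounded_bilinear_matrix_vector_mult]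
lemmas has_derivative_hat [derivative_intros] = bounded_linear.has_derivative[OF bounded_linear_hat]
lemmas has_derivative_vee [derivative_intros] = bounded_linear.has_derivative[OF bounded_linear_vee]
lemmas has_derivative_transpose [derivative_intros] =
  bounded_linear.has_derivative[OF bounded_linear_transpose]
lemmas continuous_on_matrix_mult [continuous_intros] =
  bounded_bilinear.continuous_on[OF bounded_bilinear_matrix_mult]
lemmas continuous_on_matrix_vector [continuous_intros] =
  bounded_bilinear.continuous_on[OF bounded_bilinear_matrix_vector_mult]
lemmas continuous_on_transpose [continuous_intros] =
  bounded_linear.continuous_on[OF bounded_linear_transpose]

lemma rotation_matrix_mat_1: "rotation_matrix (mat 1 :: real^'n^'n)"
  by (simp add: rotation_matrix_def orthogonal_matrix_id)

text \<open>The determinant takes only the values 1 and -1 and is continuous on a connected line, so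
  it keeps its initial value 1.\<close>

lemma rotation_matrix_curve:
  fixes B :: "real \<Rightarrow> real^3^3"
  assumes cont: "continuous_on UNIV B" and orth: "\<And>t. orthogonal_matrix (B t)"
    and B0: "rotation_matrix (B 0)"
  shows "rotation_matrix (B t)"
proof -
  let ?d = "\<lambda>t. det (B t)"
  have contd: "continuous_on UNIV ?d"
    using cont unfolding det_3 by (intro continuous_intros)
  have pm: "?d s = 1 \<or> ?d s = -1" for s
    using det_orthogonal_matrix[OF orth] .
  have "connected (range ?d)"
    using contd connected_UNIV by (rule connected_continuous_image)
  moreover have "1 \<in> range ?d" using B0 by (metis rangeI rotation_matrix_def)
  ultimately have "?d t \<noteq> -1"
  proof (intro notI)
    assume conn: "connected (range ?d)" and "1 \<in> range ?d" "?d t = -1"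
    then have "0 \<in> range ?d"
      using connectedD_interval[OF conn, of "-1" 1 0] by (metis neg_le_0_iff_le rangeI zero_le_one)
    then obtain s where "?d s = 0" by auto
    then show False using pm[of s] by simp
  qed
  then show ?thesis using pm[of t] orth by (auto simp: rotation_matrix_def)
qed

text \<open>Since the cube of \<open>hat w\<close> is \<open>- \<theta>\<^sup>2\<close> times
  \<open>hat w\<close>, odd powers are multiples of \<open>hat w\<close> and even powers from the
  second on are multiples of its square, with the coefficients of sine and minus cosine. The last
  summand corrects the term \<open>n = 0\<close>, where the power is the identity.\<close>

lemma mat_exp_term_hat:
  assumes "\<theta> \<noteq> 0" "\<theta>\<^sup>2 = w \<bullet> w"
  shows "(1 / fact n) *\<^sub>R ((\<lambda>M. (t *\<^sub>R hat w) ** M) ^^ n) (mat 1)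
    = (sin_coeff n * (t * \<theta>) ^ n) *\<^sub>R ((1 / \<theta>) *\<^sub>R hat w)
      - (cos_coeff n * (t * \<theta>) ^ n) *\<^sub>R ((1 / \<theta>\<^sup>2) *\<^sub>R (hat w ** hat w))
      + (if n = 0 then mat 1 + (1 / \<theta>\<^sup>2) *\<^sub>R (hat w ** hat w) else 0)"
proof -
  let ?A = "hat w" and ?p = "\<lambda>n. ((\<lambda>M. (t *\<^sub>R hat w) ** M) ^^ n) (mat 1)"
  have smul: "(c *\<^sub>R X) ** Y = c *\<^sub>R (X ** Y)" "X ** (c *\<^sub>R Y) = c *\<^sub>R (X ** Y)"
    for c and X Y :: "real^3^3"
    by (simp_all add: scalar_matrix_assoc matrix_scalar_ac)
  have cub: "?A ** (?A ** ?A) = (- (\<theta>\<^sup>2)) *\<^sub>R ?A"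
    by (simp add: hat_cubed assms)
  \<comment> \<open>The pairs start at the powers 1 and 2; the power 0 does not fit the
    pattern.\<close>
  have p: "?p (2 * k + 1) = ((-1) ^ k * t ^ (2 * k + 1) * \<theta> ^ (2 * k)) *\<^sub>R ?A \<and>
    ?p (2 * k + 2) = ((-1) ^ k * t ^ (2 * k + 2) * \<theta> ^ (2 * k)) *\<^sub>R (?A ** ?A)" for k
  proof (induction k)
    case 0
    show ?case by (simp add: smul power2_eq_square)
  next
    case (Suc k)
    have o: "?p (2 * Suc k + 1) = ((-1) ^ Suc k * t ^ (2 * Suc k + 1) * \<theta> ^ (2 * Suc k)) *\<^sub>R ?A"
    proof -
      have "?p (2 * Suc k + 1) = (t *\<^sub>R ?A) ** ?p (2 * k + 2)" by simp
      also have "\<dots> = (t *\<^sub>R ?A) ** (((-1) ^ k * t ^ (2 * k + 2) * \<theta> ^ (2 * k)) *\<^sub>R (?A ** ?A))"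
        by (simp only: conjunct2[OF Suc])
      also have "\<dots> = (t * ((-1) ^ k * t ^ (2 * k + 2) * \<theta> ^ (2 * k)) * (- (\<theta>\<^sup>2))) *\<^sub>R ?A"
        by (simp add: smul cub mult_ac)
      also have "t * ((-1) ^ k * t ^ (2 * k + 2) * \<theta> ^ (2 * k)) * (- (\<theta>\<^sup>2))
          = (-1) ^ Suc k * t ^ (2 * Suc k + 1) * \<theta> ^ (2 * Suc k)"
        by (simp add: power2_eq_square)
      finally show ?thesis .
    qed
    have "?p (2 * Suc k + 2) = (t *\<^sub>R ?A) ** ?p (2 * Suc k + 1)" by simp
    also have "\<dots> = (t *\<^sub>R ?A) ** (((-1) ^ Suc k * t ^ (2 * Suc k + 1) * \<theta> ^ (2 * Suc k)) *\<^sub>R ?A)"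
      by (simp only: o)
    also have "\<dots> = (t * ((-1) ^ Suc k * t ^ (2 * Suc k + 1) * \<theta> ^ (2 * Suc k))) *\<^sub>R (?A ** ?A)"
      by (simp only: smul scaleR_scaleR mult_ac)
    also have "t * ((-1) ^ Suc k * t ^ (2 * Suc k + 1) * \<theta> ^ (2 * Suc k))
        = (-1) ^ Suc k * t ^ (2 * Suc k + 2) * \<theta> ^ (2 * Suc k)"
      by simp
    finally show ?case using o by simp
  qed
  show ?thesis
  proof (cases n)
    case 0
    then show ?thesis by (simp add: sin_coeff_def cos_coeff_def)
  next
    case (Suc m)
    show ?thesis
    proof (cases "even m")
      case True
      then obtain k where "m = 2 * k" by (elim evenE)
      then have n: "n = 2 * k + 1" using Suc by simp
      have "sin_coeff n = (-1) ^ k / fact n" "cos_coeff n = 0"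
        unfolding sin_coeff_def cos_coeff_def n by simp_all
      then show ?thesis
        using p[of k] assms(1) unfolding n by (simp add: power_mult_distrib field_simps)
    next
      case False
      then obtain k where "m = 2 * k + 1" by (elim oddE)
      then have n: "n = 2 * k + 2" using Suc by simp
      have "cos_coeff n = (-1) ^ Suc k / fact n" "sin_coeff n = 0"
        unfolding sin_coeff_def cos_coeff_def n by simp_all
      moreover have "?p n = ((-1) ^ k * t ^ n * \<theta> ^ (2 * k)) *\<^sub>R (?A ** ?A)"
        using p[of k] unfolding n by blast
      moreover have "(t * \<theta>) ^ n = t ^ n * (\<theta> ^ (2 * k) * \<theta>\<^sup>2)"
        unfolding n by (simp only: power_mult_distrib power_add mult_ac)
      moreover have "n \<noteq> 0" using n by simp
      ultimately show ?thesis using assms(1) by simp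
    qed
  qed
qed

lemma mat_exp_0: "mat_exp 0 = mat 1"
proof -
  have "((\<lambda>M. 0 ** M) ^^ n) (mat 1 :: real^3^3) = (if n = 0 then mat 1 else 0)" for n
    by (cases n) auto
  then have "(\<lambda>n. (1 / fact n) *\<^sub>R ((\<lambda>M. 0 ** M) ^^ n) (mat 1 :: real^3^3))
      = (\<lambda>n. if n = 0 then mat 1 else 0)"
    by (auto simp: fun_eq_iff)
  then show ?thesis
    using sums_single[of 0 "\<lambda>_. mat 1 :: real^3^3", THEN sums_unique] by (simp add: mat_exp_def)
qed

lemma rodrigues:
  assumes "w \<noteq> 0"
  shows "mat_exp (t *\<^sub>R hat w) = mat 1 + (sin (t * norm w) / norm w) *\<^sub>R hat w
    + ((1 - cos (t * norm w)) / (norm w)\<^sup>2) *\<^sub>R (hat w ** hat w)"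
proof -
  let ?\<theta> = "norm w"
  have \<theta>: "?\<theta> \<noteq> 0" "?\<theta>\<^sup>2 = w \<bullet> w" using assms by (auto simp: power2_norm_eq_inner)
  have 1: "(\<lambda>n. (sin_coeff n * (t * ?\<theta>) ^ n) *\<^sub>R ((1 / ?\<theta>) *\<^sub>R hat w))
      sums (sin (t * ?\<theta>) *\<^sub>R ((1 / ?\<theta>) *\<^sub>R hat w))"
    using sin_converges[of "t * ?\<theta>"] by (intro sums_scaleR_left) simp
  have 2: "(\<lambda>n. (cos_coeff n * (t * ?\<theta>) ^ n) *\<^sub>R ((1 / ?\<theta>\<^sup>2) *\<^sub>R (hat w ** hat w)))
      sums (cos (t * ?\<theta>) *\<^sub>R ((1 / ?\<theta>\<^sup>2) *\<^sub>R (hat w ** hat w)))"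
    using cos_converges[of "t * ?\<theta>"] by (intro sums_scaleR_left) simp
  have 3: "(\<lambda>n. if n = 0 then mat 1 + (1 / ?\<theta>\<^sup>2) *\<^sub>R (hat w ** hat w) else 0)
      sums (mat 1 + (1 / ?\<theta>\<^sup>2) *\<^sub>R (hat w ** hat w))"
    using sums_single[of 0 "\<lambda>_. mat 1 + (1 / ?\<theta>\<^sup>2) *\<^sub>R (hat w ** hat w)"] by simp
  have "mat_exp (t *\<^sub>R hat w) = sin (t * ?\<theta>) *\<^sub>R ((1 / ?\<theta>) *\<^sub>R hat w)
      - cos (t * ?\<theta>) *\<^sub>R ((1 / ?\<theta>\<^sup>2) *\<^sub>R (hat w ** hat w))
      + (mat 1 + (1 / ?\<theta>\<^sup>2) *\<^sub>R (hat w ** hat w))"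
    unfolding mat_exp_def mat_exp_term_hat[OF \<theta>]
    by (rule sums_unique[symmetric]) (intro sums_add sums_diff 1 2 3)
  then show ?thesis by (simp add: diff_divide_distrib scaleR_left.diff algebra_simps)
qed

text \<open>The generator stands on the right to match the left trivialised velocity
  \<open>B ** hat \<Omega>\<close>. The case \<open>w = 0\<close> is separate because the Rodrigues
  formula divides by the norm.\<close>

lemma mat_exp_hat_has_vector_derivative:
  "((\<lambda>t. mat_exp (t *\<^sub>R hat w)) has_vector_derivative mat_exp (t *\<^sub>R hat w) ** hat w) (at t)"
proof (cases "w = 0")
  case True
  then show ?thesis by (simp add: hat_simps)
next
  case False
  let ?\<theta> = "norm w"
  have \<theta>: "?\<theta> \<noteq> 0" using False by simp
  have "(mat_exp (t *\<^sub>R hat w)) ** hat w = hat w + (sin (t * ?\<theta>) / ?\<theta>) *\<^sub>R (hat w ** hat w)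
      + ((1 - cos (t * ?\<theta>)) / ?\<theta>\<^sup>2) *\<^sub>R (hat w ** (hat w ** hat w))"
    by (simp add: rodrigues[OF False] matrix_add_left flip: scalar_matrix_assoc matrix_mul_assoc)
  also have "\<dots> = cos (t * ?\<theta>) *\<^sub>R hat w + (sin (t * ?\<theta>) / ?\<theta>) *\<^sub>R (hat w ** hat w)"
  proof -
    have "(1 - cos (t * ?\<theta>)) / ?\<theta>\<^sup>2 * - (w \<bullet> w) = cos (t * ?\<theta>) - 1"
      using \<theta> by (simp add: field_simps flip: power2_norm_eq_inner)
    then show ?thesis by (simp only: hat_cubed scaleR_scaleR) (simp add: algebra_simps)
  qed
  finally have eq: "mat_exp (t *\<^sub>R hat w) ** hat w
      = cos (t * ?\<theta>) *\<^sub>R hat w + (sin (t * ?\<theta>) / ?\<theta>) *\<^sub>R (hat w ** hat w)" .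
  show ?thesis
    unfolding eq unfolding rodrigues[OF False]
    using \<theta> by (auto intro!: derivative_eq_intros simp: power2_eq_square field_simps)
qed

text \<open>The product of the curve with its transpose has derivative zero by skew-symmetry of
  \<open>hat w\<close>, hence stays the identity.\<close>

lemma rotation_matrix_mat_exp_hat: "rotation_matrix (mat_exp (t *\<^sub>R hat w))"
proof -
  let ?B = "\<lambda>t. mat_exp (t *\<^sub>R hat w)"
  note D = mat_exp_hat_has_vector_derivative
  have cont: "continuous_on UNIV ?B"
    by (intro continuous_at_imp_continuous_on ballI has_vector_derivative_continuous[OF D])
  have "((\<lambda>t. ?B t ** transpose (?B t)) has_derivative (\<lambda>h. 0)) (at s)" for s
  proof -
    have "((\<lambda>t. ?B t ** transpose (?B t)) has_derivative
        (\<lambda>h. ?B s ** transpose (h *\<^sub>R (?B s ** hat w)) + h *\<^sub>R (?B s ** hat w) ** transpose (?B s))) (at s)"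
      using D[of w s, unfolded has_vector_derivative_def]
      by (intro derivative_intros)
    moreover have "?B s ** transpose (h *\<^sub>R (?B s ** hat w)) + h *\<^sub>R (?B s ** hat w) ** transpose (?B s) = 0" for h
      by (simp add: transpose_scalar matrix_transpose_mul transpose_hat matrix_scalar_ac
          matrix_mul_assoc matrix_minus_left matrix_minus_right flip: scalar_matrix_assoc)
    ultimately show ?thesis by simp
  qed
  then obtain c where "\<And>s. ?B s ** transpose (?B s) = c"
    using has_derivative_zero_constant[of UNIV "\<lambda>t. ?B t ** transpose (?B t)"] by auto
  moreover have "?B 0 ** transpose (?B 0) = mat 1" by (simp add: mat_exp_0 transpose_mat)
  ultimately have "?B s ** transpose (?B s) = mat 1" for s by metis
  then have "orthogonal_matrix (?B s)" for s
    by (simp add: orthogonal_matrix_def matrix_left_right_inverse)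
  then show ?thesis
    by (rule rotation_matrix_curve[OF cont]) (simp add: mat_exp_0 rotation_matrix_mat_1)
qed

section \<open>Hamiltonian vector fields in body coordinates\<close>

lemma cross3_dot_cyclic: "cross3 u v \<bullet> w = u \<bullet> cross3 v w"
  by (simp add: cross3_simps)

definition inertia_inv :: "real^3 \<Rightarrow> real^3^3" where
  "inertia_inv a = diag (\<chi> i. 1 / a $ i)"

text \<open>Angular velocity part of the inverse Legendre transform, from
  \<open>\<pi> = I \<Omega> + cross3 R p\<close>.\<close>

definition body_vel :: "real^3 \<Rightarrow> real^3 \<Rightarrow> real^3 \<Rightarrow> real^3 \<Rightarrow> real^3" where
  "body_vel a R \<pi> p = inertia_inv a *v (\<pi> - cross3 R p)"

definition reduced_H :: "real^3 \<Rightarrow> real^3 \<Rightarrow> real^3 \<Rightarrow> real^3 \<Rightarrow> real" where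
  "reduced_H a R \<pi> p = ((\<pi> - cross3 R p) \<bullet> body_vel a R \<pi> p + p \<bullet> p) / 2 + V2 (diag a) R"

definition grad_V :: "real^3 \<Rightarrow> real^3 \<Rightarrow> real^3" where
  "grad_V a R = (1 / norm R ^ 3 + 3 / (2 * norm R ^ 5)
      - 15 / (2 * norm R ^ 7) * (R \<bullet> (diag a *v R))) *\<^sub>R R + (3 / norm R ^ 5) *\<^sub>R (diag a *v R)"

text \<open>Hamilton's equations in body coordinates. Being an explicit formula on the whole ambient
  vector space, it can be extended, estimated and integrated there; on \<open>phase_space\<close> it
  is the Hamiltonian vector field by \<open>ham_vf_H2\<close>.\<close>

definition sat_vf :: "real^3 \<Rightarrow> phase \<Rightarrow> phase" where
  "sat_vf a = (\<lambda>(B, R, \<pi>, p). (B ** hat (body_vel a R \<pi> p), p - cross3 (body_vel a R \<pi> p) R,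
     cross3 \<pi> (body_vel a R \<pi> p), cross3 p (body_vel a R \<pi> p) - grad_V a R))"

lemma diag_mult_vec: "(diag a *v x) $ i = a $ i * x $ i"
proof -
  have "(diag a *v x) $ i = (\<Sum>j\<in>UNIV. if i = j then a $ i * x $ j else 0)"
    unfolding diag_def matrix_vector_mult_def vec_lambda_beta by (rule sum.cong) auto
  then show ?thesis by simp
qed

lemma diag_sym: "x \<bullet> (diag a *v y) = y \<bullet> (diag a *v x)"
  by (simp add: inner_vec_def diag_mult_vec mult_ac)

lemma inertia_inv_sym: "x \<bullet> (inertia_inv a *v y) = y \<bullet> (inertia_inv a *v x)"
  by (simp add: inertia_inv_def diag_sym)

lemma quadratic_has_derivative:
  "((\<lambda>R. R \<bullet> (diag a *v R)) has_derivative (\<lambda>r. 2 * (r \<bullet> (diag a *v R)))) (at R)"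
  by (rule has_derivative_eq_rhs, rule derivative_intros, rule derivative_intros, rule derivative_intros,
      rule derivative_intros, rule derivative_intros) (auto simp: fun_eq_iff diag_sym[of R a])

lemma inverse_norm_power_has_derivative:
  fixes R :: "'a::real_inner"
  assumes "R \<noteq> 0"
  shows "((\<lambda>R. c / norm R ^ Suc k) has_derivative (\<lambda>r. - (c * Suc k * (r \<bullet> R) / norm R ^ (k + 3)))) (at R)"
proof -
  have n: "norm R > 0" using assms by simp
  have sgn: "r \<bullet> sgn R = (r \<bullet> R) / norm R" for r
    by (simp add: sgn_div_norm divide_inverse mult.commute)
  have N: "((\<lambda>R. norm R) has_derivative (\<lambda>r. (r \<bullet> R) / norm R)) (at R)"
    using has_derivative_norm[OF assms] by (simp add: sgn)
  have "((\<lambda>R. norm R ^ Suc k) has_derivative (\<lambda>r. Suc k * ((r \<bullet> R) / norm R) * norm R ^ k)) (at R)"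
    using has_derivative_power[OF N, of "Suc k"] by simp
  from has_derivative_divide[OF has_derivative_const[of c] this] show ?thesis
    by (rule has_derivative_eq_rhs)
      (use n in \<open>auto simp: fun_eq_iff field_simps power_numeral_reduce power_add\<close>)
qed

lemma V2_has_derivative:
  assumes "R \<noteq> 0"
  shows "(V2 (diag a) has_derivative (\<lambda>r. grad_V a R \<bullet> r)) (at R)"
proof -
  have n: "norm R > 0" using assms by simp
  let ?q = "R \<bullet> (diag a *v R)"
  note I = quadratic_has_derivative[of a R]
  note P = inverse_norm_power_has_derivative[OF assms, of _ 0, simplified]
    inverse_norm_power_has_derivative[OF assms, of _ 2, simplified]
    inverse_norm_power_has_derivative[OF assms, of _ 4, simplified]
  have "((\<lambda>R. (-1) / norm R + (-1/2) / norm R ^ 3 + (3/2) / norm R ^ 5 * (R \<bullet> (diag a *v R)))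
      has_derivative (\<lambda>r. grad_V a R \<bullet> r)) (at R)"
  proof (rule has_derivative_eq_rhs[OF has_derivative_add[OF has_derivative_add[OF P(1) P(2)]
          has_derivative_mult[OF P(3) I]]], rule ext)
    fix r
    show "- (- 1 * (r \<bullet> R) / norm R ^ 3) + - (- 1 / 2 * 3 * (r \<bullet> R) / norm R ^ 5)
        + (3 / 2 / norm R ^ 5 * (2 * (r \<bullet> (diag a *v R)))
          + - (3 / 2 * 5 * (r \<bullet> R) / norm R ^ 7) * ?q) = grad_V a R \<bullet> r"
      unfolding grad_V_def inner_add_left inner_scaleR_left inner_commute[of R r]
        inner_commute[of "diag a *v R" r]
      using n by (simp add: field_simps)
  qed
  then show ?thesis
    by (rule has_derivative_transform_within[OF _ zero_less_one]) (auto simp: V2_def)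
qed

lemma grad_V_has_derivative:
  assumes "R \<noteq> 0"
  shows "(grad_V a has_derivative (\<lambda>r.
      (1 / norm R ^ 3 + 3 / (2 * norm R ^ 5) - 15 / (2 * norm R ^ 7) * (R \<bullet> (diag a *v R))) *\<^sub>R r
      - ((3 / norm R ^ 5 + 15 / (2 * norm R ^ 7) - 105 / (2 * norm R ^ 9) * (R \<bullet> (diag a *v R))) * (r \<bullet> R)
          + 15 / norm R ^ 7 * (r \<bullet> (diag a *v R))) *\<^sub>R R
      + (3 / norm R ^ 5) *\<^sub>R (diag a *v r) - (15 * (r \<bullet> R) / norm R ^ 7) *\<^sub>R (diag a *v R))) (at R)"
proof -
  note P = inverse_norm_power_has_derivative[OF assms, of _ 2, simplified]
    inverse_norm_power_has_derivative[OF assms, of _ 4, simplified]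
    inverse_norm_power_has_derivative[OF assms, of _ 6, simplified]
  have lin: "((*v) (diag a) has_derivative (*v) (diag a)) (at R)"
    by (intro bounded_linear_imp_has_derivative matrix_vector_mul_bounded_linear)
  have eq: "grad_V a = (\<lambda>R. (1 / norm R ^ 3 + (3/2) / norm R ^ 5
      - (15/2) / norm R ^ 7 * (R \<bullet> (diag a *v R))) *\<^sub>R R + (3 / norm R ^ 5) *\<^sub>R (diag a *v R))"
    by (simp add: fun_eq_iff grad_V_def)
  show ?thesis
    unfolding eq
    by (rule has_derivative_eq_rhs[OF has_derivative_add[OF has_derivative_scaleR[OF
          has_derivative_diff[OF has_derivative_add[OF P(1) P(2)] has_derivative_mult[OF P(3)
            quadratic_has_derivative]] has_derivative_ident] has_derivative_scaleR[OF P(2) lin]]])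
      (simp add: fun_eq_iff algebra_simps)
qed

locale satellite =
  fixes a :: "real^3"
  assumes a_pos: "\<And>i. a $ i > 0"
begin

abbreviation "\<I> \<equiv> diag a"
abbreviation "Om \<equiv> body_vel a"

lemma inertia_inv_inverse: "inertia_inv a *v (\<I> *v x) = x" "\<I> *v (inertia_inv a *v x) = x"
  using a_pos[THEN less_imp_neq] by (auto simp: vec_eq_iff inertia_inv_def diag_mult_vec)

lemma inertia_body_vel: "\<I> *v Om R \<pi> p = \<pi> - cross3 R p"
  by (simp add: body_vel_def inertia_inv_inverse)

lemma inv_legendre: "inv (legendre \<I> R) (\<pi>, p) = (Om R \<pi> p, p - cross3 (Om R \<pi> p) R)"
proof (rule inv_f_eq)
  show "inj (legendre \<I> R)"
  proof (rule injI)
    fix x y assume "legendre \<I> R x = legendre \<I> R y"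
    then have 1: "\<I> *v fst x = \<I> *v fst y" and 2: "snd x + cross3 (fst x) R = snd y + cross3 (fst y) R"
      by (auto simp: legendre_def case_prod_unfold)
    have "fst x = fst y" using 1 by (metis inertia_inv_inverse(1))
    then show "x = y" using 2 by (simp add: prod_eq_iff)
  qed
qed (simp add: legendre_def inertia_body_vel)

lemma body_vel_legendre: "Om R (fst (legendre \<I> R (\<Omega>, v))) (snd (legendre \<I> R (\<Omega>, v))) = \<Omega>"
  by (simp add: legendre_def body_vel_def inertia_inv_inverse)

lemma H2_eq: "H2 \<I> (B, R, \<pi>, p) = reduced_H a R \<pi> p"
  by (simp add: H2_def inv_legendre kinetic_def reduced_H_def inertia_body_vel inner_commute
      power2_norm_eq_inner)

lemma reduced_H_has_derivative:
  fixes B :: "real^3^3"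
  assumes "R \<noteq> 0"
  shows "((\<lambda>(B, R, \<pi>, p). reduced_H a R \<pi> p) has_derivative
    (\<lambda>(B', r, \<pi>', p'). Om R \<pi> p \<bullet> \<pi>' + (grad_V a R - cross3 p (Om R \<pi> p)) \<bullet> r
      + (p - cross3 (Om R \<pi> p) R) \<bullet> p')) (at (B, R, \<pi>, p))"
proof -
  let ?z = "(B, R, \<pi>, p)"
  let ?m = "\<lambda>z::phase. fst (snd (snd z)) - cross3 (fst (snd z)) (snd (snd (snd z)))"
  let ?m' = "\<lambda>z::phase. fst (snd (snd z)) - (cross3 R (snd (snd (snd z))) + cross3 (fst (snd z)) p)"
  have m: "(?m has_derivative ?m') (at ?z)"
    by (auto intro!: derivative_eq_intros)
  have V: "((\<lambda>z::phase. V2 (diag a) (fst (snd z))) has_derivative (\<lambda>z. grad_V a R \<bullet> fst (snd z))) (at ?z)"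
    using V2_has_derivative[OF assms, of a]
    by (intro has_derivative_compose[where f="\<lambda>z. fst (snd z)" and g="V2 (diag a)", simplified])
      (auto intro!: derivative_eq_intros)
  have "((\<lambda>z. (?m z \<bullet> (inertia_inv a *v ?m z) + snd (snd (snd z)) \<bullet> snd (snd (snd z))) / 2
        + V2 (diag a) (fst (snd z))) has_derivative
    (\<lambda>z. (?m ?z \<bullet> (inertia_inv a *v ?m' z) + ?m' z \<bullet> (inertia_inv a *v ?m ?z)
       + (p \<bullet> snd (snd (snd z)) + snd (snd (snd z)) \<bullet> p)) / 2 + grad_V a R \<bullet> fst (snd z))) (at ?z)"
    by (auto intro!: derivative_eq_intros m V)
  moreover have "(\<lambda>z. (?m z \<bullet> (inertia_inv a *v ?m z) + snd (snd (snd z)) \<bullet> snd (snd (snd z))) / 2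
        + V2 (diag a) (fst (snd z))) = (\<lambda>(B, R, \<pi>, p). reduced_H a R \<pi> p)"
    by (auto simp: fun_eq_iff reduced_H_def body_vel_def)
  moreover have "(\<lambda>z. (?m ?z \<bullet> (inertia_inv a *v ?m' z) + ?m' z \<bullet> (inertia_inv a *v ?m ?z)
       + (p \<bullet> snd (snd (snd z)) + snd (snd (snd z)) \<bullet> p)) / 2 + grad_V a R \<bullet> fst (snd z))
    = (\<lambda>(B', r, \<pi>', p'). Om R \<pi> p \<bullet> \<pi>' + (grad_V a R - cross3 p (Om R \<pi> p)) \<bullet> r
      + (p - cross3 (Om R \<pi> p) R) \<bullet> p')"
  proof -
    have "\<Omega> \<bullet> (\<pi>' - (cross3 R p' + cross3 r p)) = \<Omega> \<bullet> \<pi>' - cross3 p \<Omega> \<bullet> r - cross3 \<Omega> R \<bullet> p'"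
      for \<Omega> \<pi>' p' r :: "real^3"
      by (simp add: cross3_simps)
    moreover have "m \<bullet> (inertia_inv a *v d) + d \<bullet> (inertia_inv a *v m) = 2 * ((inertia_inv a *v m) \<bullet> d)"
      for m d :: "real^3"
      using inertia_inv_sym[of m a d] by (simp add: inner_commute)
    ultimately have "(?m ?z \<bullet> (inertia_inv a *v ?m' z) + ?m' z \<bullet> (inertia_inv a *v ?m ?z)
         + (p \<bullet> snd (snd (snd z)) + snd (snd (snd z)) \<bullet> p)) / 2 + grad_V a R \<bullet> fst (snd z)
      = Om R \<pi> p \<bullet> fst (snd (snd z)) + (grad_V a R - cross3 p (Om R \<pi> p)) \<bullet> fst (snd z)
      + (p - cross3 (Om R \<pi> p) R) \<bullet> snd (snd (snd z))" for z :: phase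
      by (simp only: fst_conv snd_conv)
        (simp add: inner_diff_left inner_commute[of _ p] flip: body_vel_def)
    then show ?thesis by (simp add: fun_eq_iff)
  qed
  ultimately show ?thesis by simp
qed

end

text \<open>Canonical form in left trivialisation. The term containing \<open>\<pi>\<close> is the
  Lie bracket of the two body velocities.\<close>

lemma omega_tangent:
  assumes "orthogonal_matrix B"
  shows "omega (B, R, \<pi>, p) (B ** hat w, r, \<pi>1, p1) (B ** hat w2, r2, \<pi>2, p2)
    = \<pi>2 \<bullet> w - \<pi>1 \<bullet> w2 + \<pi> \<bullet> cross3 w w2 + p2 \<bullet> r - p1 \<bullet> r2"
proof -
  have D: "frechet_derivative (\<lambda>z'. theta z' X) (at (B, R, \<pi>, p)) Y
      = fst (snd (snd Y)) \<bullet> vee (transpose B ** fst X) + \<pi> \<bullet> vee (transpose (fst Y) ** fst X)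
        + snd (snd (snd Y)) \<bullet> fst (snd X)" for X Y
  proof -
    have "((\<lambda>z'. theta z' X) has_derivative (\<lambda>Y. fst (snd (snd Y)) \<bullet> vee (transpose B ** fst X)
        + \<pi> \<bullet> vee (transpose (fst Y) ** fst X) + snd (snd (snd Y)) \<bullet> fst (snd X))) (at (B, R, \<pi>, p))"
      unfolding theta_def case_prod_unfold
      by (auto intro!: derivative_eq_intros simp: fun_eq_iff)
    then show ?thesis by (simp flip: frechet_derivative_at)
  qed
  have BB: "transpose B ** (B ** M) = M" for M :: "real^3^3"
    using assms by (simp add: matrix_mul_assoc orthogonal_matrix_def)
  \<comment> \<open>Differentiating the base rotation in \<open>theta\<close> leaves a product of
    two skew matrices; antisymmetrising it gives their commutator, to which
    \<open>hat_commutator\<close> applies.\<close>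
  have "\<pi> \<bullet> vee (transpose (B ** hat w2) ** (B ** hat w)) - \<pi> \<bullet> vee (transpose (B ** hat w) ** (B ** hat w2))
      = \<pi> \<bullet> vee (hat w ** hat w2 - hat w2 ** hat w)"
    by (simp add: matrix_transpose_mul BB transpose_hat matrix_minus_left flip: matrix_mul_assoc
        linear_diff[OF bounded_linear.linear[OF bounded_linear_vee]] inner_diff_right)
  then show ?thesis
    by (simp add: omega_def D BB hat_commutator)
qed

text \<open>Reads off Hamilton's equations from the four partial gradients. As \<open>ham_vf\<close>
  is a definite description, uniqueness is shown too: testing with each of the four kinds of tangent
  directions determines the vector, which is nondegeneracy of \<open>omega\<close>.\<close>

lemma ham_vf_eqI:
  assumes B: "orthogonal_matrix B"
    and F: "(F has_derivative F') (at (B, R, \<pi>, p))"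
    and F': "\<And>w r \<pi>' p'. F' (B ** hat w, r, \<pi>', p') = fw \<bullet> w + fR \<bullet> r + f\<pi> \<bullet> \<pi>' + fp \<bullet> p'"
  shows "ham_vf F (B, R, \<pi>, p) = (B ** hat f\<pi>, fp, cross3 \<pi> f\<pi> - fw, - fR)"
proof -
  have FD: "frechet_derivative F (at (B, R, \<pi>, p)) = F'"
    using F by (rule frechet_derivative_at[symmetric])
  show ?thesis
    unfolding ham_vf_def
  proof (rule the_equality)
    show "(B ** hat f\<pi>, fp, cross3 \<pi> f\<pi> - fw, - fR) \<in> tangent_space (B, R, \<pi>, p) \<and>
      (\<forall>Y\<in>tangent_space (B, R, \<pi>, p).
        omega (B, R, \<pi>, p) (B ** hat f\<pi>, fp, cross3 \<pi> f\<pi> - fw, - fR) Y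
        = frechet_derivative F (at (B, R, \<pi>, p)) Y)"
    proof (intro conjI ballI)
      fix Y assume "Y \<in> tangent_space (B, R, \<pi>, p)"
      then obtain w r \<pi>' p' where Y: "Y = (B ** hat w, r, \<pi>', p')"
        by (auto simp: tangent_space_def)
      have cyc: "\<pi> \<bullet> cross3 f\<pi> w = w \<bullet> cross3 \<pi> f\<pi>"
        by (simp add: cross3_simps)
      show "omega (B, R, \<pi>, p) (B ** hat f\<pi>, fp, cross3 \<pi> f\<pi> - fw, - fR) Y
        = frechet_derivative F (at (B, R, \<pi>, p)) Y"
        unfolding Y FD F' omega_tangent[OF B]
        by (simp add: cyc inner_diff_left inner_diff_right inner_commute)
    qed (auto simp: tangent_space_def)
  next
    fix X assume X: "X \<in> tangent_space (B, R, \<pi>, p) \<and>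
      (\<forall>Y\<in>tangent_space (B, R, \<pi>, p). omega (B, R, \<pi>, p) X Y = frechet_derivative F (at (B, R, \<pi>, p)) Y)"
    then obtain w r \<pi>1 p1 where Xeq: "X = (B ** hat w, r, \<pi>1, p1)"
      by (auto simp: tangent_space_def)
    have eq: "\<pi>2 \<bullet> w - \<pi>1 \<bullet> w2 + \<pi> \<bullet> cross3 w w2 + p2 \<bullet> r - p1 \<bullet> r2
        = fw \<bullet> w2 + fR \<bullet> r2 + f\<pi> \<bullet> \<pi>2 + fp \<bullet> p2" for w2 r2 \<pi>2 p2
    proof -
      have "(B ** hat w2, r2, \<pi>2, p2) \<in> tangent_space (B, R, \<pi>, p)"
        by (auto simp: tangent_space_def)
      then show ?thesis using X unfolding Xeq FD by (metis F' omega_tangent[OF B])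
    qed
    have "w = f\<pi>" using eq[of _ 0 0 0] by (intro vector_eq_rdot[THEN iffD1]) (simp add: inner_commute)
    moreover have "r = fp" using eq[of 0 0 _ 0] by (intro vector_eq_rdot[THEN iffD1]) (simp add: inner_commute)
    moreover have "- p1 = fR" using eq[of 0 0 0] by (intro vector_eq_rdot[THEN iffD1]) (simp add: inner_commute)
    moreover have "\<pi>1 = cross3 \<pi> w - fw"
      using eq[of 0 _ 0 0] by (intro vector_eq_rdot[THEN iffD1])
        (simp add: inner_diff_left cross3_dot_cyclic algebra_simps)
    ultimately show "X = (B ** hat f\<pi>, fp, cross3 \<pi> f\<pi> - fw, - fR)" by (auto simp: Xeq)
  qed
qed

context satellite
begin

lemma H2_eq': "H2 \<I> = (\<lambda>(B, R, \<pi>, p). reduced_H a R \<pi> p)"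
  by (auto simp: fun_eq_iff H2_eq)

lemma ham_vf_H2:
  assumes "z \<in> phase_space"
  shows "ham_vf (H2 \<I>) z = sat_vf a z"
proof -
  obtain B R \<pi> p where z: "z = (B, R, \<pi>, p)" and B: "orthogonal_matrix B" and R: "R \<noteq> 0"
    using assms by (auto simp: phase_space_def rotation_matrix_def)
  have "ham_vf (H2 \<I>) (B, R, \<pi>, p) = (B ** hat (Om R \<pi> p), p - cross3 (Om R \<pi> p) R,
      cross3 \<pi> (Om R \<pi> p) - 0, - (grad_V a R - cross3 p (Om R \<pi> p)))"
    by (rule ham_vf_eqI[OF B reduced_H_has_derivative[OF R, folded H2_eq']]) simp
  then show ?thesis by (simp add: z sat_vf_def)
qed

text \<open>The momentum map generates left rotations, which in body coordinates move
  \<open>B\<close> alone: its two contributions to the \<open>\<pi>\<close> component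
  cancel.\<close>

lemma ham_vf_H2_J:
  assumes "z \<in> phase_space"
  shows "ham_vf (\<lambda>y. H2 \<I> y - J y \<bullet> \<xi>) z = sat_vf a z - (fst z ** hat (transpose (fst z) *v \<xi>), 0, 0, 0)"
proof -
  obtain B R \<pi> p where z: "z = (B, R, \<pi>, p)" and B: "orthogonal_matrix B" and R: "R \<noteq> 0"
    using assms by (auto simp: phase_space_def rotation_matrix_def)
  let ?\<eta> = "transpose B *v \<xi>"
  have adj: "(B *v x) \<bullet> \<xi> = x \<bullet> ?\<eta>" for x
    by (metis dot_lmul_matrix inner_commute vector_transpose_matrix)
  have Jd: "((\<lambda>y. J y \<bullet> \<xi>) has_derivative (\<lambda>Y. (fst Y *v \<pi> + B *v fst (snd (snd Y))) \<bullet> \<xi>)) (at (B, R, \<pi>, p))"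
    unfolding J_def case_prod_unfold by (auto intro!: derivative_eq_intros simp: fun_eq_iff add.commute)
  have "ham_vf (\<lambda>y. H2 \<I> y - J y \<bullet> \<xi>) (B, R, \<pi>, p) = (B ** hat (Om R \<pi> p - ?\<eta>), p - cross3 (Om R \<pi> p) R,
      cross3 \<pi> (Om R \<pi> p - ?\<eta>) - (- cross3 \<pi> ?\<eta>), - (grad_V a R - cross3 p (Om R \<pi> p)))"
  proof (rule ham_vf_eqI[OF B has_derivative_diff[OF reduced_H_has_derivative[OF R, folded H2_eq'] Jd]])
    fix w r \<pi>' p'
    have "((B ** hat w) *v \<pi>) \<bullet> \<xi> = cross3 \<pi> ?\<eta> \<bullet> w"
      by (simp only: hat_mult_vec adj flip: matrix_vector_mul_assoc) (simp add: cross3_simps)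
    then show "(case (B ** hat w, r, \<pi>', p') of (B', r, \<pi>', p') \<Rightarrow>
         Om R \<pi> p \<bullet> \<pi>' + (grad_V a R - cross3 p (Om R \<pi> p)) \<bullet> r + (p - cross3 (Om R \<pi> p) R) \<bullet> p') -
         (fst (B ** hat w, r, \<pi>', p') *v \<pi> + B *v fst (snd (snd (B ** hat w, r, \<pi>', p')))) \<bullet> \<xi>
       = - cross3 \<pi> ?\<eta> \<bullet> w + (grad_V a R - cross3 p (Om R \<pi> p)) \<bullet> r + (Om R \<pi> p - ?\<eta>) \<bullet> \<pi>'
         + (p - cross3 (Om R \<pi> p) R) \<bullet> p'"
      using adj[of \<pi>'] by (simp add: inner_add_left inner_diff_left inner_add_right inner_diff_right
          inner_commute del: transpose_matrix_vector)
  qed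
  then show ?thesis
    by (simp add: z sat_vf_def hat_simps Cross3.right_diff_distrib
        bounded_bilinear.diff_right[OF bounded_bilinear_matrix_mult] del: transpose_matrix_vector)
qed

end

section \<open>Relative equilibria\<close>

lemma act_one_param: "act (one_param \<xi> t) (B, R, \<pi>, p) = (mat_exp (t *\<^sub>R hat \<xi>) ** B, R, \<pi>, p)"
  by (simp add: act_def one_param_def transpose_mat)

context satellite
begin

text \<open>A rotation by \<open>one_param\<close> leaves \<open>R\<close>, \<open>\<pi>\<close>,
  \<open>p\<close> unchanged, so these components of the vector field vanish. The velocity component
  of \<open>R\<close> vanishes automatically at a pair point; the other two give the balance of
  torque and of force.\<close>

lemma relative_equilibrium_imp:
  assumes "relative_equilibrium \<I> (pair_point \<I> R \<xi>) \<xi>"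
  shows "R \<noteq> 0" "cross3 (\<I> *v \<xi> + cross3 R (cross3 \<xi> R)) \<xi> = 0"
    "cross3 (cross3 \<xi> R) \<xi> = grad_V a R"
proof -
  let ?z = "pair_point \<I> R \<xi>" and ?c = "legendre \<I> R (\<xi>, 0)"
  let ?\<gamma> = "\<lambda>t. act (one_param \<xi> t) ?z"
  have \<gamma>: "?\<gamma> t = (mat_exp (t *\<^sub>R hat \<xi>), R, ?c)" for t
    by (cases ?c) (simp add: pair_point_def act_one_param)
  have ps: "?\<gamma> 0 \<in> phase_space" and
    D: "(?\<gamma> has_vector_derivative ham_vf (H2 \<I>) (?\<gamma> 0)) (at 0)"
    using assms by (auto simp: relative_equilibrium_def integral_curve_def)
  show "R \<noteq> 0" using ps by (cases ?c) (auto simp: \<gamma> phase_space_def)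
  have "((\<lambda>t. snd (?\<gamma> t)) has_vector_derivative snd (ham_vf (H2 \<I>) (?\<gamma> 0))) (at 0)"
    by (rule bounded_linear.has_vector_derivative[OF bounded_linear_snd D])
  moreover have "((\<lambda>t. snd (?\<gamma> t)) has_vector_derivative 0) (at 0)"
    by (simp add: \<gamma>)
  ultimately have "snd (sat_vf a (?\<gamma> 0)) = 0"
    using vector_derivative_unique_at ham_vf_H2[OF ps] by metis
  then show "cross3 (\<I> *v \<xi> + cross3 R (cross3 \<xi> R)) \<xi> = 0" "cross3 (cross3 \<xi> R) \<xi> = grad_V a R"
    using body_vel_legendre[of R \<xi> 0]
    by (simp_all add: \<gamma> sat_vf_def legendre_def zero_prod_def)
qed

text \<open>Conversely, the balance equations leave only the rotation moving, with constant body
  velocity \<open>\<xi>\<close>, and the exponential is then the solution.\<close>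

lemma relative_equilibriumI:
  assumes "R \<noteq> 0" "cross3 (\<I> *v \<xi> + cross3 R (cross3 \<xi> R)) \<xi> = 0"
    "cross3 (cross3 \<xi> R) \<xi> = grad_V a R"
  shows "relative_equilibrium \<I> (pair_point \<I> R \<xi>) \<xi>"
proof -
  let ?\<pi> = "\<I> *v \<xi> + cross3 R (cross3 \<xi> R)" and ?p = "cross3 \<xi> R"
  have z: "pair_point \<I> R \<xi> = (mat 1, R, ?\<pi>, ?p)"
    by (simp add: pair_point_def legendre_def)
  have \<gamma>: "act (one_param \<xi> t) (pair_point \<I> R \<xi>) = (mat_exp (t *\<^sub>R hat \<xi>), R, ?\<pi>, ?p)" for t
    by (simp add: z act_one_param)
  have ps: "(mat_exp (t *\<^sub>R hat \<xi>), R, ?\<pi>, ?p) \<in> phase_space" for t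
    using assms(1) by (simp add: phase_space_def rotation_matrix_mat_exp_hat)
  have "Om R ?\<pi> ?p = \<xi>"
    using body_vel_legendre[of R \<xi> 0] by (simp add: legendre_def)
  then have "ham_vf (H2 \<I>) (mat_exp (t *\<^sub>R hat \<xi>), R, ?\<pi>, ?p) = (mat_exp (t *\<^sub>R hat \<xi>) ** hat \<xi>, 0)" for t
    using assms by (simp add: ham_vf_H2[OF ps] sat_vf_def zero_prod_def)
  then show ?thesis
    unfolding relative_equilibrium_def integral_curve_def \<gamma>
    using ps ps[of 0] mat_exp_hat_has_vector_derivative
    by (auto simp: z mat_exp_0 intro!: has_vector_derivative_Pair)
qed

end

text \<open>The inequality \<open>3 * I2 < 1\<close> carries what the trace condition contributes:
  \<open>I2\<close> is the smallest of three numbers with sum 1.\<close>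

locale lagrange =
  fixes I1 I2 I3 :: real
  assumes I_pos: "0 < I2" and I_order: "I2 < I3" "I3 < I1" and I2_less: "3 * I2 < 1"
begin

abbreviation "aI \<equiv> vector [I1, I2, I3] :: real^3"

sublocale satellite aI
proof
  have "aI $ 1 > 0 \<and> aI $ 2 > 0 \<and> aI $ 3 > 0" using I_pos I_order by simp
  then show "aI $ i > 0" for i using exhaust_3[of i] by auto
qed

lemma family_relative_equilibrium:
  assumes r: "r > 0" and k: "k\<^sup>2 = (2 * r^2 + 3 - 9 * I2) / (2 * r^5)"
  shows "relative_equilibrium \<I> (pair_point \<I> (vector [0, r, 0]) (vector [k, 0, 0])) (vector [k, 0, 0])"
proof (rule relative_equilibriumI)
  let ?R = "vector [0, r, 0] :: real^3" and ?k = "vector [k, 0, 0] :: real^3"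
  have n: "norm ?R = r"
    using r by (simp add: norm_eq_sqrt_inner inner_vec_def sum_3)
  show "?R \<noteq> 0" using r n by auto
  show "cross3 (\<I> *v ?k + cross3 ?R (cross3 ?k ?R)) ?k = 0"
    by (simp add: vec_eq_iff forall_3 cross3_def diag_mult_vec)
  have "k\<^sup>2 * r = (1 / r ^ 3 + 3 / (2 * r ^ 5) - 15 / (2 * r ^ 7) * (I2 * r\<^sup>2)) * r + 3 / r ^ 5 * (I2 * r)"
    unfolding k using r by (simp add: field_simps power_numeral_reduce)
  then show "cross3 (cross3 ?k ?R) ?k = grad_V aI ?R"
    unfolding grad_V_def n
    by (simp add: vec_eq_iff forall_3 cross3_def diag_mult_vec inner_vec_def sum_3 power2_eq_square algebra_simps)
qed

lemma pair_point_family: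
  "pair_point \<I> (vector [0, r, 0]) (vector [k, 0, 0])
    = (mat 1, vector [0, r, 0], vector [(I1 + r\<^sup>2) * k, 0, 0], vector [0, 0, k * r])"
  by (simp add: pair_point_def legendre_def vec_eq_iff forall_3 cross3_def diag_mult_vec
      power2_eq_square algebra_simps)

text \<open>Here \<open>(x, y, z)\<close> is \<open>R\<close>,
  \<open>(\<alpha>, \<beta>, \<gamma>)\<close> is \<open>\<xi>\<close>, \<open>s\<close> is the
  squared length of \<open>\<xi>\<close> and \<open>t\<close> is \<open>R \<bullet> \<xi>\<close>.
  The equations \<open>e\<close> are the force balance, \<open>m\<close> two components of the
  torque balance, and \<open>nb\<close> says that the pair is near the family.\<close>

lemma bifurcation_algebra:
  fixes x y z \<alpha> \<beta> \<gamma> f c s t :: real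
  assumes t: "t = x * \<alpha> + y * \<beta> + z * \<gamma>" and c: "c > 0"
    and e: "(f + c * I1) * x = s * x - \<alpha> * t" "(f + c * I2) * y = s * y - \<beta> * t"
      "(f + c * I3) * z = s * z - \<gamma> * t"
    and m: "\<alpha> * \<beta> * (I1 - I2) = t * (x * \<beta> - y * \<alpha>)" "\<gamma> * \<alpha> * (I3 - I1) = t * (z * \<alpha> - x * \<gamma>)"
    and nb: "y > 0" "\<alpha> > 0" "\<beta> * t < c * (I3 - I2) * y" "\<beta> * x < \<alpha> * y"
  shows "x = 0" "z = 0" "\<beta> = 0" "\<gamma> = 0"
proof -
  \<comment> \<open>The second force equation determines \<open>s\<close>, since
    \<open>y > 0\<close>. Substituted into the other two it gives
    \<open>A * x = - \<alpha> * t\<close> and \<open>C * z = - \<gamma> * t\<close>; the third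
    inequality of \<open>nb\<close>, divided by \<open>y\<close>, is positivity of \<open>C\<close>,
    and \<open>A\<close> exceeds \<open>C\<close> because \<open>I1 > I3\<close>.\<close>
  define g where "g = \<beta> * t / y"
  have g: "s = f + c * I2 + g" using e(2) nb(1) by (simp add: g_def field_simps)
  define A where "A = c * (I1 - I2) - g"
  define C where "C = c * (I3 - I2) - g"
  have C: "C > 0" using nb by (simp add: C_def g_def field_simps)
  moreover have "A - C = c * (I1 - I3)" by (simp add: A_def C_def algebra_simps)
  moreover have "c * (I1 - I3) > 0" using c I_order by simp
  ultimately have A: "A > 0" by linarith
  have x: "A * x = - \<alpha> * t" using e(1) g by (simp add: A_def algebra_simps)
  have z: "C * z = - \<gamma> * t" using e(3) g by (simp add: C_def algebra_simps)
  have "t = 0"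
  proof (rule ccontr)
    assume t0: "t \<noteq> 0"
    have "t * (x * \<alpha>) = - (A * x) * x" unfolding x by simp
    then have "t * (x * \<alpha>) \<le> 0" using A by (simp add: mult.assoc)
    moreover have "t * (z * \<gamma>) = - (C * z) * z" unfolding z by simp
    then have "t * (z * \<gamma>) \<le> 0" using C by (simp add: mult.assoc)
    \<comment> \<open>The term along the second axis gets its sign from the torque balance instead:
      \<open>m(1)\<close> times \<open>y * t\<close>, with the last inequality of
      \<open>nb\<close>.\<close>
    moreover have "t * (y * \<beta>) \<le> 0"
    proof -
      have "(\<alpha> * (I1 - I2)) * (t * (y * \<beta>)) = y * t * (t * (x * \<beta> - y * \<alpha>))"
        unfolding m(1)[symmetric] by (simp add: algebra_simps)
      also have "\<dots> = - (y * t\<^sup>2 * (y * \<alpha> - x * \<beta>))" by (simp add: power2_eq_square algebra_simps)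
      also have "\<dots> \<le> 0" using nb by (simp add: mult.commute)
      finally show ?thesis using nb(2) I_order by (simp add: mult_le_0_iff)
    qed
    ultimately have "t * t \<le> 0" by (subst (2) t) (simp add: distrib_left)
    then show False using t0 by (auto simp: mult_le_0_iff)
  qed
  then show "x = 0" "z = 0" "\<beta> = 0" "\<gamma> = 0"
    using x z A C m nb I_order by auto
qed

text \<open>The conditions \<open>nb\<close> are strict inequalities between continuous functions
  that hold along the family, so they cut out an open neighbourhood of it.\<close>

lemma relative_equilibria_nearby:
  fixes R \<xi> :: "real^3"
  assumes re: "relative_equilibrium \<I> (pair_point \<I> R \<xi>) \<xi>"
    and nb: "R $ 2 > 0" "\<xi> $ 1 > 0" "\<xi> $ 2 * (R \<bullet> \<xi>) * norm R ^ 5 < 3 * (I3 - I2) * R $ 2"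
      "\<xi> $ 2 * R $ 1 < \<xi> $ 1 * R $ 2"
  shows "R = vector [0, R $ 2, 0]" "\<xi> = vector [\<xi> $ 1, 0, 0]"
    "(\<xi> $ 1)\<^sup>2 = (2 * (R $ 2)^2 + 3 - 9 * I2) / (2 * (R $ 2)^5)"
proof -
  note eqs = relative_equilibrium_imp[OF re]
  have n: "norm R > 0" using eqs(1) by simp
  define t where "t = R \<bullet> \<xi>"
  define s where "s = \<xi> \<bullet> \<xi>"
  define c where "c = 3 / norm R ^ 5"
  define f where "f = 1 / norm R ^ 3 + 3 / (2 * norm R ^ 5) - 15 / (2 * norm R ^ 7) * (R \<bullet> (\<I> *v R))"
  have g: "grad_V aI R = f *\<^sub>R R + c *\<^sub>R (\<I> *v R)" by (simp add: grad_V_def f_def c_def)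
  \<comment> \<open>Expanding the double cross products brings both balance equations to the form in
    which only \<open>s\<close> and \<open>t = R \<bullet> \<xi>\<close> couple the
    components.\<close>
  have pc: "cross3 (cross3 \<xi> R) \<xi> = s *\<^sub>R R - t *\<^sub>R \<xi>"
    by (simp add: s_def t_def cross3_simps forall_3)
  have mc: "cross3 (\<I> *v \<xi> + cross3 R (cross3 \<xi> R)) \<xi> = cross3 (\<I> *v \<xi>) \<xi> - t *\<^sub>R cross3 R \<xi>"
    by (simp add: t_def cross3_simps forall_3)
  have comp: "(f *\<^sub>R R + c *\<^sub>R (\<I> *v R)) $ i = (s *\<^sub>R R - t *\<^sub>R \<xi>) $ i"
    "(cross3 (\<I> *v \<xi>) \<xi> - t *\<^sub>R cross3 R \<xi>) $ i = 0" for i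
    using eqs(2,3) unfolding g pc mc by simp_all
  have "c > 0" using n by (simp add: c_def)
  moreover have "t = R $ 1 * \<xi> $ 1 + R $ 2 * \<xi> $ 2 + R $ 3 * \<xi> $ 3"
    by (simp add: t_def inner_vec_def sum_3)
  moreover have "(f + c * I1) * R $ 1 = s * R $ 1 - \<xi> $ 1 * t" "(f + c * I2) * R $ 2 = s * R $ 2 - \<xi> $ 2 * t"
    "(f + c * I3) * R $ 3 = s * R $ 3 - \<xi> $ 3 * t"
    using comp(1)[of 1] comp(1)[of 2] comp(1)[of 3] by (simp_all add: diag_mult_vec algebra_simps)
  moreover have "\<xi> $ 1 * \<xi> $ 2 * (I1 - I2) = t * (R $ 1 * \<xi> $ 2 - R $ 2 * \<xi> $ 1)"
    "\<xi> $ 3 * \<xi> $ 1 * (I3 - I1) = t * (R $ 3 * \<xi> $ 1 - R $ 1 * \<xi> $ 3)"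
    using comp(2)[of 3] comp(2)[of 2] by (simp_all add: diag_mult_vec cross3_def algebra_simps)
  moreover have "\<xi> $ 2 * t < c * (I3 - I2) * R $ 2"
    using nb(3) n by (simp add: c_def t_def field_simps)
  ultimately have zero: "R $ 1 = 0" "R $ 3 = 0" "\<xi> $ 2 = 0" "\<xi> $ 3 = 0"
    using bifurcation_algebra[of t "R $ 1" "\<xi> $ 1" "R $ 2" "\<xi> $ 2" "R $ 3" "\<xi> $ 3" c f s] nb by blast+
  show R: "R = vector [0, R $ 2, 0]" "\<xi> = vector [\<xi> $ 1, 0, 0]"
    using zero by (simp_all add: vec_eq_iff forall_3)
  have nR: "norm R = R $ 2"
    using zero nb(1) by (simp add: norm_eq_sqrt_inner inner_vec_def sum_3)
  have "(f + c * I2) * R $ 2 = (\<xi> $ 1)\<^sup>2 * R $ 2"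
    using comp(1)[of 2] zero
    by (simp add: diag_mult_vec s_def t_def inner_vec_def sum_3 power2_eq_square algebra_simps)
  then have "f + c * I2 = (\<xi> $ 1)\<^sup>2" using nb(1) by simp
  moreover have "f + c * I2 = (2 * (R $ 2)^2 + 3 - 9 * I2) / (2 * (R $ 2)^5)"
    using nb(1) unfolding f_def c_def nR
    by (simp add: zero diag_mult_vec inner_vec_def sum_3 field_simps power_numeral_reduce)
  ultimately show "(\<xi> $ 1)\<^sup>2 = (2 * (R $ 2)^2 + 3 - 9 * I2) / (2 * (R $ 2)^5)" by simp
qed

end

section \<open>Linear instability below the critical radius\<close>

text \<open>Symmetry directions have no component in \<open>R\<close>, \<open>\<pi>\<close>,
  \<open>p\<close>; hence a vector with a nonzero such component survives in the symplectic
  slice.\<close>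

lemma infinitesimal_eq: "infinitesimal \<eta> (mat 1, x) = (hat \<eta>, 0)"
proof -
  have "((\<lambda>t. act (one_param \<eta> t) (mat 1, x)) has_vector_derivative (hat \<eta>, 0)) (at 0)"
    using mat_exp_hat_has_vector_derivative[of \<eta> 0]
    by (cases x) (auto simp: act_one_param hat_simps mat_exp_0 zero_prod_def intro!: has_vector_derivative_Pair)
  then show ?thesis unfolding infinitesimal_def by (rule vector_derivative_at)
qed

lemma rotation_in_isotropy:
  assumes "rotation_matrix M" "M *v \<mu> = \<mu>"
  shows "(M, mat 1) \<in> isotropy \<mu>"
proof -
  have "mat 1 = diag 1" by (simp add: diag_def mat_def cong: if_cong)
  then have "\<exists>s::real^3. (\<forall>i. s $ i = 1 \<or> s $ i = -1) \<and> mat 1 = diag s"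
    by (intro exI[of _ 1]) simp
  then show ?thesis using assms by (simp add: isotropy_def Gasym_def)
qed

lemma zero_in_isotropy_algebra: "0 \<in> isotropy_algebra \<mu>"
  by (simp add: isotropy_algebra_def one_param_def hat_simps mat_exp_0 rotation_in_isotropy
      rotation_matrix_mat_1)

lemma ker_dJ_I:
  assumes "cross3 w \<pi> + \<pi>' = 0"
  shows "(hat w, r, \<pi>', p') \<in> ker_dJ (mat 1, R, \<pi>, p)"
proof -
  have "(J has_derivative (\<lambda>Y. fst Y *v \<pi> + fst (snd (snd Y)))) (at (mat 1, R, \<pi>, p))"
    unfolding J_def case_prod_unfold by (auto intro!: derivative_eq_intros simp: fun_eq_iff add.commute)
  then have "frechet_derivative J (at (mat 1, R, \<pi>, p)) = (\<lambda>Y. fst Y *v \<pi> + fst (snd (snd Y)))"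
    by (rule frechet_derivative_at[symmetric])
  then show ?thesis
    using assms by (auto simp: ker_dJ_def tangent_space_def hat_mult_vec)
qed

text \<open>The hypothesis makes the left side smaller than \<open>S\<close> at 0, so the larger
  root is positive. It yields the square of an unstable eigenvalue, and later the square of the
  critical radius.\<close>

lemma quadratic_positive_root:
  fixes P Q S :: real
  assumes "P * Q < S"
  shows "\<exists>\<Lambda>>0. (\<Lambda> + P) * (\<Lambda> + Q) = S"
proof -
  define D where "D = (P + Q)\<^sup>2 - 4 * (P * Q - S)"
  have D: "\<bar>P + Q\<bar> < sqrt D"
    using assms by (intro real_less_rsqrt) (simp add: D_def)
  then have D0: "D \<ge> 0" by (smt (verit) real_sqrt_lt_0_iff)
  let ?\<Lambda> = "(sqrt D - (P + Q)) / 2"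
  have "(?\<Lambda> + P) * (?\<Lambda> + Q) = ((sqrt D)\<^sup>2 - (P - Q)\<^sup>2) / 4"
    by (simp add: field_simps power2_eq_square)
  also have "\<dots> = S" using D0 by (simp add: D_def field_simps power2_eq_square)
  finally show ?thesis using D by (intro exI[of _ ?\<Lambda>]) auto
qed

context satellite
begin

text \<open>The explicit ambient formula is differentiated and the result restricted to
  \<open>phase_space\<close>, where it coincides with \<open>ham_vf\<close>. As the body velocity at
  the point is \<open>\<xi>\<close>, the two products \<open>B' ** hat \<xi>\<close> from the
  product rule cancel.\<close>

lemma ham_vf_H2_J_has_derivative:
  assumes R: "R \<noteq> 0" and G: "(grad_V a has_derivative G) (at R)" and \<xi>: "\<xi> = Om R \<pi> p"
  defines "Om' \<equiv> \<lambda>(B', r, \<pi>', p'). inertia_inv a *v (\<pi>' - (cross3 R p' + cross3 r p))"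
  shows "(ham_vf (\<lambda>y. H2 \<I> y - J y \<bullet> \<xi>) has_derivative (\<lambda>(B', r, \<pi>', p').
      let \<omega> = Om' (B', r, \<pi>', p') in (hat \<omega> + B' ** hat \<xi> - (hat (transpose B' *v \<xi>) + B' ** hat \<xi>),
       p' - (cross3 \<xi> r + cross3 \<omega> R), cross3 \<pi> \<omega> + cross3 \<pi>' \<xi>, cross3 p \<omega> + cross3 p' \<xi> - G r)))
    (at (mat 1, R, \<pi>, p) within phase_space)"
proof -
  let ?z = "(mat 1, R, \<pi>, p) :: phase"
  let ?R = "\<lambda>z::phase. fst (snd z)" and ?\<pi> = "\<lambda>z::phase. fst (snd (snd z))"
    and ?p = "\<lambda>z::phase. snd (snd (snd z))"
  let ?Om = "\<lambda>z::phase. inertia_inv a *v (?\<pi> z - cross3 (?R z) (?p z))"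
  let ?Om' = "\<lambda>z::phase. inertia_inv a *v (?\<pi> z - (cross3 R (?p z) + cross3 (?R z) p))"
  have Om: "(?Om has_derivative ?Om') (at ?z)"
    by (auto intro!: derivative_eq_intros simp: fun_eq_iff)
  have Om0: "?Om ?z = \<xi>" by (simp add: \<xi> body_vel_def)
  have "((\<lambda>z. (fst z ** hat (?Om z) - fst z ** hat (transpose (fst z) *v \<xi>), ?p z - cross3 (?Om z) (?R z),
       cross3 (?\<pi> z) (?Om z), cross3 (?p z) (?Om z) - grad_V a (?R z))) has_derivative
     (\<lambda>z. (fst ?z ** hat (?Om' z) + fst z ** hat (?Om ?z)
          - (fst ?z ** hat (transpose (fst ?z) *v 0 + transpose (fst z) *v \<xi>)
             + fst z ** hat (transpose (fst ?z) *v \<xi>)),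
        ?p z - (cross3 (?Om ?z) (?R z) + cross3 (?Om' z) (?R ?z)),
        cross3 (?\<pi> ?z) (?Om' z) + cross3 (?\<pi> z) (?Om ?z),
        cross3 (?p ?z) (?Om' z) + cross3 (?p z) (?Om ?z) - G (?R z)))) (at ?z)"
  proof -
    have GR: "((\<lambda>z. grad_V a (?R z)) has_derivative (\<lambda>z. G (?R z))) (at ?z)"
      using G by (intro has_derivative_compose[where f="\<lambda>z. ?R z" and g="grad_V a", simplified])
        (auto intro!: derivative_eq_intros)
    show ?thesis
      by (intro has_derivative_Pair has_derivative_diff has_derivative_matrix_mult has_derivative_cross3
          has_derivative_hat has_derivative_matrix_vector_mult has_derivative_transpose has_derivative_fst
          has_derivative_snd has_derivative_ident has_derivative_const Om GR)
  qed
  then have "((\<lambda>z. (fst z ** hat (?Om z) - fst z ** hat (transpose (fst z) *v \<xi>), ?p z - cross3 (?Om z) (?R z),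
       cross3 (?\<pi> z) (?Om z), cross3 (?p z) (?Om z) - grad_V a (?R z))) has_derivative
     (\<lambda>(B', r, \<pi>', p').
      let \<omega> = Om' (B', r, \<pi>', p') in (hat \<omega> + B' ** hat \<xi> - (hat (transpose B' *v \<xi>) + B' ** hat \<xi>),
       p' - (cross3 \<xi> r + cross3 \<omega> R), cross3 \<pi> \<omega> + cross3 \<pi>' \<xi>, cross3 p \<omega> + cross3 p' \<xi> - G r)))
     (at ?z within phase_space)"
  proof (rule has_derivative_eq_rhs[OF has_derivative_at_withinI], intro ext)
    fix x :: phase
    show "(fst ?z ** hat (?Om' x) + fst x ** hat (?Om ?z)
          - (fst ?z ** hat (transpose (fst ?z) *v 0 + transpose (fst x) *v \<xi>)
             + fst x ** hat (transpose (fst ?z) *v \<xi>)),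
        ?p x - (cross3 (?Om ?z) (?R x) + cross3 (?Om' x) (?R ?z)),
        cross3 (?\<pi> ?z) (?Om' x) + cross3 (?\<pi> x) (?Om ?z),
        cross3 (?p ?z) (?Om' x) + cross3 (?p x) (?Om ?z) - G (?R x))
      = (case x of (B', r, \<pi>', p') \<Rightarrow>
      let \<omega> = Om' (B', r, \<pi>', p') in (hat \<omega> + B' ** hat \<xi> - (hat (transpose B' *v \<xi>) + B' ** hat \<xi>),
       p' - (cross3 \<xi> r + cross3 \<omega> R), cross3 \<pi> \<omega> + cross3 \<pi>' \<xi>, cross3 p \<omega> + cross3 p' \<xi> - G r))"
      unfolding Om0 by (cases x) (simp add: Om'_def Let_def transpose_mat del: transpose_matrix_vector)
  qed
  then show ?thesis
  proof (rule has_derivative_transform[rotated 2])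
    show "?z \<in> phase_space" using R by (simp add: phase_space_def rotation_matrix_mat_1)
    show "ham_vf (\<lambda>y. H2 \<I> y - J y \<bullet> \<xi>) z
      = (fst z ** hat (?Om z) - fst z ** hat (transpose (fst z) *v \<xi>), ?p z - cross3 (?Om z) (?R z),
       cross3 (?\<pi> z) (?Om z), cross3 (?p z) (?Om z) - grad_V a (?R z))" if "z \<in> phase_space" for z
      unfolding ham_vf_H2_J[OF that] by (cases z) (simp add: sat_vf_def body_vel_def del: transpose_matrix_vector)
  qed
qed

end

context lagrange
begin

lemma family_linearly_unstable:
  assumes r: "r > 0" and k: "k > 0" and k2: "k\<^sup>2 = (2 * r^2 + 3 - 9 * I2) / (2 * r^5)"
    and neg: "2 * r^4 + (9 * I2 - 6 * I1 - 3) * r^2 - 15 * I1 + 45 * I1 * I2 < 0"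
  shows "linearly_unstable \<I> (pair_point \<I> (vector [0, r, 0]) (vector [k, 0, 0])) (vector [k, 0, 0])"
proof -
  let ?R = "vector [0, r, 0] :: real^3" and ?k = "vector [k, 0, 0] :: real^3"
  let ?\<pi> = "vector [(I1 + r\<^sup>2) * k, 0, 0] :: real^3" and ?p = "vector [0, 0, k * r] :: real^3"
  define \<kappa> where "\<kappa> = 1 - 3 * I2"
  \<comment> \<open>The Hessian of the potential acts on the planar perturbations as the diagonal
    matrix with entries \<open>P - 3 * k\<^sup>2\<close> and \<open>k\<^sup>2 + \<sigma>\<close>
    (see \<open>G_val\<close>). Eliminating all other variables, the square \<open>\<Lambda>\<close>
    of a planar eigenvalue solves
    \<open>(\<Lambda> + P) * (\<Lambda> + Q) = 4 * k\<^sup>2 * \<sigma>\<close>.\<close>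
  define P where "P = 3 * k\<^sup>2 - 2 / r^3 - 6 * \<kappa> / r^5"
  define \<sigma> where "\<sigma> = 3 * (I3 - I2) / r^5"
  define Q where "Q = \<sigma> * (1 + r\<^sup>2 / I1)"
  have I1: "I1 > 0" using I_pos I_order by simp
  have \<sigma>: "\<sigma> > 0" using r I_order by (simp add: \<sigma>_def)
  \<comment> \<open>Up to positive factors, the constant term
    \<open>P * Q - 4 * k\<^sup>2 * \<sigma>\<close> of that quadratic is the polynomial defining the
    critical radius.\<close>
  have "(P * (I1 + r\<^sup>2) - 4 * k\<^sup>2 * I1) * (2 * r^5)
      = 2 * r^4 + (9 * I2 - 6 * I1 - 3) * r^2 - 15 * I1 + 45 * I1 * I2"
    unfolding P_def k2 \<kappa>_def using r by (simp add: field_simps power_numeral_reduce)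
  with neg have "(P * (I1 + r\<^sup>2) - 4 * k\<^sup>2 * I1) * (2 * r^5) < 0" by simp
  then have "P * (I1 + r\<^sup>2) - 4 * k\<^sup>2 * I1 < 0" using r by (simp add: mult_less_0_iff)
  then have "P * (1 + r\<^sup>2 / I1) < 4 * k\<^sup>2" using I1 by (simp add: field_simps)
  then have "P * Q < 4 * k\<^sup>2 * \<sigma>" using \<sigma> by (simp add: Q_def)
  then obtain \<Lambda> where \<Lambda>: "\<Lambda> > 0" "(\<Lambda> + P) * (\<Lambda> + Q) = 4 * k\<^sup>2 * \<sigma>"
    using quadratic_positive_root by blast
  define l where "l = sqrt \<Lambda>"
  have l: "l > 0" "l\<^sup>2 = \<Lambda>" using \<Lambda> by (simp_all add: l_def)
  have Q: "Q > 0" using \<sigma> I1 by (simp add: Q_def add_pos_nonneg)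
  \<comment> \<open>In the variables \<open>y\<close>, \<open>z\<close> (perturbation of \<open>R\<close>) and \<open>n = u3 + k y\<close> the planar eigenvalue
    equations become \<open>l\<^sup>2 y = 2 k n - P y\<close>, \<open>l z = (1 + r\<^sup>2 / I1) n - 2 k y\<close>, \<open>l n = - \<sigma> z\<close>; the vector
    below is the solution normalised by \<open>n = 2 k \<sigma>\<close>.\<close>
  define y where "y = \<Lambda> + Q"
  define n where "n = 2 * k * \<sigma>"
  define z where "z = - 2 * k * l"
  define u2 where "u2 = l * y - k * z"
  define u3 where "u3 = n - k * y"
  define \<omega> where "\<omega> = - (r / I1) * n"
  have eq1: "l * z = (1 + r\<^sup>2 / I1) * n - 2 * k * y"
    unfolding z_def n_def y_def Q_def l(2)[symmetric] by (simp add: power2_eq_square algebra_simps)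
  have eq2: "l * n = - \<sigma> * z" by (simp add: n_def z_def)
  have eq3: "l * u2 = k * u3 + k * r * \<omega> - (P - 3 * k\<^sup>2) * y"
  proof -
    have "(\<Lambda> + P) * y = 2 * k * n" using \<Lambda>(2) by (simp add: y_def n_def power2_eq_square)
    moreover have "l * u2 = \<Lambda> * y - k * (l * z)"
      by (simp add: u2_def power2_eq_square algebra_simps flip: l(2))
    ultimately show ?thesis
      unfolding eq1 u3_def \<omega>_def by (simp add: power2_eq_square algebra_simps)
  qed
  have nR: "norm ?R = r"
    using r by (simp add: norm_eq_sqrt_inner inner_vec_def sum_3)
  then have R0: "?R \<noteq> 0" using r by auto
  obtain G where G: "(grad_V aI has_derivative G) (at ?R)"
    and G_val: "G (vector [0, y, z]) = vector [0, (P - 3 * k\<^sup>2) * y, (k\<^sup>2 + \<sigma>) * z]"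
  proof (rule that[OF grad_V_has_derivative[OF R0]])
    have q: "?R \<bullet> (\<I> *v ?R) = I2 * r\<^sup>2" "vector [0, y, z] \<bullet> ?R = y * r"
      "vector [0, y, z] \<bullet> (\<I> *v ?R) = I2 * r * y"
      by (simp_all add: inner_vec_def sum_3 diag_mult_vec power2_eq_square)
    have 2: "(1 / r ^ 3 + 3 / (2 * r ^ 5) - 15 / (2 * r ^ 7) * (I2 * r\<^sup>2)) * y
      - ((3 / r ^ 5 + 15 / (2 * r ^ 7) - 105 / (2 * r ^ 9) * (I2 * r\<^sup>2)) * (y * r)
          + 15 / r ^ 7 * (I2 * r * y)) * r
      + 3 / r ^ 5 * (I2 * y) - 15 * (y * r) / r ^ 7 * (I2 * r) = (P - 3 * k\<^sup>2) * y"
      unfolding P_def \<kappa>_def using r by (simp add: field_simps power_numeral_reduce)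
    have 3: "(1 / r ^ 3 + 3 / (2 * r ^ 5) - 15 / (2 * r ^ 7) * (I2 * r\<^sup>2)) * z + 3 / r ^ 5 * (I3 * z)
        = (k\<^sup>2 + \<sigma>) * z"
      unfolding k2 \<sigma>_def using r by (simp add: field_simps power_numeral_reduce)
    show "(1 / norm ?R ^ 3 + 3 / (2 * norm ?R ^ 5) - 15 / (2 * norm ?R ^ 7) * (?R \<bullet> (\<I> *v ?R))) *\<^sub>R vector [0, y, z]
      - ((3 / norm ?R ^ 5 + 15 / (2 * norm ?R ^ 7) - 105 / (2 * norm ?R ^ 9) * (?R \<bullet> (\<I> *v ?R))) * (vector [0, y, z] \<bullet> ?R)
          + 15 / norm ?R ^ 7 * (vector [0, y, z] \<bullet> (\<I> *v ?R))) *\<^sub>R ?R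
      + (3 / norm ?R ^ 5) *\<^sub>R (\<I> *v vector [0, y, z]) - (15 * (vector [0, y, z] \<bullet> ?R) / norm ?R ^ 7) *\<^sub>R (\<I> *v ?R)
      = vector [0, (P - 3 * k\<^sup>2) * y, (k\<^sup>2 + \<sigma>) * z]"
      unfolding nR q using 2 3 by (simp add: vec_eq_iff forall_3 diag_mult_vec)
  qed
  note z = pair_point_family[of r k]
  have Om: "?k = Om ?R ?\<pi> ?p"
    using body_vel_legendre[of ?R ?k 0] z by (simp add: pair_point_def prod_eq_iff)
  note D = ham_vf_H2_J_has_derivative[OF R0 G Om]
  \<comment> \<open>The rotation part has to be \<open>1 / l\<close> times the perturbation
    \<open>\<omega>\<close> of the body velocity. It is parallel to both \<open>\<pi>\<close> and
    \<open>\<xi>\<close>: the former puts \<open>v\<close> into the kernel of the derivative of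
    \<open>J\<close>, the latter removes the term with \<open>transpose B'\<close> from
    \<open>L\<close>.\<close>
  define w where "w = (vector [\<omega> / l, 0, 0] :: real^3)"
  define v where "v = (hat w, vector [0, y, z] :: real^3, 0 :: real^3, vector [0, u2, u3] :: real^3)"
  let ?W = "ker_dJ (mat 1, ?R, ?\<pi>, ?p)"
  let ?N = "(\<lambda>\<eta>. infinitesimal \<eta> (mat 1, ?R, ?\<pi>, ?p)) ` isotropy_algebra (J (mat 1, ?R, ?\<pi>, ?p))"
  have zero_N: "0 \<in> ?N"
    by (rule image_eqI[OF _ zero_in_isotropy_algebra]) (simp add: infinitesimal_eq hat_simps zero_prod_def)
  have "v \<in> ?W"
    unfolding v_def by (rule ker_dJ_I) (simp add: w_def vec_eq_iff forall_3 cross3_def)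
  moreover have "0 \<in> ?W"
    using ker_dJ_I[of 0 ?\<pi> 0 0 0 ?R ?p] by (simp add: hat_simps zero_prod_def)
  moreover have "v \<notin> ?N"
  proof -
    have "y > 0" using \<Lambda> Q by (simp add: y_def)
    then have "vector [0, y, z] \<noteq> (0 :: real^3)" by (simp add: vec_eq_iff forall_3)
    then show ?thesis by (auto simp: infinitesimal_eq v_def zero_prod_def)
  qed
  moreover define L where "L = (\<lambda>(B', r, \<pi>', p').
      let \<omega> = (\<lambda>(B', r, \<pi>', p'). inertia_inv aI *v (\<pi>' - (cross3 ?R p' + cross3 r ?p))) (B', r, \<pi>', p')
      in (hat \<omega> + B' ** hat ?k - (hat (transpose B' *v ?k) + B' ** hat ?k),
       p' - (cross3 ?k r + cross3 \<omega> ?R), cross3 ?\<pi> \<omega> + cross3 \<pi>' ?k, cross3 ?p \<omega> + cross3 p' ?k - G r))"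
  note D = D[folded L_def]
  have "L v = l *\<^sub>R v"
  proof -
    have Om': "inertia_inv aI *v (0 - (cross3 ?R (vector [0, u2, u3]) + cross3 (vector [0, y, z]) ?p))
        = vector [\<omega>, 0, 0]"
      using I1 by (simp add: vec_eq_iff forall_3 cross3_def inertia_inv_def diag_mult_vec \<omega>_def u3_def field_simps)
    have w: "transpose (hat w) *v ?k = 0"
      by (simp add: transpose_hat hat_mult_vec w_def vec_eq_iff forall_3 cross3_def
          bounded_bilinear.minus_left[OF bounded_bilinear_matrix_vector_mult] del: transpose_matrix_vector)
    have lw: "hat (vector [\<omega>, 0, 0]) = l *\<^sub>R hat w"
    proof -
      have "vector [\<omega>, 0, 0] = l *\<^sub>R w" using l by (simp add: w_def vec_eq_iff forall_3)
      then show ?thesis by (simp only: hat_simps)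
    qed
    have "L v = (hat (vector [\<omega>, 0, 0]), vector [0, u2, u3] - (cross3 ?k (vector [0, y, z]) + cross3 (vector [\<omega>, 0, 0]) ?R),
       cross3 ?\<pi> (vector [\<omega>, 0, 0]), cross3 ?p (vector [\<omega>, 0, 0]) + cross3 (vector [0, u2, u3]) ?k
         - vector [0, (P - 3 * k\<^sup>2) * y, (k\<^sup>2 + \<sigma>) * z])"
      unfolding L_def v_def Let_def prod.case Om' w G_val by (simp add: hat_simps)
    also have "\<dots> = l *\<^sub>R v"
    proof -
      have "l * u3 = - \<sigma> * z - k * (u2 + k * z)" using eq2 by (simp add: u3_def u2_def algebra_simps)
      then have "cross3 ?p (vector [\<omega>, 0, 0]) + cross3 (vector [0, u2, u3]) ?k
         - vector [0, (P - 3 * k\<^sup>2) * y, (k\<^sup>2 + \<sigma>) * z] = l *\<^sub>R vector [0, u2, u3]"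
        using eq3 by (simp add: vec_eq_iff forall_3 cross3_def power2_eq_square algebra_simps)
      moreover have "vector [0, u2, u3] - (cross3 ?k (vector [0, y, z]) + cross3 (vector [\<omega>, 0, 0]) ?R)
          = l *\<^sub>R vector [0, y, z]"
        using eq1 by (simp add: vec_eq_iff forall_3 cross3_def u2_def u3_def \<omega>_def
            power2_eq_square algebra_simps)
      moreover have "cross3 ?\<pi> (vector [\<omega>, 0, 0]) = l *\<^sub>R 0"
        by (simp add: vec_eq_iff forall_3 cross3_def)
      ultimately show ?thesis by (simp only: v_def lw scaleR_Pair)
    qed
    finally show ?thesis .
  qed
  moreover have "L 0 = 0" using has_derivative_linear[OF D] by (rule linear_0)
  \<comment> \<open>The eigenvalue is real, so the imaginary part of the eigenvector is 0.\<close>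
  ultimately have "quotient_eigenvalue L ?W ?N (of_real l)"
    using zero_N unfolding quotient_eigenvalue_def by (intro bexI[of _ v] bexI[of _ 0] conjI) simp_all
  then show ?thesis
    unfolding linearly_unstable_def z using D l(1) by (intro exI[of _ L] conjI exI[of _ "of_real l"]) simp_all
qed

end

section \<open>Stability above the critical radius\<close>

definition bounded_lipschitz_on :: "'a::metric_space set \<Rightarrow> ('a \<Rightarrow> 'b::real_normed_vector) \<Rightarrow> bool" where
  "bounded_lipschitz_on C f \<longleftrightarrow> bounded (f ` C) \<and> (\<exists>L. L-lipschitz_on C f)"

lemma bounded_lipschitz_onI: "bounded (f ` C) \<Longrightarrow> L-lipschitz_on C f \<Longrightarrow> bounded_lipschitz_on C f"
  unfolding bounded_lipschitz_on_def by (rule conjI, assumption, rule exI)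

lemma bounded_lipschitz_onE:
  assumes "bounded_lipschitz_on C f"
  obtains L where "bounded (f ` C)" "L-lipschitz_on C f"
  using assms unfolding bounded_lipschitz_on_def by (elim conjE exE)

lemma bounded_lipschitz_on_const: "bounded_lipschitz_on C (\<lambda>x. c)"
  unfolding bounded_lipschitz_on_def
  by (auto intro!: exI[of _ 0] lipschitz_on_constant finite_imp_bounded finite_subset[of _ "{c}"])

text \<open>Boundedness of both factors is what makes products of Lipschitz maps Lipschitz, by
  splitting the difference as \<open>h (f x) (g x - g y) + h (f x - f y) (g y)\<close>. Hence the
  class combines both properties.\<close>

lemma bounded_lipschitz_on_bounded_bilinear:
  assumes h: "bounded_bilinear h" and f: "bounded_lipschitz_on C f" and g: "bounded_lipschitz_on C g"
  shows "bounded_lipschitz_on C (\<lambda>x. h (f x) (g x))"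
proof -
  interpret bounded_bilinear h by (rule h)
  obtain K where K: "K \<ge> 0" "\<And>a b. norm (h a b) \<le> norm a * norm b * K"
    using nonneg_bounded by blast
  obtain L M where L: "L-lipschitz_on C f" and M: "M-lipschitz_on C g"
    using f g by (auto simp: bounded_lipschitz_on_def)
  obtain F where F: "\<And>x. x \<in> C \<Longrightarrow> norm (f x) \<le> F" "F \<ge> 0"
    using f by (auto simp: bounded_lipschitz_on_def bounded_pos intro: less_imp_le)
  obtain G where G: "\<And>x. x \<in> C \<Longrightarrow> norm (g x) \<le> G" "G \<ge> 0"
    using g by (auto simp: bounded_lipschitz_on_def bounded_pos intro: less_imp_le)
  have LM: "L \<ge> 0" "M \<ge> 0" using L M by (auto intro: lipschitz_on_nonneg)
  have "norm (h (f x) (g x)) \<le> F * G * K" if "x \<in> C" for x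
  proof -
    have "norm (f x) * norm (g x) * K \<le> F * G * K"
      using that F G K by (intro mult_right_mono mult_mono) auto
    with K(2)[of "f x" "g x"] show ?thesis by simp
  qed
  then have "bounded ((\<lambda>x. h (f x) (g x)) ` C)" by (auto simp: bounded_iff)
  moreover have "((F * M + L * G) * K)-lipschitz_on C (\<lambda>x. h (f x) (g x))"
  proof (rule lipschitz_onI)
    fix x y assume xy: "x \<in> C" "y \<in> C"
    have "dist (h (f x) (g x)) (h (f y) (g y)) = norm (h (f x) (g x - g y) + h (f x - f y) (g y))"
      by (simp add: dist_norm diff_left diff_right)
    also have "\<dots> \<le> norm (f x) * norm (g x - g y) * K + norm (f x - f y) * norm (g y) * K"
      by (intro norm_triangle_mono K)
    also have "\<dots> \<le> F * (M * dist x y) * K + (L * dist x y) * G * K"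
    proof -
      have "norm (g x - g y) \<le> M * dist x y" "norm (f x - f y) \<le> L * dist x y"
        using lipschitz_onD[OF M xy] lipschitz_onD[OF L xy] by (simp_all add: dist_norm)
      then show ?thesis
        using F G K xy LM by (intro add_mono mult_right_mono mult_mono) simp_all
    qed
    finally show "dist (h (f x) (g x)) (h (f y) (g y)) \<le> (F * M + L * G) * K * dist x y"
      by (simp add: algebra_simps)
  qed (use F G K LM in simp)
  ultimately show ?thesis by (auto simp: bounded_lipschitz_on_def)
qed

lemma bounded_lipschitz_on_compose_linear:
  assumes h: "bounded_linear h" and f: "bounded_lipschitz_on C f"
  shows "bounded_lipschitz_on C (\<lambda>x. h (f x))"
proof -
  have "bounded_bilinear (\<lambda>a b. a *\<^sub>R h b)"
    using bounded_bilinear.comp[OF bounded_bilinear_scaleR bounded_linear_ident h] .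
  from bounded_lipschitz_on_bounded_bilinear[OF this bounded_lipschitz_on_const f, of 1]
  show ?thesis by simp
qed

lemma bounded_lipschitz_on_add:
  "bounded_lipschitz_on C f \<Longrightarrow> bounded_lipschitz_on C g \<Longrightarrow> bounded_lipschitz_on C (\<lambda>x. f x + g x)"
  by (elim bounded_lipschitz_onE, rule bounded_lipschitz_onI[OF bounded_plus_comp lipschitz_on_add]; assumption)

lemma bounded_lipschitz_on_diff:
  "bounded_lipschitz_on C f \<Longrightarrow> bounded_lipschitz_on C g \<Longrightarrow> bounded_lipschitz_on C (\<lambda>x. f x - g x)"
  by (elim bounded_lipschitz_onE, rule bounded_lipschitz_onI[OF bounded_minus_comp lipschitz_on_diff]; assumption)

lemma bounded_lipschitz_on_Pair:
  "bounded_lipschitz_on C f \<Longrightarrow> bounded_lipschitz_on C g \<Longrightarrow> bounded_lipschitz_on C (\<lambda>x. (f x, g x))"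
  by (elim bounded_lipschitz_onE,
      rule bounded_lipschitz_onI[OF bounded_subset[OF bounded_Times[of "f ` C" "g ` C"]] lipschitz_on_Pair])
    auto

lemma bounded_lipschitz_on_power:
  fixes f :: "'a::metric_space \<Rightarrow> real"
  shows "bounded_lipschitz_on C f \<Longrightarrow> bounded_lipschitz_on C (\<lambda>x. f x ^ n)"
  by (induction n) (auto intro: bounded_lipschitz_on_const bounded_lipschitz_on_bounded_bilinear[OF bounded_bilinear_mult])

lemma bounded_lipschitz_on_inverse_norm:
  assumes f: "bounded_lipschitz_on C f" and d: "d > 0" "\<And>x. x \<in> C \<Longrightarrow> d \<le> norm (f x)"
  shows "bounded_lipschitz_on C (\<lambda>x. 1 / norm (f x))"
proof -
  obtain L where L: "L-lipschitz_on C f" using f by (auto simp: bounded_lipschitz_on_def)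
  have "1 / norm (f x) \<le> 1 / d" if "x \<in> C" for x
    using d(1) d(2)[OF that] by (intro divide_left_mono mult_pos_pos) auto
  then have "bounded ((\<lambda>x. 1 / norm (f x)) ` C)" by (auto simp: bounded_iff)
  moreover have "(L / d\<^sup>2)-lipschitz_on C (\<lambda>x. 1 / norm (f x))"
  proof (rule lipschitz_onI)
    fix x y assume xy: "x \<in> C" "y \<in> C"
    have pos: "norm (f x) > 0" "norm (f y) > 0" using d xy by (meson less_le_trans)+
    have "dist (1 / norm (f x)) (1 / norm (f y)) = \<bar>norm (f y) - norm (f x)\<bar> / (norm (f x) * norm (f y))"
    proof -
      have "1 / norm (f x) - 1 / norm (f y) = (norm (f y) - norm (f x)) / (norm (f x) * norm (f y))"
        using pos by (simp add: field_simps)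
      then show ?thesis by (simp add: dist_real_def)
    qed
    also have "\<dots> \<le> dist (f x) (f y) / (d * d)"
    proof (rule frac_le)
      show "\<bar>norm (f y) - norm (f x)\<bar> \<le> dist (f x) (f y)"
        by (metis dist_commute dist_norm norm_triangle_ineq3)
      show "d * d \<le> norm (f x) * norm (f y)" using d xy by (intro mult_mono) (auto intro: less_imp_le)
    qed (use d in auto)
    also have "\<dots> \<le> L * dist x y / (d * d)"
      using lipschitz_onD[OF L xy] d by (intro divide_right_mono) auto
    finally show "dist (1 / norm (f x)) (1 / norm (f y)) \<le> L / d\<^sup>2 * dist x y"
      by (simp add: power2_eq_square)
  qed (use lipschitz_on_nonneg[OF L] in simp)
  ultimately show ?thesis by (auto simp: bounded_lipschitz_on_def)
qed

lemma bounded_lipschitz_on_ident: "bounded C \<Longrightarrow> bounded_lipschitz_on C (\<lambda>x. x)"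
  by (rule bounded_lipschitz_onI[OF _ lipschitz_on_id]) simp

text \<open>Apart from powers of \<open>1 / norm R\<close>, the vector field is composed of linear
  and bilinear operations; the distance \<open>d\<close> keeps away from the singularity at
  \<open>R = 0\<close>.\<close>

lemma sat_vf_lipschitz:
  assumes "bounded C" and d: "d > 0" "\<And>z. z \<in> C \<Longrightarrow> d \<le> norm (fst (snd z))"
  shows "\<exists>L. L-lipschitz_on C (sat_vf a)"
proof -
  let ?b = "bounded_lipschitz_on C"
  let ?R = "\<lambda>z::phase. fst (snd z)" and ?\<pi> = "\<lambda>z::phase. fst (snd (snd z))"
    and ?p = "\<lambda>z::phase. snd (snd (snd z))"
  note id = bounded_lipschitz_on_ident[OF assms(1)]
  note fst = bounded_lipschitz_on_compose_linear[OF bounded_linear_fst]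
  note snd = bounded_lipschitz_on_compose_linear[OF bounded_linear_snd]
  note cross = bounded_lipschitz_on_bounded_bilinear[OF bounded_bilinear_cross3]
  note mult = bounded_lipschitz_on_bounded_bilinear[OF bounded_bilinear_mult]
  note scaleR = bounded_lipschitz_on_bounded_bilinear[OF bounded_bilinear_scaleR]
  note inner = bounded_lipschitz_on_bounded_bilinear[OF bounded_bilinear_inner]
  note mat = bounded_lipschitz_on_bounded_bilinear[OF bounded_bilinear_matrix_mult]
  note hat = bounded_lipschitz_on_compose_linear[OF bounded_linear_hat]
  note matv = bounded_lipschitz_on_compose_linear[OF matrix_vector_mul_bounded_linear]
  note arith = bounded_lipschitz_on_add bounded_lipschitz_on_diff bounded_lipschitz_on_const
  have B: "?b fst" and R: "?b ?R" and \<pi>: "?b ?\<pi>" and p: "?b ?p"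
    by (intro fst snd id)+
  have inv: "?b (\<lambda>z. (1 / norm (?R z)) ^ k)" for k
    by (intro bounded_lipschitz_on_power bounded_lipschitz_on_inverse_norm[OF R d])
  have Om: "?b (\<lambda>z. body_vel a (?R z) (?\<pi> z) (?p z))"
    unfolding body_vel_def by (intro matv arith cross R \<pi> p)
  have "grad_V a R = ((1 / norm R) ^ 3 + 3 / 2 * (1 / norm R) ^ 5
      - 15 / 2 * (1 / norm R) ^ 7 * (R \<bullet> (diag a *v R))) *\<^sub>R R + (3 * (1 / norm R) ^ 5) *\<^sub>R (diag a *v R)" for R
    by (simp add: grad_V_def power_divide)
  then have G: "?b (\<lambda>z. grad_V a (?R z))"
    by (simp only:) (intro arith scaleR mult inner matv R inv)
  have "?b (\<lambda>z. (fst z ** hat (body_vel a (?R z) (?\<pi> z) (?p z)), ?p z - cross3 (body_vel a (?R z) (?\<pi> z) (?p z)) (?R z),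
     cross3 (?\<pi> z) (body_vel a (?R z) (?\<pi> z) (?p z)), cross3 (?p z) (body_vel a (?R z) (?\<pi> z) (?p z)) - grad_V a (?R z)))"
    by (intro bounded_lipschitz_on_Pair arith mat hat cross B R \<pi> p Om G)
  then show ?thesis
    by (simp add: bounded_lipschitz_on_def sat_vf_def case_prod_unfold)
qed

text \<open>The norm on matrices is the Frobenius norm, whose square is the trace of
  \<open>B ** transpose B\<close>. In dimension 3 it gives the value sqrt 3, below the radii 2 and 3
  used later.\<close>

lemma norm_orthogonal_matrix:
  fixes B :: "real^'n^'n"
  assumes "B ** transpose B = mat 1"
  shows "(norm B)\<^sup>2 = of_nat CARD('n)"
proof -
  have "(norm B)\<^sup>2 = (\<Sum>i\<in>UNIV. (B ** transpose B) $ i $ i)"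
    by (simp add: power2_norm_eq_inner inner_vec_def matrix_matrix_mult_def transpose_def)
  also have "\<dots> = of_nat CARD('n)" by (simp add: assms mat_def)
  finally show ?thesis .
qed

lemma compact_rotation_matrices: "compact {B :: real^3^3. rotation_matrix B}"
proof -
  have "closed {B :: real^3^3. transpose B ** B = mat 1 \<and> B ** transpose B = mat 1 \<and> det B = 1}"
    unfolding det_3 by (intro closed_Collect_conj closed_Collect_eq continuous_intros)
  moreover have "norm B \<le> 2" if "B ** transpose B = mat 1" for B :: "real^3^3"
    by (rule power2_le_imp_le) (simp_all add: norm_orthogonal_matrix[OF that])
  ultimately show ?thesis
    unfolding compact_eq_bounded_closed rotation_matrix_def orthogonal_matrix_def
    by (auto simp: bounded_iff)
qed

lemma positive_continuous_on_compact_bound: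
  fixes f :: "'a::topological_space \<Rightarrow> real"
  assumes "compact S" "continuous_on S f" "\<And>x. x \<in> S \<Longrightarrow> f x > 0"
  shows "\<exists>m>0. \<forall>x\<in>S. m \<le> f x"
proof (cases "S = {}")
  case False
  then obtain x where "x \<in> S" "\<forall>y\<in>S. f x \<le> f y"
    using continuous_attains_inf[OF assms(1) _ assms(2)] by blast
  then show ?thesis using assms(3) by blast
qed (auto intro: exI[of _ 1])

section \<open>Conserved quantities and the stability criterion\<close>

context satellite
begin

text \<open>The first entry keeps the flow orthogonal although it is solved in the ambient vector
  space; the next two form a joint level in the reduced variables alone; the last is the spatial
  momentum \<open>J\<close>.\<close>

definition conserved :: "phase \<Rightarrow> (real^3^3) \<times> real \<times> real \<times> (real^3)" where
  "conserved = (\<lambda>(B, R, \<pi>, p). (B ** transpose B, reduced_H a R \<pi> p, \<pi> \<bullet> \<pi>, B *v \<pi>))"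

definition conserved_deriv :: "phase \<Rightarrow> phase \<Rightarrow> (real^3^3) \<times> real \<times> real \<times> (real^3)" where
  "conserved_deriv = (\<lambda>(B, R, \<pi>, p) (B', r, \<pi>', p'). (B ** transpose B' + B' ** transpose B,
     Om R \<pi> p \<bullet> \<pi>' + (grad_V a R - cross3 p (Om R \<pi> p)) \<bullet> r + (p - cross3 (Om R \<pi> p) R) \<bullet> p',
     \<pi> \<bullet> \<pi>' + \<pi>' \<bullet> \<pi>, B *v \<pi>' + B' *v \<pi>))"

lemma conserved_has_derivative:
  assumes "fst (snd z) \<noteq> 0"
  shows "(conserved has_derivative conserved_deriv z) (at z)"
proof -
  obtain B R \<pi> p where z: "z = (B, R, \<pi>, p)" by (cases z)
  have R: "R \<noteq> 0" using assms by (simp add: z)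
  let ?\<pi> = "\<lambda>z::phase. fst (snd (snd z))"
  have eq: "conserved = (\<lambda>z. (fst z ** transpose (fst z), (\<lambda>(B, R, \<pi>, p). reduced_H a R \<pi> p) z,
      ?\<pi> z \<bullet> ?\<pi> z, fst z *v ?\<pi> z))"
    by (auto simp: conserved_def fun_eq_iff)
  have "(conserved has_derivative (\<lambda>y. (fst z ** transpose (fst y) + fst y ** transpose (fst z),
      (\<lambda>(B', r, \<pi>', p'). Om R \<pi> p \<bullet> \<pi>' + (grad_V a R - cross3 p (Om R \<pi> p)) \<bullet> r
        + (p - cross3 (Om R \<pi> p) R) \<bullet> p') y,
      ?\<pi> z \<bullet> ?\<pi> y + ?\<pi> y \<bullet> ?\<pi> z, fst z *v ?\<pi> y + fst y *v ?\<pi> z))) (at z)"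
    unfolding eq using reduced_H_has_derivative[OF R, of \<pi> p B, folded z]
    by (intro has_derivative_Pair has_derivative_matrix_mult has_derivative_transpose has_derivative_inner
        has_derivative_matrix_vector_mult has_derivative_fst has_derivative_snd has_derivative_ident)
  then show ?thesis
    by (rule has_derivative_eq_rhs) (auto simp: fun_eq_iff conserved_deriv_def z)
qed

text \<open>Conservation holds at every ambient point, also where \<open>B\<close> is not
  orthogonal, as is required on a trapping region that is a neighbourhood in the ambient
  space.\<close>

lemma conserved_deriv_sat_vf: "conserved_deriv z (sat_vf a z) = 0"
proof -
  obtain B R \<pi> p where z: "z = (B, R, \<pi>, p)" by (cases z)
  let ?\<Omega> = "Om R \<pi> p" and ?g = "grad_V a R"
  have 1: "B ** transpose (B ** hat ?\<Omega>) + (B ** hat ?\<Omega>) ** transpose B = 0"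
    by (simp add: matrix_transpose_mul transpose_hat matrix_mul_assoc matrix_minus_left matrix_minus_right)
  have 2: "?\<Omega> \<bullet> cross3 \<pi> ?\<Omega> + (?g - cross3 p ?\<Omega>) \<bullet> (p - cross3 ?\<Omega> R)
      + (p - cross3 ?\<Omega> R) \<bullet> (cross3 p ?\<Omega> - ?g) = 0"
    by (simp add: dot_cross_self inner_diff_left inner_diff_right inner_commute)
  have 3: "\<pi> \<bullet> cross3 \<pi> ?\<Omega> + cross3 \<pi> ?\<Omega> \<bullet> \<pi> = 0"
    by (simp add: dot_cross_self inner_commute)
  have 4: "B *v cross3 \<pi> ?\<Omega> + (B ** hat ?\<Omega>) *v \<pi> = 0"
    using cross_skew[of \<pi> ?\<Omega>]
    by (simp add: hat_mult_vec bounded_bilinear.minus_right[OF bounded_bilinear_matrix_vector_mult]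
        flip: matrix_vector_mul_assoc)
  show ?thesis
    unfolding z sat_vf_def conserved_deriv_def prod.case 1 2 3 4 by (simp add: zero_prod_def)
qed

lemma reduced_H_continuous_on:
  assumes "\<And>x. x \<in> S \<Longrightarrow> fst x \<noteq> 0"
  shows "continuous_on S (\<lambda>(R, \<pi>, p). reduced_H a R \<pi> p)"
proof -
  have "continuous (at x) (\<lambda>(R, \<pi>, p). reduced_H a R \<pi> p)" if "x \<in> S" for x
  proof -
    obtain R \<pi> p where x: "x = (R, \<pi>, p)" by (cases x)
    have "((\<lambda>x. (mat 1 :: real^3^3, x)) has_derivative (\<lambda>x. (0, x))) (at x)"
      by (intro has_derivative_Pair has_derivative_const has_derivative_ident)
    from diff_chain_at[OF this, of "\<lambda>(B, R, \<pi>, p). reduced_H a R \<pi> p"]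
      reduced_H_has_derivative[of R \<pi> p "mat 1"] assms[OF that]
    have "\<exists>D. ((\<lambda>(R, \<pi>, p). reduced_H a R \<pi> p) has_derivative D) (at x)"
      by (auto simp: x o_def)
    then show ?thesis using has_derivative_continuous by blast
  qed
  then show ?thesis by (intro continuous_at_imp_continuous_on) auto
qed

text \<open>By compactness of the rotation group: rotations that nearly fix \<open>\<pi>0\<close>
  accumulate only at rotations that fix it, and those carry the equilibrium to points of
  \<open>V\<close>.\<close>

lemma orbit_neighborhood:
  fixes V :: "phase set"
  assumes "open V" and R0: "R0 \<noteq> 0"
    and V: "\<And>M. rotation_matrix M \<Longrightarrow> M *v \<pi>0 = \<pi>0 \<Longrightarrow> (M, R0, \<pi>0, p0) \<in> V"
  shows "\<exists>\<eta>>0. \<forall>B x. rotation_matrix B \<and> dist x (R0, \<pi>0, p0) \<le> \<eta> \<and> norm (B *v \<pi>0 - \<pi>0) \<le> \<eta> \<longrightarrow> (B, x) \<in> V"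
proof (rule ccontr)
  let ?P = "\<lambda>\<eta> B x. rotation_matrix B \<and> dist x (R0, \<pi>0, p0) \<le> \<eta> \<and> norm (B *v \<pi>0 - \<pi>0) \<le> \<eta> \<and> (B, x) \<notin> V"
  assume "\<not> ?thesis"
  then have "\<exists>B x. ?P (1 / real (Suc n)) B x" for n
    by (metis of_nat_0_less_iff zero_less_Suc zero_less_divide_1_iff)
  then obtain B x where Bx: "\<And>n. ?P (1 / real (Suc n)) (B n) (x n)" by metis
  have "seq_compact {B :: real^3^3. rotation_matrix B}"
    using compact_rotation_matrices by (simp add: compact_eq_seq_compact_metric)
  from this[unfolded seq_compact_def, rule_format, of B]
  obtain M and \<phi> :: "nat \<Rightarrow> nat" where M: "rotation_matrix M" and \<phi>: "strict_mono \<phi>"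
    and lim: "(B \<circ> \<phi>) \<longlonglongrightarrow> M"
    using Bx by auto
  have z: "(\<lambda>n. 1 / real (Suc (\<phi> n))) \<longlonglongrightarrow> 0"
    using LIMSEQ_subseq_LIMSEQ[OF LIMSEQ_Suc[OF lim_1_over_n] \<phi>] by (simp add: o_def)
  have "(\<lambda>n. dist (x (\<phi> n)) (R0, \<pi>0, p0)) \<longlonglongrightarrow> 0"
    by (rule tendsto_sandwich[OF _ _ tendsto_const z]) (use Bx in auto)
  then have x: "(\<lambda>n. x (\<phi> n)) \<longlonglongrightarrow> (R0, \<pi>0, p0)" by (rule tendsto_dist_iff[THEN iffD2])
  have "(\<lambda>n. norm (B (\<phi> n) *v \<pi>0 - \<pi>0)) \<longlonglongrightarrow> 0"
    by (rule tendsto_sandwich[OF _ _ tendsto_const z]) (use Bx in auto)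
  moreover have "(\<lambda>n. norm (B (\<phi> n) *v \<pi>0 - \<pi>0)) \<longlonglongrightarrow> norm (M *v \<pi>0 - \<pi>0)"
    using lim by (intro tendsto_intros bounded_bilinear.tendsto[OF bounded_bilinear_matrix_vector_mult])
      (simp_all add: o_def)
  ultimately have "norm (M *v \<pi>0 - \<pi>0) = 0" by (rule LIMSEQ_unique[rotated])
  then have "(M, R0, \<pi>0, p0) \<in> V" using V M by simp
  moreover have "(\<lambda>n. (B (\<phi> n), x (\<phi> n))) \<longlonglongrightarrow> (M, R0, \<pi>0, p0)"
    using lim x by (intro tendsto_Pair) (simp_all add: o_def)
  ultimately have "\<forall>\<^sub>F n in sequentially. (B (\<phi> n), x (\<phi> n)) \<in> V"
    using \<open>open V\<close> by (simp add: tendsto_def)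
  then show False using Bx by (auto simp: eventually_sequentially)
qed

text \<open>Energy-momentum criterion: it suffices that the equilibrium is locally the only reduced
  point with the same momentum norm and no larger energy. No definiteness of a Hessian is
  required.\<close>

lemma G_mu_stableI:
  assumes R0: "R0 \<noteq> 0" and \<epsilon>: "\<epsilon> > 0"
    and strict: "\<And>R \<pi> p. dist (R, \<pi>, p) (R0, \<pi>0, p0) < \<epsilon> \<Longrightarrow> \<pi> \<bullet> \<pi> = \<pi>0 \<bullet> \<pi>0 \<Longrightarrow>
      reduced_H a R \<pi> p \<le> reduced_H a R0 \<pi>0 p0 \<Longrightarrow> (R, \<pi>, p) = (R0, \<pi>0, p0)"
  shows "G_mu_stable \<I> (mat 1, R0, \<pi>0, p0)"
  unfolding G_mu_stable_def Let_def
proof (intro allI impI, elim conjE)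
  let ?z0 = "(mat 1, R0, \<pi>0, p0) :: phase" and ?x0 = "(R0, \<pi>0, p0)"
  fix U assume "nbhd_of ((\<lambda>g. act g ?z0) ` isotropy (J ?z0)) U"
  then obtain V where orb: "(\<lambda>g. act g ?z0) ` isotropy \<pi>0 \<subseteq> phase_space \<inter> V" and V: "open V"
    and VU: "phase_space \<inter> V \<subseteq> U"
    unfolding nbhd_of_def openin_open J_def by auto
  have "(M, R0, \<pi>0, p0) \<in> V" if M: "rotation_matrix M" "M *v \<pi>0 = \<pi>0" for M
  proof -
    have "(M, mat 1) \<in> isotropy \<pi>0" using M by (rule rotation_in_isotropy)
    moreover have "act (M, mat 1) ?z0 = (M, R0, \<pi>0, p0)" by (simp add: act_def transpose_mat)
    ultimately show ?thesis using orb by (metis (no_types, lifting) IntD2 imageI subsetD)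
  qed
  from orbit_neighborhood[OF V R0 this] obtain \<eta> where \<eta>: "\<eta> > 0" and
    near: "\<And>B x. rotation_matrix B \<Longrightarrow> dist x ?x0 \<le> \<eta> \<Longrightarrow> norm (B *v \<pi>0 - \<pi>0) \<le> \<eta> \<Longrightarrow> (B, x) \<in> V"
    by blast
  \<comment> \<open>The three bounds serve, in this order, closeness to the orbit, applicability of
    \<open>strict\<close> on the sphere of radius \<open>e\<close>, and distance from
    \<open>R = 0\<close>.\<close>
  define e where "e = min (\<eta> / 2) (min (\<epsilon> / 2) (norm R0 / 2))"
  have e: "e > 0" "e \<le> \<eta> / 2" "e < \<epsilon>" "e < norm R0"
    using \<eta> \<epsilon> R0 by (auto simp: e_def min_def)
  have away: "norm R0 - e \<le> norm R" if "(R, \<pi>, p) \<in> cball ?x0 e" for R \<pi> p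
  proof -
    have "dist R0 R \<le> e" using that dist_fst_le[of ?x0 "(R, \<pi>, p)"] by simp
    then show ?thesis using norm_triangle_ineq2[of R0 R] by (simp add: dist_norm)
  qed
  \<comment> \<open>A conserved quantity that is zero at the equilibrium only.\<close>
  define \<Lambda> where "\<Lambda> x = max ((\<lambda>(R, \<pi>, p). reduced_H a R \<pi> p) x - reduced_H a R0 \<pi>0 p0) 0
      + \<bar>fst (snd x) \<bullet> fst (snd x) - \<pi>0 \<bullet> \<pi>0\<bar>" for x
  have cont\<Lambda>: "continuous_on (cball ?x0 e) \<Lambda>"
  proof -
    have "fst x \<noteq> 0" if "x \<in> cball ?x0 e" for x
      using away[of "fst x" "fst (snd x)" "snd (snd x)"] that e by auto
    then show ?thesis
      unfolding \<Lambda>_def by (intro continuous_intros reduced_H_continuous_on) auto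
  qed
  have "\<exists>m>0. \<forall>x\<in>sphere ?x0 e. m \<le> \<Lambda> x"
  proof (rule positive_continuous_on_compact_bound)
    show "continuous_on (sphere ?x0 e) \<Lambda>" by (rule continuous_on_subset[OF cont\<Lambda>]) auto
    fix x assume x: "x \<in> sphere ?x0 e"
    obtain R \<pi> p where xe: "x = (R, \<pi>, p)" by (cases x)
    have "x \<noteq> ?x0" "dist x ?x0 < \<epsilon>" using x e by (auto simp: dist_commute)
    then have "\<not> (\<pi> \<bullet> \<pi> = \<pi>0 \<bullet> \<pi>0 \<and> reduced_H a R \<pi> p \<le> reduced_H a R0 \<pi>0 p0)"
      using strict[of R \<pi> p] xe by blast
    then show "\<Lambda> x > 0" by (auto simp: \<Lambda>_def xe)
  qed (rule compact_sphere)
  then obtain m where m: "m > 0" "\<And>x. x \<in> sphere ?x0 e \<Longrightarrow> m \<le> \<Lambda> x" by blast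
  \<comment> \<open>Below the minimum \<open>m\<close> of \<open>\<Lambda>\<close> on the sphere a
    trajectory cannot cross that sphere; the condition on \<open>B *v \<pi>\<close> fixes the
    spatial momentum up to \<open>\<eta> / 2\<close>.\<close>
  define W where "W = (UNIV \<times> ball ?x0 e) \<inter> (\<lambda>z. (\<Lambda> (snd z), fst z *v fst (snd (snd z)))) -` ({..<m} \<times> ball \<pi>0 (\<eta> / 2))"
  \<comment> \<open>The ball of radius 3 has all orthogonal matrices in its interior, so
    \<open>C\<close> is a compact convex region whose boundary can be reached only through the
    sphere around the reduced equilibrium.\<close>
  define C where "C = (cball 0 3 :: (real^3^3) set) \<times> cball ?x0 e"
  have "open W"
    unfolding W_def
  proof (rule continuous_open_preimage)
    show "continuous_on (UNIV \<times> ball ?x0 e) (\<lambda>z. (\<Lambda> (snd z), fst z *v fst (snd (snd z))))"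
      by (intro continuous_intros continuous_on_compose2[OF cont\<Lambda>]) auto
  qed (auto intro: open_Times)
  have z0W: "?z0 \<in> W" using e m \<eta> by (simp add: W_def \<Lambda>_def)
  have z0P: "?z0 \<in> phase_space" using R0 by (simp add: phase_space_def rotation_matrix_mat_1)
  show "\<exists>N. nbhd_of {?z0} N \<and>
     (\<forall>y\<in>N. (\<exists>\<gamma>. integral_curve (ham_vf (H2 \<I>)) \<gamma> \<and> \<gamma> 0 = y) \<and>
       (\<forall>\<gamma>. integral_curve (ham_vf (H2 \<I>)) \<gamma> \<and> \<gamma> 0 = y \<longrightarrow> (\<forall>t. \<gamma> t \<in> U)))"
  proof (intro exI[of _ "phase_space \<inter> W"] conjI ballI)
    show "nbhd_of {?z0} (phase_space \<inter> W)"
      unfolding nbhd_of_def openin_open using \<open>open W\<close> z0W z0P by blast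
  next
    fix y assume y: "y \<in> phase_space \<inter> W"
    obtain By Ry \<pi>y py where ye: "y = (By, Ry, \<pi>y, py)" by (cases y)
    have By: "By ** transpose By = mat 1"
      using y by (simp add: ye phase_space_def rotation_matrix_def orthogonal_matrix_def)
    have norm_lt: "norm B < 3" if "B ** transpose B = mat 1" for B :: "real^3^3"
      by (rule power2_less_imp_less) (simp_all add: norm_orthogonal_matrix[OF that])
    have yC: "y \<in> C"
      using y norm_lt[OF By] by (auto simp: C_def W_def ye)
    have C: "compact C" "convex C" "closed C"
      unfolding C_def by (auto intro: compact_Times convex_Times closed_Times)
    have away: "norm R0 - e \<le> norm (fst (snd z))" if "z \<in> C" for z
      using that away[of "fst (snd z)" "fst (snd (snd z))" "snd (snd (snd z))"] by (auto simp: C_def)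
    have R: "fst (snd z) \<noteq> 0" if "z \<in> C" for z
      using away[OF that] e by auto
    have P: "(conserved has_derivative conserved_deriv z) (at z)" if "z \<in> C" for z
      by (rule conserved_has_derivative[OF R[OF that]])
    have intC: "interior C = ball 0 3 \<times> ball ?x0 e"
      by (simp add: C_def interior_Times)
    have trap: "z \<in> interior C" if z: "z \<in> C" "conserved z = conserved y" for z
    proof -
      obtain B Rz \<pi> p where ze: "z = (B, Rz, \<pi>, p)" by (cases z)
      have eqs: "B ** transpose B = mat 1" "reduced_H a Rz \<pi> p = reduced_H a Ry \<pi>y py" "\<pi> \<bullet> \<pi> = \<pi>y \<bullet> \<pi>y"
        using z(2) By by (simp_all add: conserved_def ze ye)
      then have "\<Lambda> (Rz, \<pi>, p) = \<Lambda> (Ry, \<pi>y, py)" by (simp add: \<Lambda>_def)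
      also have "\<dots> < m" using y by (simp add: W_def ye)
      finally have "(Rz, \<pi>, p) \<notin> sphere ?x0 e" using m(2) by force
      moreover have "(Rz, \<pi>, p) \<in> cball ?x0 e" using z(1) by (simp add: C_def ze)
      ultimately have "(Rz, \<pi>, p) \<in> ball ?x0 e" by auto
      then show ?thesis unfolding intC using norm_lt[OF eqs(1)] by (simp add: ze)
    qed
    have "bounded C" using C(1) by (rule compact_imp_bounded)
    moreover have "norm R0 - e > 0" using e by simp
    ultimately obtain L where L: "L-lipschitz_on C (sat_vf a)"
      using sat_vf_lipschitz[of C "norm R0 - e"] away by blast
    show "\<exists>\<gamma>. integral_curve (ham_vf (H2 \<I>)) \<gamma> \<and> \<gamma> 0 = y"
    proof -
      obtain \<gamma> where \<gamma>: "\<gamma> 0 = y" "\<And>t. \<gamma> t \<in> C" "\<And>t. conserved (\<gamma> t) = conserved y"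
        "\<And>t. (\<gamma> has_vector_derivative sat_vf a (\<gamma> t)) (at t)"
        using trapped_global_solution[OF C(1,2) L yC P conserved_deriv_sat_vf trap] by blast
      have orth: "orthogonal_matrix (fst (\<gamma> t))" for t
      proof -
        have "fst (\<gamma> t) ** transpose (fst (\<gamma> t)) = fst (conserved (\<gamma> t))"
          by (simp add: conserved_def case_prod_unfold)
        also have "\<dots> = mat 1" unfolding \<gamma>(3) by (simp add: conserved_def ye By)
        finally show ?thesis by (simp add: orthogonal_matrix_def matrix_left_right_inverse)
      qed
      have "continuous_on UNIV (\<lambda>t. fst (\<gamma> t))"
        using \<gamma>(4) by (intro continuous_on_fst continuous_at_imp_continuous_on)
          (auto intro: has_vector_derivative_continuous)
      then have "rotation_matrix (fst (\<gamma> t))" for t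
        by (rule rotation_matrix_curve[OF _ orth]) (use y in \<open>simp add: \<gamma>(1) phase_space_def ye\<close>)
      then have "\<gamma> t \<in> phase_space" for t
        using R[OF \<gamma>(2)[of t]] by (cases "\<gamma> t") (simp add: phase_space_def, metis fst_conv)
      then have "integral_curve (ham_vf (H2 \<I>)) \<gamma>"
        using \<gamma>(4) by (simp add: integral_curve_def ham_vf_H2)
      then show ?thesis using \<gamma>(1) by blast
    qed
    \<comment> \<open>Stability speaks of every integral curve from \<open>y\<close>, so trapping is
      applied to the given curve rather than to the solution constructed above.\<close>
    show "\<forall>\<gamma>. integral_curve (ham_vf (H2 \<I>)) \<gamma> \<and> \<gamma> 0 = y \<longrightarrow> (\<forall>t. \<gamma> t \<in> U)"
    proof (intro allI impI, elim conjE)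
      fix \<gamma> t assume "integral_curve (ham_vf (H2 \<I>)) \<gamma>" and \<gamma>0: "\<gamma> 0 = y"
      then have ps: "\<And>t. \<gamma> t \<in> phase_space" and D: "\<And>t. (\<gamma> has_vector_derivative sat_vf a (\<gamma> t)) (at t)"
        unfolding integral_curve_def by (simp, metis ham_vf_H2)
      have cont: "continuous_on UNIV \<gamma>"
        using D by (intro continuous_at_imp_continuous_on) (auto intro: has_vector_derivative_continuous)
      have in_C: "\<gamma> t \<in> C" and const: "conserved (\<gamma> t) = conserved y"
        using trapped_curve[where X="sat_vf a", OF C(3) \<gamma>0 yC cont D P conserved_deriv_sat_vf trap] by blast+
      obtain B Rt \<pi> p where ze: "\<gamma> t = (B, Rt, \<pi>, p)" by (cases "\<gamma> t")
      have B: "rotation_matrix B" using ps[of t] by (simp add: ze phase_space_def)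
      have x: "dist (Rt, \<pi>, p) ?x0 \<le> e" using in_C by (simp add: C_def ze dist_commute)
      have "B *v \<pi> = By *v \<pi>y" using const by (simp add: conserved_def ze ye)
      then have "norm (B *v \<pi> - \<pi>0) < \<eta> / 2" using y by (simp add: W_def ye dist_norm norm_minus_commute)
      \<comment> \<open>\<open>B\<close> moves \<open>\<pi>0\<close> by at most \<open>e\<close>
        (from the change of \<open>\<pi>\<close>) plus \<open>\<eta> / 2\<close> (from conservation
        of the spatial momentum), hence by at most \<open>\<eta>\<close>.\<close>
      moreover have "norm (B *v (\<pi>0 - \<pi>)) \<le> e"
      proof -
        have "norm (B *v (\<pi>0 - \<pi>)) = norm (\<pi>0 - \<pi>)"
        proof (rule orthogonal_transformation_norm)
          show "orthogonal_transformation ((*v) B)"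
            using B by (simp add: orthogonal_transformation_matrix rotation_matrix_def)
        qed
        also have "\<dots> \<le> e"
          using x dist_snd_le[of "(Rt, \<pi>, p)" ?x0] dist_fst_le[of "(\<pi>, p)" "(\<pi>0, p0)"]
          by (simp add: dist_norm norm_minus_commute)
        finally show ?thesis .
      qed
      moreover have "norm (B *v \<pi>0 - \<pi>0) \<le> norm (B *v (\<pi>0 - \<pi>)) + norm (B *v \<pi> - \<pi>0)"
        using norm_triangle_ineq[of "B *v (\<pi>0 - \<pi>)" "B *v \<pi> - \<pi>0"]
        by (simp add: matrix_vector_mult_diff_distrib)
      ultimately have "norm (B *v \<pi>0 - \<pi>0) \<le> \<eta>" using e(2) by simp
      then have "\<gamma> t \<in> V" using near[OF B, of "(Rt, \<pi>, p)"] x e(1,2) \<eta> by (simp add: ze)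
      then show "\<gamma> t \<in> U" using ps VU by blast
    qed
  qed
qed

end

lemma strict_local_min_second_derivative:
  fixes f f' :: "real \<Rightarrow> real"
  assumes r: "r > 0" and f: "\<And>x. x > 0 \<Longrightarrow> (f has_real_derivative f' x) (at x)"
    and f'0: "f' r = 0" and f'': "(f' has_real_derivative c) (at r)" "c > 0"
  shows "\<exists>d>0. \<forall>x. x \<noteq> r \<longrightarrow> \<bar>x - r\<bar> < d \<longrightarrow> f r < f x"
proof -
  obtain d1 where d1: "d1 > 0" "\<And>h. 0 < h \<Longrightarrow> h < d1 \<Longrightarrow> f' r < f' (r + h)"
    using DERIV_pos_inc_right[OF f''] by blast
  obtain d2 where d2: "d2 > 0" "\<And>h. 0 < h \<Longrightarrow> h < d2 \<Longrightarrow> f' (r - h) < f' r"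
    using DERIV_pos_inc_left[OF f''] by blast
  define d where "d = min r (min d1 d2)"
  have "f r < f x" if x: "x \<noteq> r" "\<bar>x - r\<bar> < d" for x
  proof (cases "x > r")
    case True
    show ?thesis
    proof (rule DERIV_pos_imp_increasing_open[OF True])
      fix y assume y: "r < y" "y < x"
      then have "f' y > 0" using d1(2)[of "y - r"] x f'0 by (simp add: d_def)
      moreover have "(f has_real_derivative f' y) (at y)" using f y r by simp
      ultimately show "\<exists>D. (f has_real_derivative D) (at y) \<and> 0 < D" by blast
    next
      show "continuous_on {r..x} f"
        by (intro continuous_at_imp_continuous_on ballI DERIV_isCont[OF f]) (use r in auto)
    qed
  next
    case False
    then have xr: "x < r" using x by simp
    have x0: "x > 0" using x xr by (simp add: d_def)
    show ?thesis
    proof (rule DERIV_neg_imp_decreasing_open[OF xr])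
      fix y assume y: "x < y" "y < r"
      then have "f' y < 0" using d2(2)[of "r - y"] x xr f'0 by (simp add: d_def)
      moreover have "(f has_real_derivative f' y) (at y)" using f y x0 by simp
      ultimately show "\<exists>D. (f has_real_derivative D) (at y) \<and> D < 0" by blast
    next
      show "continuous_on {x..r} f"
        by (intro continuous_at_imp_continuous_on ballI DERIV_isCont[OF f]) (use x0 in auto)
    qed
  qed
  moreover have "d > 0" using d1 d2 r by (simp add: d_def)
  ultimately show ?thesis by blast
qed

section \<open>The amended potential as a lower bound of the energy\<close>

context satellite
begin

text \<open>The locked inertia tensor is \<open>\<I>\<close> plus \<open>R \<bullet> R\<close> times
  the identity, minus the dyad of \<open>R\<close>. Dropping the dyad makes it diagonal, at the cost
  of the square of \<open>\<omega> \<bullet> R\<close>; this is the identity of Lagrange for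
  \<open>cross3 \<omega> R\<close>.\<close>

lemma reduced_H_squares:
  defines "d \<equiv> \<lambda>R i. a $ i + R \<bullet> R"
  defines "\<omega> \<equiv> \<lambda>R \<pi>. \<chi> i. \<pi> $ i / d R i"
  shows "reduced_H a R \<pi> p = ((Om R \<pi> p - \<omega> R \<pi>) \<bullet> (\<I> *v (Om R \<pi> p - \<omega> R \<pi>))
    + (p - cross3 (\<omega> R \<pi>) R) \<bullet> (p - cross3 (\<omega> R \<pi>) R) + (\<omega> R \<pi> \<bullet> R)\<^sup>2
    + (\<Sum>i\<in>UNIV. (\<pi> $ i)\<^sup>2 / d R i)) / 2 + V2 \<I> R"
proof -
  let ?w = "\<omega> R \<pi>" and ?\<Omega> = "Om R \<pi> p" and ?m = "\<pi> - cross3 R p"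
  have d: "d R i > 0" for i using a_pos[of i] by (simp add: d_def add_pos_nonneg)
  have dw: "\<pi> $ i = d R i * ?w $ i" for i using d[of i] by (simp add: \<omega>_def)
  have wD: "\<I> *v ?w + (R \<bullet> R) *\<^sub>R ?w = \<pi>"
    by (simp add: vec_eq_iff diag_mult_vec dw d_def algebra_simps)
  have "(\<Sum>i\<in>UNIV. (\<pi> $ i)\<^sup>2 / d R i) = \<pi> \<bullet> ?w"
    by (simp add: inner_vec_def \<omega>_def power2_eq_square)
  moreover have "?w \<bullet> \<pi> = ?w \<bullet> (\<I> *v ?w) + (R \<bullet> R) * (?w \<bullet> ?w)"
    by (subst wD[symmetric]) (simp add: inner_add_right)
  moreover have "(?\<Omega> - ?w) \<bullet> (\<I> *v (?\<Omega> - ?w)) = ?m \<bullet> ?\<Omega> - 2 * (?w \<bullet> ?m) + ?w \<bullet> (\<I> *v ?w)"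
    using inertia_body_vel[of R \<pi> p] diag_sym[of ?\<Omega> a ?w]
    by (simp add: matrix_vector_mult_diff_distrib inner_diff_left inner_diff_right inner_commute)
  moreover have "?w \<bullet> ?m = ?w \<bullet> \<pi> - p \<bullet> cross3 ?w R"
    by (simp add: inner_diff_right) (simp add: cross3_simps)
  moreover have "(p - cross3 ?w R) \<bullet> (p - cross3 ?w R) = p \<bullet> p - 2 * (p \<bullet> cross3 ?w R) + cross3 ?w R \<bullet> cross3 ?w R"
    by (simp add: inner_diff_left inner_diff_right inner_commute)
  moreover have "cross3 ?w R \<bullet> cross3 ?w R + (?w \<bullet> R)\<^sup>2 = (R \<bullet> R) * (?w \<bullet> ?w)"
    using norm_cross_dot[of ?w R] by (simp add: power_mult_distrib power2_norm_eq_inner)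
  ultimately show ?thesis
    unfolding reduced_H_def by (simp add: inner_commute field_simps)
qed

end

context lagrange
begin

text \<open>Splits off the value on the second axis; the Lagrange conditions make the remainder
  nonnegative.\<close>

lemma V2_spherical:
  assumes "R \<noteq> 0"
  shows "V2 \<I> R = - 1 / norm R - (1 - 3 * I2) / (2 * norm R ^ 3)
    + 3 / (2 * norm R ^ 5) * ((I1 - I2) * (R $ 1)\<^sup>2 + (I3 - I2) * (R $ 3)\<^sup>2)"
proof -
  have n: "norm R > 0" using assms by simp
  have "R \<bullet> (\<I> *v R) = I2 * (norm R)\<^sup>2 + ((I1 - I2) * (R $ 1)\<^sup>2 + (I3 - I2) * (R $ 3)\<^sup>2)"
    unfolding power2_norm_eq_inner by (simp add: inner_vec_def sum_3 diag_mult_vec power2_eq_square algebra_simps)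
  then show ?thesis
    unfolding V2_def by (simp only:) (use n in \<open>simp add: field_simps power_numeral_reduce\<close>)
qed

text \<open>Potential plus centrifugal energy at distance \<open>\<rho>\<close>, for squared
  momentum \<open>s\<close> along the first axis and \<open>R\<close> along the second.\<close>

definition amended :: "real \<Rightarrow> real \<Rightarrow> real" where
  "amended s \<rho> = - 1 / \<rho> - (1 - 3 * I2) / (2 * \<rho> ^ 3) + s / (2 * (I1 + \<rho>\<^sup>2))"

text \<open>The formula for \<open>k\<^sup>2\<close> says that \<open>r\<close> is a critical point.
  The second derivative there is the polynomial in \<open>pos\<close> divided by the positive number
  \<open>2 * r ^ 5 * (I1 + r\<^sup>2)\<close>.\<close>

lemma amended_strict_local_min:
  assumes r: "r > 0" and k2: "k\<^sup>2 = (2 * r^2 + 3 - 9 * I2) / (2 * r^5)"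
    and pos: "2 * r^4 + (9 * I2 - 6 * I1 - 3) * r^2 - 15 * I1 + 45 * I1 * I2 > 0"
  shows "\<exists>d>0. \<forall>\<rho>. \<rho> \<noteq> r \<longrightarrow> \<bar>\<rho> - r\<bar> < d \<longrightarrow>
    amended (((I1 + r\<^sup>2) * k)\<^sup>2) r < amended (((I1 + r\<^sup>2) * k)\<^sup>2) \<rho>"
proof -
  define s where "s = ((I1 + r\<^sup>2) * k)\<^sup>2"
  define \<kappa> where "\<kappa> = 1 - 3 * I2"
  have I1: "I1 > 0" using I_pos I_order by simp
  have D: "I1 + x\<^sup>2 > 0" for x using I1 by (simp add: add_pos_nonneg)
  let ?f' = "\<lambda>x. 1 / x\<^sup>2 + 3 * \<kappa> / (2 * x ^ 4) - s * x / (I1 + x\<^sup>2)\<^sup>2"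
  let ?c = "- 2 / r ^ 3 - 6 * \<kappa> / r ^ 5 - s / (I1 + r\<^sup>2)\<^sup>2 + 4 * s * r\<^sup>2 / (I1 + r\<^sup>2) ^ 3"
  have "\<exists>d>0. \<forall>\<rho>. \<rho> \<noteq> r \<longrightarrow> \<bar>\<rho> - r\<bar> < d \<longrightarrow> amended s r < amended s \<rho>"
  proof (rule strict_local_min_second_derivative[OF r])
    show "(amended s has_real_derivative ?f' x) (at x)" if "x > 0" for x
    proof -
      have d1: "((\<lambda>x. - 1 / x) has_real_derivative 1 / x\<^sup>2) (at x)"
        using that by (auto intro!: derivative_eq_intros simp: power2_eq_square)
      have d2: "((\<lambda>x. \<kappa> / (2 * x ^ 3)) has_real_derivative - (3 * \<kappa> / (2 * x ^ 4))) (at x)"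
        using that by (auto intro!: derivative_eq_intros simp: field_simps power_numeral_reduce)
      have d3: "((\<lambda>x. s / (2 * (I1 + x\<^sup>2))) has_real_derivative - (s * x / (I1 + x\<^sup>2)\<^sup>2)) (at x)"
        using D[of x] by (auto intro!: derivative_eq_intros simp: power2_eq_square simp del: distrib_left_numeral)
      have "amended s = (\<lambda>x. - 1 / x - \<kappa> / (2 * x ^ 3) + s / (2 * (I1 + x\<^sup>2)))"
        by (simp add: fun_eq_iff amended_def \<kappa>_def)
      then show ?thesis using DERIV_add[OF DERIV_diff[OF d1 d2] d3] by simp
    qed
    have s: "s = (I1 + r\<^sup>2)\<^sup>2 * k\<^sup>2" by (simp add: s_def power_mult_distrib)
    have sk: "s / (I1 + r\<^sup>2)\<^sup>2 = k\<^sup>2" using D[of r] by (simp add: s)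
    have sk3: "s / (I1 + r\<^sup>2) ^ 3 = k\<^sup>2 / (I1 + r\<^sup>2)" using D[of r] by (simp add: s power2_eq_square power3_eq_cube)
    have "?f' r = 1 / r\<^sup>2 + 3 * \<kappa> / (2 * r ^ 4) - k\<^sup>2 * r" by (simp flip: sk)
    also have "\<dots> = 0" unfolding k2 \<kappa>_def using r by (simp add: field_simps power_numeral_reduce)
    finally show "?f' r = 0" .
    show "(?f' has_real_derivative ?c) (at r)"
    proof -
      have d1: "((\<lambda>x. 1 / x\<^sup>2) has_real_derivative - 2 / r ^ 3) (at r)"
        using r by (auto intro!: derivative_eq_intros simp: field_simps power_numeral_reduce)
      have d2: "((\<lambda>x. 3 * \<kappa> / (2 * x ^ 4)) has_real_derivative - (6 * \<kappa> / r ^ 5)) (at r)"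
        using r by (auto intro!: derivative_eq_intros simp: field_simps power_numeral_reduce)
      have d3: "((\<lambda>x. s * x / (I1 + x\<^sup>2)\<^sup>2) has_real_derivative
          s / (I1 + r\<^sup>2)\<^sup>2 - 4 * s * r\<^sup>2 / (I1 + r\<^sup>2) ^ 3) (at r)"
      proof -
        have 1: "((\<lambda>x. s * x) has_real_derivative s) (at r)"
          by (auto intro!: derivative_eq_intros)
        have 2: "((\<lambda>x. (I1 + x\<^sup>2)\<^sup>2) has_real_derivative 2 * (I1 + r\<^sup>2) * (2 * r)) (at r)"
          by (auto intro!: derivative_eq_intros)
        have 3: "(s * E\<^sup>2 - s * r * (2 * E * (2 * r))) / (E\<^sup>2 * E\<^sup>2) = s / E\<^sup>2 - 4 * s * r\<^sup>2 / E ^ 3"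
          if "E > 0" for E :: real
          using that by (simp add: field_simps power_numeral_reduce)
        have "(I1 + r\<^sup>2)\<^sup>2 \<noteq> 0" using D[of r] by simp
        from DERIV_divide[OF 1 2 this] show ?thesis unfolding 3[OF D] .
      qed
      show ?thesis by (rule DERIV_cong[OF DERIV_diff[OF DERIV_add[OF d1 d2] d3]]) simp
    qed
    have "?c = - 2 / r ^ 3 - 6 * \<kappa> / r ^ 5 - k\<^sup>2 + 4 * k\<^sup>2 * r\<^sup>2 / (I1 + r\<^sup>2)"
    proof -
      have "4 * s * r\<^sup>2 / (I1 + r\<^sup>2) ^ 3 = 4 * r\<^sup>2 * (s / (I1 + r\<^sup>2) ^ 3)" by simp
      then show ?thesis unfolding sk3 sk by simp
    qed
    also have "\<dots> = (2 * r^4 + (9 * I2 - 6 * I1 - 3) * r^2 - 15 * I1 + 45 * I1 * I2) / (2 * r ^ 5 * (I1 + r\<^sup>2))"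
      unfolding k2 \<kappa>_def using r D[of r] by (simp add: divide_simps) (simp add: algebra_simps power_numeral_reduce)
    also have "\<dots> > 0" using pos r D[of r] by simp
    finally show "?c > 0" .
  qed
  then show ?thesis by (simp only: s_def)
qed

lemma reduced_H_family:
  assumes r: "r > 0"
  shows "reduced_H aI (vector [0, r, 0]) (vector [(I1 + r\<^sup>2) * k, 0, 0]) (vector [0, 0, k * r])
    = amended (((I1 + r\<^sup>2) * k)\<^sup>2) r"
proof -
  let ?R = "vector [0, r, 0] :: real^3" and ?\<pi> = "vector [(I1 + r\<^sup>2) * k, 0, 0] :: real^3"
    and ?p = "vector [0, 0, k * r] :: real^3"
  have I1: "I1 > 0" using I_pos I_order by simp
  then have D: "I1 + r\<^sup>2 > 0" by (simp add: add_pos_nonneg)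
  have n: "norm ?R = r" using r by (simp add: norm_eq_sqrt_inner inner_vec_def sum_3)
  then have "?R \<noteq> 0" using r by auto
  from V2_spherical[OF this] have V: "V2 \<I> ?R = - 1 / r - (1 - 3 * I2) / (2 * r ^ 3)" by (simp add: n)
  have m: "?\<pi> - cross3 ?R ?p = vector [I1 * k, 0, 0]"
    by (simp add: vec_eq_iff forall_3 cross3_def power2_eq_square algebra_simps)
  have "Om ?R ?\<pi> ?p = vector [k, 0, 0]"
    unfolding body_vel_def m using I1 by (simp add: vec_eq_iff forall_3 inertia_inv_def diag_mult_vec)
  then have "(?\<pi> - cross3 ?R ?p) \<bullet> Om ?R ?\<pi> ?p + ?p \<bullet> ?p = (I1 + r\<^sup>2) * k\<^sup>2"
    unfolding m by (simp add: inner_vec_def sum_3 power2_eq_square algebra_simps)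
  moreover have "((I1 + r\<^sup>2) * k)\<^sup>2 / (2 * (I1 + r\<^sup>2)) = (I1 + r\<^sup>2) * k\<^sup>2 / 2"
  proof -
    have "(E * k)\<^sup>2 / (2 * E) = E * k\<^sup>2 / 2" if "E > 0" for E :: real
      using that by (simp add: power2_eq_square)
    from this[OF D] show ?thesis .
  qed
  ultimately show ?thesis unfolding reduced_H_def V amended_def by simp
qed

text \<open>The energy exceeds the amended potential by a combination of nonnegative terms, all of
  which vanish when the excess does.\<close>

lemma reduced_H_le_amended_imp:
  fixes R \<pi> p :: "real^3"
  assumes R: "R \<noteq> 0"
  defines "\<omega> \<equiv> \<chi> i. \<pi> $ i / (aI $ i + R \<bullet> R)" and "d \<equiv> \<lambda>i. aI $ i + R \<bullet> R"
  assumes le: "reduced_H aI R \<pi> p \<le> amended (\<pi> \<bullet> \<pi>) (norm R)"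
  shows "p = cross3 \<omega> R" "\<pi> $ 2 = 0" "\<pi> $ 3 = 0" "R $ 1 = 0" "R $ 3 = 0"
    "reduced_H aI R \<pi> p = amended (\<pi> \<bullet> \<pi>) (norm R)"
proof -
  \<comment> \<open>\<open>Q1\<close> to \<open>Q3\<close> are the completed squares;
    \<open>Q4\<close> and \<open>Q5\<close> penalise momentum off the first axis, \<open>Q6\<close>
    and \<open>Q7\<close> position off the second axis.\<close>
  define Q1 where "Q1 = (Om R \<pi> p - \<omega>) \<bullet> (\<I> *v (Om R \<pi> p - \<omega>))"
  define Q2 where "Q2 = (p - cross3 \<omega> R) \<bullet> (p - cross3 \<omega> R)"
  define Q3 where "Q3 = (\<omega> \<bullet> R)\<^sup>2"
  define Q4 where "Q4 = (1 / d 2 - 1 / d 1) * (\<pi> $ 2)\<^sup>2"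
  define Q5 where "Q5 = (1 / d 3 - 1 / d 1) * (\<pi> $ 3)\<^sup>2"
  define Q6 where "Q6 = 3 / (2 * norm R ^ 5) * ((I1 - I2) * (R $ 1)\<^sup>2)"
  define Q7 where "Q7 = 3 / (2 * norm R ^ 5) * ((I3 - I2) * (R $ 3)\<^sup>2)"
  have n: "norm R > 0" using R by simp
  have d1: "d 1 = I1 + (norm R)\<^sup>2" "d 2 = I2 + (norm R)\<^sup>2" "d 3 = I3 + (norm R)\<^sup>2"
    by (simp_all add: d_def power2_norm_eq_inner)
  have dpos: "0 < d 2" "d 2 < d 3" "d 3 < d 1" using n I_pos I_order by (simp_all add: d1 add_pos_nonneg)
  have c: "1 / d 2 - 1 / d 1 > 0" "1 / d 3 - 1 / d 1 > 0"
    using dpos by (simp_all add: frac_less2)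
  have "(\<Sum>i\<in>UNIV. (\<pi> $ i)\<^sup>2 / (aI $ i + R \<bullet> R)) = (\<pi> \<bullet> \<pi>) / d 1 + Q4 + Q5"
    unfolding d_def[THEN meta_eq_to_obj_eq, THEN fun_cong, symmetric]
    by (simp add: sum_3 Q4_def Q5_def inner_vec_def power2_eq_square add_divide_distrib algebra_simps)
  moreover have "amended (\<pi> \<bullet> \<pi>) (norm R) = - 1 / norm R - (1 - 3 * I2) / (2 * norm R ^ 3) + (\<pi> \<bullet> \<pi>) / d 1 / 2"
    by (simp add: amended_def d1)
  moreover have "V2 \<I> R = - 1 / norm R - (1 - 3 * I2) / (2 * norm R ^ 3) + (Q6 + Q7)"
    by (simp add: V2_spherical[OF R] Q6_def Q7_def algebra_simps)
  ultimately have H: "reduced_H aI R \<pi> p = amended (\<pi> \<bullet> \<pi>) (norm R)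
      + (Q1 + Q2 + Q3 + Q4 + Q5) / 2 + Q6 + Q7"
    unfolding reduced_H_squares[of R \<pi> p, folded \<omega>_def] Q1_def[symmetric] Q2_def[symmetric] Q3_def[symmetric] by simp
  have nonneg: "Q1 \<ge> 0" "Q2 \<ge> 0" "Q3 \<ge> 0" "Q4 \<ge> 0" "Q5 \<ge> 0" "Q6 \<ge> 0" "Q7 \<ge> 0"
  proof -
    show "Q1 \<ge> 0"
      unfolding Q1_def inner_vec_def diag_mult_vec
      by (rule sum_nonneg) (use a_pos in \<open>simp add: mult.left_commute less_imp_le\<close>)
  qed (use c n I_order in \<open>simp_all add: Q2_def Q3_def Q4_def Q5_def Q6_def Q7_def\<close>)
  have sum0: "Q1 + Q2 + Q3 + Q4 + Q5 + 2 * Q6 + 2 * Q7 \<le> 0"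
    using le unfolding H by (simp add: field_simps)
  have "Q2 = 0" using sum0 nonneg by linarith
  moreover have "Q4 = 0" using sum0 nonneg by linarith
  moreover have "Q5 = 0" using sum0 nonneg by linarith
  moreover have "Q6 = 0" using sum0 nonneg by linarith
  moreover have "Q7 = 0" using sum0 nonneg by linarith
  ultimately show "p = cross3 \<omega> R" "\<pi> $ 2 = 0" "\<pi> $ 3 = 0" "R $ 1 = 0" "R $ 3 = 0"
    using dpos n I_order by (auto simp: Q2_def Q4_def Q5_def Q6_def Q7_def)
  show "reduced_H aI R \<pi> p = amended (\<pi> \<bullet> \<pi>) (norm R)"
    by (rule antisym[OF le]) (use nonneg in \<open>simp add: H\<close>)
qed

lemma family_G_mu_stable:
  assumes r: "r > 0" and k: "k > 0" and k2: "k\<^sup>2 = (2 * r^2 + 3 - 9 * I2) / (2 * r^5)"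
    and pos: "2 * r^4 + (9 * I2 - 6 * I1 - 3) * r^2 - 15 * I1 + 45 * I1 * I2 > 0"
  shows "G_mu_stable \<I> (pair_point \<I> (vector [0, r, 0]) (vector [k, 0, 0]))"
proof -
  let ?R = "vector [0, r, 0] :: real^3"
  define \<mu> where "\<mu> = (I1 + r\<^sup>2) * k"
  let ?\<pi> = "vector [\<mu>, 0, 0] :: real^3" and ?p = "vector [0, 0, k * r] :: real^3"
  have "I1 > 0" using I_pos I_order by simp
  then have D: "I1 + r\<^sup>2 > 0" by (simp add: add_pos_nonneg)
  have \<mu>: "\<mu> > 0" using D k by (simp add: \<mu>_def)
  obtain \<delta> where \<delta>: "\<delta> > 0" "\<And>\<rho>. \<rho> \<noteq> r \<Longrightarrow> \<bar>\<rho> - r\<bar> < \<delta> \<Longrightarrow> amended (\<mu>\<^sup>2) r < amended (\<mu>\<^sup>2) \<rho>"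
    using amended_strict_local_min[OF r k2 pos, folded \<mu>_def] by blast
  \<comment> \<open>Besides the radius of the local minimum, the bounds \<open>r\<close> and
    \<open>\<mu>\<close> exclude the mirror images with \<open>R $ 2 = - r\<close> or
    \<open>\<pi> $ 1 = - \<mu>\<close>, which have the same energy and momentum norm.\<close>
  define \<epsilon> where "\<epsilon> = min \<delta> (min r \<mu>)"
  have \<epsilon>: "\<epsilon> > 0" using \<delta> r \<mu> by (simp add: \<epsilon>_def)
  have nR: "norm ?R = r" using r by (simp add: norm_eq_sqrt_inner inner_vec_def sum_3)
  then have R0: "?R \<noteq> 0" using r by auto
  have \<mu>2: "?\<pi> \<bullet> ?\<pi> = \<mu>\<^sup>2" by (simp add: inner_vec_def sum_3 power2_eq_square)
  show ?thesis
    unfolding pair_point_family \<mu>_def[symmetric]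
  proof (rule G_mu_stableI[OF R0 \<epsilon>])
    fix R \<pi> p :: "real^3"
    assume dist: "dist (R, \<pi>, p) (?R, ?\<pi>, ?p) < \<epsilon>" and \<pi>: "\<pi> \<bullet> \<pi> = ?\<pi> \<bullet> ?\<pi>"
      and H: "reduced_H aI R \<pi> p \<le> reduced_H aI ?R ?\<pi> ?p"
    have dR: "norm (R - ?R) < \<epsilon>" and d\<pi>: "norm (\<pi> - ?\<pi>) < \<epsilon>"
      using dist dist_fst_le[of "(R, \<pi>, p)" "(?R, ?\<pi>, ?p)"] dist_snd_le[of "(R, \<pi>, p)" "(?R, ?\<pi>, ?p)"]
        dist_fst_le[of "(\<pi>, p)" "(?\<pi>, ?p)"] by (simp_all add: dist_norm)
    have \<rho>: "\<bar>norm R - r\<bar> < \<epsilon>"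
      using norm_triangle_ineq3[of R ?R] dR by (simp add: nR)
    then have R: "R \<noteq> 0" by (auto simp: \<epsilon>_def)
    have H0: "reduced_H aI ?R ?\<pi> ?p = amended (\<mu>\<^sup>2) r"
      unfolding \<mu>_def by (rule reduced_H_family[OF r])
    have le: "amended (\<mu>\<^sup>2) r \<le> amended (\<mu>\<^sup>2) (norm R)"
      using \<delta>(2)[of "norm R"] \<rho> by (cases "norm R = r") (auto simp: \<epsilon>_def)
    \<comment> \<open>Minimality at \<open>r\<close> turns the energy bound into the hypothesis of
      the lower bound lemma; the equality obtained from it then forces \<open>norm R = r\<close> by
      strictness.\<close>
    then have "reduced_H aI R \<pi> p \<le> amended (\<pi> \<bullet> \<pi>) (norm R)"
      using H H0 unfolding \<pi> \<mu>2 by simp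
    note lb = reduced_H_le_amended_imp[OF R this]
    have \<rho>r: "norm R = r"
      using \<delta>(2)[of "norm R"] \<rho> H H0 lb(6) unfolding \<pi> \<mu>2 by (auto simp: \<epsilon>_def)
    have "(R $ 2)\<^sup>2 = r\<^sup>2"
      using power2_norm_eq_inner[of R] lb(4,5) unfolding \<rho>r
      by (simp add: inner_vec_def sum_3 power2_eq_square)
    moreover have "\<bar>R $ 2 - r\<bar> < r"
      using component_le_norm_cart[of "R - ?R" 2] dR by (simp add: \<epsilon>_def)
    ultimately have R2: "R $ 2 = r" by (auto simp: power2_eq_iff)
    have "(\<pi> $ 1)\<^sup>2 = \<mu>\<^sup>2"
      using \<pi> lb(2,3) unfolding \<mu>2 by (simp add: inner_vec_def sum_3 power2_eq_square)
    moreover have "\<bar>\<pi> $ 1 - \<mu>\<bar> < \<mu>"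
      using component_le_norm_cart[of "\<pi> - ?\<pi>" 1] d\<pi> by (simp add: \<epsilon>_def)
    ultimately have \<pi>1: "\<pi> $ 1 = \<mu>" by (auto simp: power2_eq_iff)
    have Req: "R = ?R" and \<pi>eq: "\<pi> = ?\<pi>"
      using R2 \<pi>1 lb(2-5) by (simp_all add: vec_eq_iff forall_3)
    have "?R \<bullet> ?R = r\<^sup>2" by (simp add: inner_vec_def sum_3 power2_eq_square)
    then have "p = ?p"
      using lb(1) D unfolding Req \<pi>eq by (simp add: vec_eq_iff forall_3 cross3_def \<mu>_def)
    then show "(R, \<pi>, p) = (?R, ?\<pi>, ?p)" using Req \<pi>eq by simp
  qed
qed

text \<open>In the variable \<open>r\<^sup>2\<close> the polynomial is quadratic with leading
  coefficient 2 and negative constant term \<open>15 * I1 * (3 * I2 - 1)\<close>, so one root is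
  positive and the other, minus \<open>?B\<close> in the proof, is negative.\<close>

lemma critical_radius:
  "\<exists>c>0. (\<forall>r>0. 2 * r^4 + (9 * I2 - 6 * I1 - 3) * r^2 - 15 * I1 + 45 * I1 * I2 = 0 \<longleftrightarrow> r = c) \<and>
    (\<forall>r>c. 2 * r^4 + (9 * I2 - 6 * I1 - 3) * r^2 - 15 * I1 + 45 * I1 * I2 > 0) \<and>
    (\<forall>r. 0 < r \<and> r < c \<longrightarrow> 2 * r^4 + (9 * I2 - 6 * I1 - 3) * r^2 - 15 * I1 + 45 * I1 * I2 < 0)"
proof -
  let ?f = "\<lambda>r::real. 2 * r^4 + (9 * I2 - 6 * I1 - 3) * r^2 - 15 * I1 + 45 * I1 * I2"
  have "I1 * (3 * I2 - 1) < 0" using I_pos I_order I2_less by (simp add: mult_less_0_iff)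
  then have "0 * ((9 * I2 - 6 * I1 - 3) / 2) < - (15 * (I1 * (3 * I2 - 1)) / 2)" by simp
  from quadratic_positive_root[of "(9 * I2 - 6 * I1 - 3) / 2" 0 "- (15 * (I1 * (3 * I2 - 1)) / 2)"] this
  obtain \<Lambda> where \<Lambda>: "\<Lambda> > 0" "(\<Lambda> + (9 * I2 - 6 * I1 - 3) / 2) * \<Lambda> = - (15 * (I1 * (3 * I2 - 1)) / 2)"
    by auto
  let ?B = "\<Lambda> + (9 * I2 - 6 * I1 - 3) / 2"
  have "?B * \<Lambda> > 0" unfolding \<Lambda>(2) using \<open>I1 * (3 * I2 - 1) < 0\<close> by simp
  then have B: "?B > 0" using \<Lambda>(1) by (simp add: zero_less_mult_iff)
  have fac: "?f r = 2 * (r\<^sup>2 + ?B) * (r\<^sup>2 - \<Lambda>)" for r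
  proof -
    have "2 * (r\<^sup>2 + ?B) * (r\<^sup>2 - \<Lambda>) = 2 * r^4 + (9 * I2 - 6 * I1 - 3) * r^2 - 2 * (?B * \<Lambda>)"
      by (simp add: field_simps power_numeral_reduce)
    then show ?thesis unfolding \<Lambda>(2) by (simp add: algebra_simps diff_divide_distrib)
  qed
  have P: "2 * (r\<^sup>2 + ?B) > 0" for r by (intro mult_pos_pos add_nonneg_pos B zero_le_power2) simp
  have c: "sqrt \<Lambda> > 0" "(sqrt \<Lambda>)\<^sup>2 = \<Lambda>" using \<Lambda>(1) by simp_all
  have "?f r = 0 \<longleftrightarrow> r = sqrt \<Lambda>" if "r > 0" for r
    unfolding fac using P[of r] that c by (auto simp: real_sqrt_unique)
  moreover have "?f r > 0" if "r > sqrt \<Lambda>" for r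
    unfolding fac using P[of r] power_strict_mono[OF that, of 2] c by (simp add: zero_less_mult_iff)
  moreover have "?f r < 0" if "0 < r" "r < sqrt \<Lambda>" for r
    unfolding fac using P[of r] power_strict_mono[OF that(2), of 2] c that by (simp add: mult_less_0_iff)
  ultimately show ?thesis using c(1) by blast
qed

end

theorem proposition3p12:
  fixes I1 I2 I3 :: real and xi1 :: "real \<Rightarrow> real"
  assumes "0 < I1" "I1 < 1/2" "0 < I2" "I2 < 1/2" "0 < I3" "I3 < 1/2"
    and "I1 + I2 + I3 = 1"
    and "I1 > I3" "I3 > I2"
    and xi1: "\<And>r. 0 < r \<Longrightarrow> 0 < xi1 r \<and> (xi1 r)\<^sup>2 = (2 * r^2 + 3 - 9 * I2) / (2 * r^5)"
  defines "I \<equiv> diag (vector [I1, I2, I3])"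
    and "R \<equiv> \<lambda>r::real. (vector [0, r, 0] :: real^3)"
    and "\<xi> \<equiv> \<lambda>r::real. (vector [xi1 r, 0, 0] :: real^3)"
  shows "\<exists>Rcrit>0.
    (\<forall>r>0. 2 * r^4 + (9 * I2 - 6 * I1 - 3) * r^2 - 15 * I1 + 45 * I1 * I2 = 0 \<longleftrightarrow> r = Rcrit) \<and>
    (\<forall>r>0. relative_equilibrium I (pair_point I (R r) (\<xi> r)) (\<xi> r) \<and> R r \<bullet> \<xi> r = 0) \<and>
    (\<forall>r>Rcrit. G_mu_stable I (pair_point I (R r) (\<xi> r))) \<and>
    (\<forall>r. 0 < r \<and> r < Rcrit \<longrightarrow> linearly_unstable I (pair_point I (R r) (\<xi> r)) (\<xi> r)) \<and>
    (\<exists>N. open N \<and> (R Rcrit, \<xi> Rcrit) \<in> N \<and>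
       (\<forall>R' \<xi>'. (R', \<xi>') \<in> N \<and> relative_equilibrium I (pair_point I R' \<xi>') \<xi>' \<longrightarrow>
          (\<exists>r>0. R' = R r \<and> \<xi>' = \<xi> r)))"
proof -
  interpret lagrange I1 I2 I3
    by unfold_locales (use assms in auto)
  obtain c where c: "c > 0"
    and root: "\<And>r. r > 0 \<Longrightarrow> 2 * r^4 + (9 * I2 - 6 * I1 - 3) * r^2 - 15 * I1 + 45 * I1 * I2 = 0 \<longleftrightarrow> r = c"
    and above: "\<And>r. r > c \<Longrightarrow> 2 * r^4 + (9 * I2 - 6 * I1 - 3) * r^2 - 15 * I1 + 45 * I1 * I2 > 0"
    and below: "\<And>r. 0 < r \<Longrightarrow> r < c \<Longrightarrow> 2 * r^4 + (9 * I2 - 6 * I1 - 3) * r^2 - 15 * I1 + 45 * I1 * I2 < 0"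
    using critical_radius by blast
  have re: "relative_equilibrium I (pair_point I (R r) (\<xi> r)) (\<xi> r)" "R r \<bullet> \<xi> r = 0" if "r > 0" for r
    using family_relative_equilibrium[OF that, of "xi1 r"] xi1[OF that]
    by (simp_all add: I_def R_def \<xi>_def inner_vec_def sum_3)
  have stable: "G_mu_stable I (pair_point I (R r) (\<xi> r))" if "r > c" for r
  proof -
    have "r > 0" using that c by simp
    then show ?thesis
      using family_G_mu_stable[of r "xi1 r"] xi1[of r] above[OF that] by (simp add: I_def R_def \<xi>_def)
  qed
  have unstable: "linearly_unstable I (pair_point I (R r) (\<xi> r)) (\<xi> r)" if "0 < r" "r < c" for r
    using family_linearly_unstable[of r "xi1 r"] xi1[of r] below[OF that] that by (simp add: I_def R_def \<xi>_def)
  \<comment> \<open>All four inequalities are strict at the critical pair, where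
    \<open>\<xi> $ 2 = 0\<close> and \<open>R $ 1 = 0\<close> make the left sides of the last two
    vanish.\<close>
  define N :: "((real^3) \<times> (real^3)) set" where
    "N = {x. fst x $ 2 > 0 \<and> snd x $ 1 > 0
        \<and> snd x $ 2 * (fst x \<bullet> snd x) * norm (fst x) ^ 5 < 3 * (I3 - I2) * fst x $ 2
        \<and> snd x $ 2 * fst x $ 1 < snd x $ 1 * fst x $ 2}"
  have "open N"
    unfolding N_def by (intro open_Collect_conj open_Collect_less continuous_intros)
  moreover have "(R c, \<xi> c) \<in> N"
    using c xi1[OF c] I_order by (simp add: N_def R_def \<xi>_def)
  moreover have "\<exists>r>0. R' = R r \<and> \<xi>' = \<xi> r"
    if N: "(R', \<xi>') \<in> N" and "relative_equilibrium I (pair_point I R' \<xi>') \<xi>'" for R' \<xi>'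
  proof -
    have pos: "R' $ 2 > 0" "\<xi>' $ 1 > 0" using N by (simp_all add: N_def)
    note eqs = relative_equilibria_nearby[of R' \<xi>', folded I_def, OF that(2) pos]
    \<comment> \<open>The function \<open>xi1\<close> is given through its positivity and its
      square, so equality of squares identifies the angular velocity.\<close>
    have "(\<xi>' $ 1)\<^sup>2 = (xi1 (R' $ 2))\<^sup>2"
      using eqs(3) xi1[OF pos(1)] N by (simp add: N_def)
    then have "\<xi>' $ 1 = xi1 (R' $ 2)"
      by (rule power2_eq_imp_eq) (use pos xi1[OF pos(1)] in auto)
    then show ?thesis
      using eqs(1,2) N pos by (intro exI[of _ "R' $ 2"]) (simp add: N_def R_def \<xi>_def)
  qed
  ultimately have "\<exists>N. open N \<and> (R c, \<xi> c) \<in> N \<and>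
       (\<forall>R' \<xi>'. (R', \<xi>') \<in> N \<and> relative_equilibrium I (pair_point I R' \<xi>') \<xi>' \<longrightarrow>
          (\<exists>r>0. R' = R r \<and> \<xi>' = \<xi> r))" by blast
  then show ?thesis
    using c root re stable unstable by (intro exI[of _ c]) blast
qed

end
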